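(* Let $p$ be a prime, let $n\geq 3$ be an integer, let $A\cong C_{p^n}\times C_p$, and let $G$ be a finite group. Suppose that $C(G)=C(A)$. Then $G$ is a $p$-group and one of the following holds: (1) $G\cong A$. (2) $|G:G'|=p^2$, $p>2$ and $Z(G)$ is noncyclic. In addition, there is a unique maximal subgroup $X$ of $G'$ which is normal in $G$ so that the factor group $G/X$ is nonabelian of order $p^3$ and of exponent $p$.
   Context: All groups are finite. $C_m$ denotes the cyclic group of order $m$, $G'$ the derived subgroup of $G$, and $Z(G)$ the center of $G$. ${\rm Irr}(G)$ denotes the set of complex irreducible characters of $G$. For $\chi\in{\rm Irr}(G)$ the codegree of $\chi$ is ${\rm cod}\,\chi=\frac{|G:\ker\chi|}{\chi(1)}$, and ${\rm Cod}(G)=\{{\rm cod}\,\chi\mid\chi\in{\rm Irr}(G)\}$. The group pseudo-algebra of $G$ is $C(G)=\{(d,m_G(d))\mid d\in{\rm Cod}(G)\}$, where $m_G(d)$ is the number of irreducible characters of $G$ with codegree $d$. *)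

theory Defs
  imports
    "HOL-Algebra.Algebra"
    "HOL-Computational_Algebra.Primes"
    "Jordan_Normal_Form.VS_Connect"
begin

section \<open>Complex irreducible characters\<close>

definition GL :: "nat \<Rightarrow> complex mat monoid" where
  "GL n = units_of (ring_mat TYPE(complex) n ())"

definition representation :: "('a, 'b) monoid_scheme \<Rightarrow> nat \<Rightarrow> ('a \<Rightarrow> complex mat) \<Rightarrow> bool" where
  "representation G n \<rho> \<longleftrightarrow> \<rho> \<in> hom G (GL n)"

definition irreducible_representation ::
  "('a, 'b) monoid_scheme \<Rightarrow> nat \<Rightarrow> ('a \<Rightarrow> complex mat) \<Rightarrow> bool" where
  "irreducible_representation G n \<rho> \<longleftrightarrow>
     representation G n \<rho> \<and> n > 0 \<and>
     (\<forall>W. VectorSpace.subspace class_ring W (module_vec TYPE(complex) n) \<and>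
          (\<forall>g \<in> carrier G. \<forall>v \<in> W. \<rho> g *\<^sub>v v \<in> W)
        \<longrightarrow> W = {0\<^sub>v n} \<or> W = carrier_vec n)"

definition mat_trace :: "complex mat \<Rightarrow> complex" where
  "mat_trace M = (\<Sum>i<dim_row M. M $$ (i, i))"

text \<open>Characters are cut off outside the carrier, so that two of them are equal
  as HOL functions iff they agree on the group; otherwise counting them would be meaningless.\<close>

definition character_of :: "('a, 'b) monoid_scheme \<Rightarrow> ('a \<Rightarrow> complex mat) \<Rightarrow> 'a \<Rightarrow> complex" where
  "character_of G \<rho> = (\<lambda>g \<in> carrier G. mat_trace (\<rho> g))"

definition Irr :: "('a, 'b) monoid_scheme \<Rightarrow> ('a \<Rightarrow> complex) set" where
  "Irr G = {character_of G \<rho> | n \<rho>. irreducible_representation G n \<rho>}"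


section \<open>Codegrees and the group pseudo-algebra\<close>

definition char_ker :: "('a, 'b) monoid_scheme \<Rightarrow> ('a \<Rightarrow> complex) \<Rightarrow> 'a set" where
  "char_ker G \<chi> = {g \<in> carrier G. \<chi> g = \<chi> \<one>\<^bsub>G\<^esub>}"

definition group_index :: "('a, 'b) monoid_scheme \<Rightarrow> 'a set \<Rightarrow> nat" where
  "group_index G H = card (rcosets\<^bsub>G\<^esub> H)"

text \<open>A codegree is a positive integer; it is complex-valued here only because
  it is written as a quotient by \<open>\<chi>(1)\<close>.\<close>

definition cod :: "('a, 'b) monoid_scheme \<Rightarrow> ('a \<Rightarrow> complex) \<Rightarrow> complex" where
  "cod G \<chi> = of_nat (group_index G (char_ker G \<chi>)) / \<chi> \<one>\<^bsub>G\<^esub>"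

definition Cod :: "('a, 'b) monoid_scheme \<Rightarrow> complex set" where
  "Cod G = cod G ` Irr G"

definition cod_mult :: "('a, 'b) monoid_scheme \<Rightarrow> complex \<Rightarrow> nat" where
  "cod_mult G d = card {\<chi> \<in> Irr G. cod G \<chi> = d}"

definition pseudo_algebra :: "('a, 'b) monoid_scheme \<Rightarrow> (complex \<times> nat) set" where
  "pseudo_algebra G = {(d, cod_mult G d) | d. d \<in> Cod G}"


section \<open>Group theory\<close>

definition group_center :: "('a, 'b) monoid_scheme \<Rightarrow> 'a set" where
  "group_center G = {z \<in> carrier G. \<forall>g \<in> carrier G. z \<otimes>\<^bsub>G\<^esub> g = g \<otimes>\<^bsub>G\<^esub> z}"

definition commutator_subgroup :: "('a, 'b) monoid_scheme \<Rightarrow> 'a set" where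
  "commutator_subgroup G = derived G (carrier G)"

definition maximal_subgroup :: "'a set \<Rightarrow> ('a, 'b) monoid_scheme \<Rightarrow> bool" where
  "maximal_subgroup M H \<longleftrightarrow>
     subgroup M H \<and> M \<noteq> carrier H \<and>
     (\<forall>K. subgroup K H \<and> M \<subseteq> K \<longrightarrow> K = M \<or> K = carrier H)"

definition group_exponent :: "('a, 'b) monoid_scheme \<Rightarrow> nat" where
  "group_exponent G = (LEAST e. e > 0 \<and> (\<forall>x \<in> carrier G. x [^]\<^bsub>G\<^esub> e = \<one>\<^bsub>G\<^esub>))"

end

(* Write G' for the derived subgroup of G. All codegrees of G are powers of p, which forces G to be a p-group.
   A character of codegree p is linear, since chi(1)^2 < |G : ker chi| = p chi(1) otherwise. Suppose inductively
   that the characters of codegree at most p^i are linear. The number of linear characters of codegree at most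
   p^(i+1) is a power of p lying between p^(i+1) and p^(i+2); if it is p^(i+2), then all characters of codegree
   at most p^(i+1) are linear. If this works up to i = n, then G is abelian and the counts give its isomorphism type.

   Otherwise, for some a < n, |G : G'| = p^(a+1) and all nonlinear characters have codegree at least p^(a+1).
   So a normal subgroup not containing G' has index at least p^(a+2), and this forces it to lie in G'. If a > 1, let
   x generate a cyclic subgroup of order p^a modulo G'; it follows that <x> contains G', so <x> has index at most p
   and all character degrees are at most p. If a = 1, the characters of codegree p^2 have degree p by the
   inequality above. In both cases the characters of codegree p^(a+1) have degree p and the same kernel, so there
   are at most p^a of them, fewer than the p^(a+2) - p^(a+1) required.

   In particular the second alternative of the theorem never occurs: for |G : G'| = p^2 it is the case a = 1. *)

theory Submission
  imports Defs "Jordan_Normal_Form.Schur_Decomposition" "HOL-Number_Theory.Cong"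
begin

text \<open>One formula drives the proof: for every normal N, the squared degrees of the irreducible
  characters with N in their kernel sum to |G:N|. It is proved inside G, with functions constant on
  the cosets of N, so that no character has to be moved between G and a quotient. It yields the
  bound on nonlinear degrees, the number of linear characters, the fact that N is the intersection
  of the kernels containing it, and the final count. Degrees are powers of p because |G : ker chi|
  is the product of the codegree and the degree.

  For a linear character the codegree is its order in the dual group. So the linear characters of
  codegree at most p^i are the solutions of chi^(p^i) = 1. They form a group, which is why their
  number is a power of p. If no new ones appear at p^(a+1), none appear later, since a power of a
  later one would have order exactly p^(a+1); this is how |G:G'| gets determined.

  Statements about sections of G are phrased as commutation modulo a normal subgroup, again inside
  G.\<close>

section \<open>Matrices\<close>

text \<open>If \<open>b < a\<close>, pad both factors with zeros to square matrices. A one-sided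
  inverse of a square matrix is two-sided, but the padded \<open>B'\<close> has a zero row.\<close>

lemma inner_dim_le:
  fixes A B :: "'a :: field mat"
  assumes A: "A \<in> carrier_mat a b" and B: "B \<in> carrier_mat b a" and AB: "A * B = 1\<^sub>m a"
  shows "a \<le> b"
proof (rule ccontr)
  assume "\<not> a \<le> b"
  hence ba: "b < a" by simp
  define A' where "A' = mat a a (\<lambda>(i,j). if j < b then A $$ (i,j) else 0)"
  define B' where "B' = mat a a (\<lambda>(i,j). if i < b then B $$ (i,j) else 0)"
  have "A' * B' = A * B"
  proof (rule eq_matI)
    fix i j assume "i < dim_row (A * B)" "j < dim_col (A * B)"
    hence ij: "i < a" "j < a" using A B by auto
    have "(A' * B') $$ (i,j) = (\<Sum>k\<in>{0..<a}. if k < b then A $$ (i,k) * B $$ (k,j) else 0)"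
      using ij by (auto simp: A'_def B'_def scalar_prod_def intro!: sum.cong)
    also have "\<dots> = (\<Sum>k\<in>{0..<b}. A $$ (i,k) * B $$ (k,j))"
      using ba by (intro sum.mono_neutral_cong_right) auto
    also have "\<dots> = (A * B) $$ (i,j)"
      using ij A B by (auto simp: scalar_prod_def)
    finally show "(A' * B') $$ (i,j) = (A * B) $$ (i,j)" .
  qed (use A B in \<open>auto simp: A'_def B'_def\<close>)
  hence "A' * B' = 1\<^sub>m a" using AB by simp
  moreover have c: "A' \<in> carrier_mat a a" "B' \<in> carrier_mat a a" by (auto simp: A'_def B'_def)
  ultimately have "B' * A' = 1\<^sub>m a" by (rule mat_mult_left_right_inverse[rotated 2])
  hence "(B' * A') $$ (b,b) = 1" using ba by simp
  moreover have "(B' * A') $$ (b,b) = 0"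
    using ba by (auto simp: A'_def B'_def scalar_prod_def)
  ultimately show False by simp
qed

lemma det_nonzero_inverse:
  fixes A :: "complex mat"
  assumes "A \<in> carrier_mat n n" "det A \<noteq> 0"
  obtains B where "B \<in> carrier_mat n n" "A * B = 1\<^sub>m n" "B * A = 1\<^sub>m n"
proof -
  have "A \<in> Units (ring_mat TYPE(complex) n ())" by (rule det_non_zero_imp_unit[OF assms])
  thus ?thesis using that by (auto simp: Units_def ring_mat_def)
qed

definition inj_mat :: "complex mat \<Rightarrow> bool" where
  "inj_mat S \<longleftrightarrow> (\<forall>c \<in> carrier_vec (dim_col S). S *\<^sub>v c = 0\<^sub>v (dim_row S) \<longrightarrow> c = 0\<^sub>v (dim_col S))"

lemma inj_matD:
  "\<lbrakk>inj_mat S; S \<in> carrier_mat n m; c \<in> carrier_vec m; S *\<^sub>v c = 0\<^sub>v n\<rbrakk> \<Longrightarrow> c = 0\<^sub>v m"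
  by (auto simp: inj_mat_def)

lemma inj_mat_cancel:
  assumes "inj_mat S" "S \<in> carrier_mat n m" "A \<in> carrier_mat m k" "B \<in> carrier_mat m k" "S * A = S * B"
  shows "A = B"
proof -
  have "col (A - B) j = 0\<^sub>v m" if j: "j < k" for j
  proof (rule inj_matD[OF assms(1,2)])
    show "col (A - B) j \<in> carrier_vec m" using assms(3,4) by (intro carrier_vecI) simp
    have "S *\<^sub>v col (A - B) j = col (S * (A - B)) j" using assms j by (intro col_mult2[symmetric]) auto
    also have "S * (A - B) = 0\<^sub>m n k"
      using assms by (simp add: mult_minus_distrib_mat[of S n m] minus_r_inv_mat[of _ n k])
    finally show "S *\<^sub>v col (A - B) j = 0\<^sub>v n" using j by (auto intro!: eq_vecI) 
  qed
  hence "(A - B) $$ (i,j) = 0" if "i < m" "j < k" for i j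
    using that assms by (metis (no_types, lifting) carrier_matD(1,2) index_col index_zero_vec(1) minus_carrier_mat)
  thus ?thesis using assms by (intro eq_matI) auto
qed

text \<open>With more columns than rows, padding by zero rows gives a singular square matrix, and
  its kernel vectors are killed by \<open>S\<close> as well.\<close>

lemma inj_mat_dim_le:
  assumes "inj_mat S" "S \<in> carrier_mat n m"
  shows "m \<le> n"
proof (rule ccontr)
  assume "\<not> m \<le> n"
  hence nm: "n < m" by simp
  define S' where "S' = mat m m (\<lambda>(i,j). if i < n then S $$ (i,j) else 0)"
  have S': "S' \<in> carrier_mat m m" by (simp add: S'_def)
  have "det S' = 0"
  proof (rule ccontr)
    assume "det S' \<noteq> 0"
    then obtain B where B: "B \<in> carrier_mat m m" "S' * B = 1\<^sub>m m"
      using det_nonzero_inverse[OF S'] by metis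
    hence "(S' * B) $$ (n,n) = 1" using nm by simp
    moreover have "(S' * B) $$ (n,n) = 0"
      using nm B(1) by (auto simp: S'_def scalar_prod_def)
    ultimately show False by simp
  qed
  then obtain v where v: "v \<in> carrier_vec m" "v \<noteq> 0\<^sub>v m" "S' *\<^sub>v v = 0\<^sub>v m"
    using det_0_iff_vec_prod_zero[OF S'] by auto
  have "S *\<^sub>v v = 0\<^sub>v n"
  proof (rule eq_vecI)
    fix i assume i: "i < dim_vec (0\<^sub>v n :: complex vec)"
    have "(S *\<^sub>v v) $ i = (S' *\<^sub>v v) $ i"
      using i assms(2) nm v(1) by (simp add: S'_def scalar_prod_def)
    thus "(S *\<^sub>v v) $ i = 0\<^sub>v n $ i" using i nm v(3) by simp
  qed (use assms in auto)
  thus False using inj_matD[OF assms] v by auto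
qed

lemma inj_mat_square_surj:
  assumes "inj_mat S" "S \<in> carrier_mat n n" "v \<in> carrier_vec n"
  shows "\<exists>c \<in> carrier_vec n. S *\<^sub>v c = v"
proof -
  have "det S \<noteq> 0"
    using det_0_iff_vec_prod_zero[OF assms(2)] inj_matD[OF assms(1,2)] by auto
  then obtain B where B: "B \<in> carrier_mat n n" "S * B = 1\<^sub>m n"
    using det_nonzero_inverse[OF assms(2)] by metis
  have "S *\<^sub>v (B *\<^sub>v v) = v"
    using B assms by (metis assoc_mult_mat_vec one_mult_mat_vec)
  thus ?thesis using B assms by (intro bexI[of _ "B *\<^sub>v v"]) auto
qed

lemma inj_mat_mult:
  assumes "inj_mat S" "S \<in> carrier_mat n m" "inj_mat T" "T \<in> carrier_mat m k"
  shows "inj_mat (S * T)"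
  unfolding inj_mat_def
proof (intro ballI impI)
  fix c assume c: "c \<in> carrier_vec (dim_col (S * T))" "S * T *\<^sub>v c = 0\<^sub>v (dim_row (S * T))"
  hence ck: "c \<in> carrier_vec k" using assms by simp
  hence "S *\<^sub>v (T *\<^sub>v c) = 0\<^sub>v n" using c assms by (simp add: assoc_mult_mat_vec)
  hence "T *\<^sub>v c = 0\<^sub>v m" using inj_matD[OF assms(1,2)] ck assms(4) by auto
  thus "c = 0\<^sub>v (dim_col (S * T))" using inj_matD[OF assms(3,4) ck] assms by simp
qed

text \<open>Bases are encoded as matrices: the columns of \<open>S\<close> form a basis of \<open>W\<close> iff
  \<open>inj_mat S\<close> and \<open>mat_range S = W\<close>.\<close>

definition mat_range :: "complex mat \<Rightarrow> complex vec set" where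
  "mat_range S = (\<lambda>c. S *\<^sub>v c) ` carrier_vec (dim_col S)"

text \<open>The locale notion of subspace from the definition of irreducibility, restated as plain
  closure conditions; \<open>lin_subspace_iff\<close> is the bridge.\<close>

definition lin_subspace :: "nat \<Rightarrow> complex vec set \<Rightarrow> bool" where
  "lin_subspace n W \<longleftrightarrow> W \<subseteq> carrier_vec n \<and> 0\<^sub>v n \<in> W \<and>
     (\<forall>v\<in>W. \<forall>w\<in>W. v + w \<in> W) \<and> (\<forall>a. \<forall>v\<in>W. a \<cdot>\<^sub>v v \<in> W)"

lemma lin_subspace_iff:
  "lin_subspace n W \<longleftrightarrow> VectorSpace.subspace class_ring W (module_vec TYPE(complex) n)"
proof -
  interpret vectorspace "class_ring :: complex ring" "module_vec TYPE(complex) n" by (rule vec_vs)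
  have "submodule class_ring W (module_vec TYPE(complex) n) \<longleftrightarrow> lin_subspace n W"
    unfolding submodule_def lin_subspace_def using module_axioms
    by (auto simp: module_vec_simps class_ring_simps)
  thus ?thesis
    unfolding subspace_def using vectorspace_axioms by auto
qed

lemma lin_subspace_range:
  assumes "S \<in> carrier_mat n m"
  shows "lin_subspace n (mat_range S)"
  unfolding lin_subspace_def mat_range_def
proof (intro conjI ballI allI)
  show "(\<lambda>c. S *\<^sub>v c) ` carrier_vec (dim_col S) \<subseteq> carrier_vec n" using assms by auto
  show "0\<^sub>v n \<in> (\<lambda>c. S *\<^sub>v c) ` carrier_vec (dim_col S)"
    using assms by (intro image_eqI[of _ _ "0\<^sub>v m"]) auto
next
  fix v w assume "v \<in> (\<lambda>c. S *\<^sub>v c) ` carrier_vec (dim_col S)" "w \<in> (\<lambda>c. S *\<^sub>v c) ` carrier_vec (dim_col S)"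
  then obtain c d where "c \<in> carrier_vec m" "d \<in> carrier_vec m" "v = S *\<^sub>v c" "w = S *\<^sub>v d" using assms by auto
  thus "v + w \<in> (\<lambda>c. S *\<^sub>v c) ` carrier_vec (dim_col S)"
    using assms by (intro image_eqI[of _ _ "c + d"]) (auto simp: mult_add_distrib_mat_vec)
next
  fix a v assume "v \<in> (\<lambda>c. S *\<^sub>v c) ` carrier_vec (dim_col S)"
  then obtain c where "c \<in> carrier_vec m" "v = S *\<^sub>v c" using assms by auto
  thus "a \<cdot>\<^sub>v v \<in> (\<lambda>c. S *\<^sub>v c) ` carrier_vec (dim_col S)"
    using assms by (intro image_eqI[of _ _ "a \<cdot>\<^sub>v c"]) (auto simp: mult_mat_vec)
qed

text \<open>The number of independent columns inside \<open>W\<close> is bounded by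
  \<open>n\<close>. A matrix with the maximal number spans \<open>W\<close>, since a vector outside
  its range could be appended as a further independent column.\<close>

lemma subspace_basis:
  assumes W: "lin_subspace n W"
  obtains m S where "S \<in> carrier_mat n m" "inj_mat S" "mat_range S = W"
proof -
  define P where "P m \<longleftrightarrow> (\<exists>S \<in> carrier_mat n m. inj_mat S \<and> mat_range S \<subseteq> W)" for m
  have P0: "P 0" unfolding P_def
  proof (intro bexI conjI)
    show "(0\<^sub>m n 0 :: complex mat) \<in> carrier_mat n 0" by simp
    show "inj_mat (0\<^sub>m n 0)" by (auto simp: inj_mat_def)
    have "mat_range (0\<^sub>m n 0) \<subseteq> {0\<^sub>v n}" by (auto simp: mat_range_def scalar_prod_def intro!: eq_vecI)
    thus "mat_range (0\<^sub>m n 0) \<subseteq> W" using W by (auto simp: lin_subspace_def)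
  qed
  have Pn: "m \<le> n" if "P m" for m using that inj_mat_dim_le unfolding P_def by auto
  define m where "m = Greatest P"
  have Pm: "P m" unfolding m_def using P0 Pn by (rule GreatestI_nat)
  have mx: "k \<le> m" if "P k" for k unfolding m_def using that Pn by (rule Greatest_le_nat)
  obtain S where S: "S \<in> carrier_mat n m" "inj_mat S" "mat_range S \<subseteq> W" using Pm by (auto simp: P_def)
  have "W \<subseteq> mat_range S"
  proof (rule ccontr)
    assume "\<not> W \<subseteq> mat_range S"
    then obtain w where w: "w \<in> W" "w \<notin> mat_range S" by auto
    have wc: "w \<in> carrier_vec n" using w W by (auto simp: lin_subspace_def)
    define T where "T = mat n (Suc m) (\<lambda>(i,j). if j < m then S $$ (i,j) else w $ i)"
    have T: "T \<in> carrier_mat n (Suc m)" by (simp add: T_def)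
    have Tc: "T *\<^sub>v c = S *\<^sub>v vec m (($) c) + c $ m \<cdot>\<^sub>v w" if c: "c \<in> carrier_vec (Suc m)" for c
    proof (rule eq_vecI)
      fix i assume "i < dim_vec (S *\<^sub>v vec m (($) c) + c $ m \<cdot>\<^sub>v w)"
      hence i: "i < n" using wc by simp
      have "(T *\<^sub>v c) $ i = (\<Sum>j\<in>{0..<Suc m}. (if j < m then S $$ (i,j) else w $ i) * c $ j)"
        using i c by (auto simp: T_def scalar_prod_def)
      also have "\<dots> = (S *\<^sub>v vec m (($) c) + c $ m \<cdot>\<^sub>v w) $ i"
        using i S wc by (simp add: scalar_prod_def)
      finally show "(T *\<^sub>v c) $ i = (S *\<^sub>v vec m (($) c) + c $ m \<cdot>\<^sub>v w) $ i" .
    qed (use wc T in auto)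
    have "inj_mat T" unfolding inj_mat_def
    proof (intro ballI impI)
      fix c assume "c \<in> carrier_vec (dim_col T)" "T *\<^sub>v c = 0\<^sub>v (dim_row T)"
      hence c: "c \<in> carrier_vec (Suc m)" and 0: "S *\<^sub>v vec m (($) c) + c $ m \<cdot>\<^sub>v w = 0\<^sub>v n"
        using T Tc by auto
      \<comment> \<open>A nonzero last coefficient could be divided out and would express
        \<open>w\<close> through the columns of \<open>S\<close>.\<close>
      have cm: "c $ m = 0"
      proof (rule ccontr)
        assume nz: "c $ m \<noteq> 0"
        have "w = S *\<^sub>v (- (1 / c $ m) \<cdot>\<^sub>v vec m (($) c))"
        proof (rule eq_vecI)
          fix i assume "i < dim_vec (S *\<^sub>v (- (1 / c $ m) \<cdot>\<^sub>v vec m (($) c)))"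
          hence i: "i < n" using S by simp
          have "(S *\<^sub>v vec m (($) c) + c $ m \<cdot>\<^sub>v w) $ i = 0" using 0 i by simp
          hence "(S *\<^sub>v vec m (($) c)) $ i + c $ m * w $ i = 0" using i wc S by simp
          hence "w $ i = - (1 / c $ m) * (S *\<^sub>v vec m (($) c)) $ i"
            using nz by (simp add: field_simps eq_neg_iff_add_eq_0)
          also have "\<dots> = (S *\<^sub>v (- (1 / c $ m) \<cdot>\<^sub>v vec m (($) c))) $ i"
            using i S by (subst mult_mat_vec[OF S(1)]) auto
          finally show "w $ i = (S *\<^sub>v (- (1 / c $ m) \<cdot>\<^sub>v vec m (($) c))) $ i" .
        qed (use wc S in auto)
        hence "w \<in> mat_range S" using S by (auto simp: mat_range_def)
        thus False using w by simp
      qed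
      moreover have "0 \<cdot>\<^sub>v w = 0\<^sub>v n" using wc by (intro eq_vecI) auto
      ultimately have "S *\<^sub>v vec m (($) c) = 0\<^sub>v n" using 0 S by simp
      hence "vec m (($) c) = 0\<^sub>v m" using inj_matD[OF S(2,1)] by auto
      hence "c $ i = 0" if "i < m" for i using that by (metis index_vec index_zero_vec(1))
      thus "c = 0\<^sub>v (dim_col T)" using c cm T by (intro eq_vecI) (auto simp: less_Suc_eq)
    qed
    moreover have "mat_range T \<subseteq> W"
    proof
      fix v assume "v \<in> mat_range T"
      then obtain c where c: "c \<in> carrier_vec (Suc m)" "v = T *\<^sub>v c" using T by (auto simp: mat_range_def)
      have "S *\<^sub>v vec m (($) c) \<in> W" using S by (auto simp: mat_range_def)
      thus "v \<in> W" using W w c Tc by (auto simp: lin_subspace_def)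
    qed
    ultimately have "P (Suc m)" using T by (auto simp: P_def)
    thus False using mx by fastforce
  qed
  thus ?thesis using that S by blast
qed

text \<open>Used to read off the matrix of a linear map in the basis given by the columns of
  \<open>M\<close>.\<close>

lemma mat_range_factor:
  assumes M: "M \<in> carrier_mat n k" and A: "A \<in> carrier_mat n l"
    and col: "\<And>j. j < l \<Longrightarrow> col A j \<in> mat_range M"
  obtains D where "D \<in> carrier_mat k l" "A = M * D"
proof -
  have "\<exists>c \<in> carrier_vec k. col A j = M *\<^sub>v c" if "j < l" for j
    using col[OF that] M by (auto simp: mat_range_def)
  then obtain c where c: "\<And>j. j < l \<Longrightarrow> c j \<in> carrier_vec k" "\<And>j. j < l \<Longrightarrow> col A j = M *\<^sub>v c j" by metis
  define D where "D = mat k l (\<lambda>(i,j). c j $ i)"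
  have D: "D \<in> carrier_mat k l" by (simp add: D_def)
  have "A = M * D"
  proof (rule mat_col_eqI)
    fix j assume "j < dim_col (M * D)"
    hence j: "j < l" using D by simp
    have "col D j = c j" using c(1)[OF j] j by (intro eq_vecI) (auto simp: D_def)
    thus "col A j = col (M * D) j" using col_mult2[OF M D j] c(2)[OF j] by simp
  qed (use A M D in auto)
  thus ?thesis using that D by blast
qed

lemma trace_cyclic:
  assumes "A \<in> carrier_mat n m" "B \<in> carrier_mat m n"
  shows "mat_trace (A * B) = mat_trace (B * A)"
proof -
  have "mat_trace (A * B) = (\<Sum>i<n. \<Sum>k<m. A $$ (i,k) * B $$ (k,i))"
    using assms by (auto simp: mat_trace_def scalar_prod_def lessThan_atLeast0)
  also have "\<dots> = (\<Sum>k<m. \<Sum>i<n. B $$ (k,i) * A $$ (i,k))"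
    by (subst sum.swap) (simp add: mult.commute)
  also have "\<dots> = mat_trace (B * A)"
    using assms by (auto simp: mat_trace_def scalar_prod_def lessThan_atLeast0)
  finally show ?thesis .
qed

section \<open>Representations\<close>

lemma GL_simps [simp]:
  "carrier (GL n) = {A \<in> carrier_mat n n. \<exists>B \<in> carrier_mat n n. B * A = 1\<^sub>m n \<and> A * B = 1\<^sub>m n}"
  "monoid.mult (GL n) = (*)" "one (GL n) = 1\<^sub>m n"
  by (auto simp: GL_def units_of_def Units_def ring_mat_def)

lemma mat_eq_zeroI:
  fixes T :: "'a :: comm_ring_1 mat"
  assumes T: "T \<in> carrier_mat m n" and 0: "\<And>v. v \<in> carrier_vec n \<Longrightarrow> T *\<^sub>v v = 0\<^sub>v m"
  shows "T = 0\<^sub>m m n"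
proof (rule eq_matI)
  fix i j assume "i < dim_row (0\<^sub>m m n :: 'a mat)" "j < dim_col (0\<^sub>m m n :: 'a mat)"
  hence ij: "i < m" "j < n" by auto
  have "(T *\<^sub>v unit_vec n j) $ i = 0" using 0[of "unit_vec n j"] ij by simp
  thus "T $$ (i,j) = 0\<^sub>m m n $$ (i,j)" using T ij by simp
qed (use T in auto)

context group
begin

lemma representationI:
  assumes "\<And>g. g \<in> carrier G \<Longrightarrow> \<rho> g \<in> carrier_mat n n"
    and "\<And>g h. \<lbrakk>g \<in> carrier G; h \<in> carrier G\<rbrakk> \<Longrightarrow> \<rho> (g \<otimes> h) = \<rho> g * \<rho> h"
    and "\<rho> \<one> = 1\<^sub>m n"
  shows "representation G n \<rho>"
proof -
  have "\<exists>B \<in> carrier_mat n n. B * \<rho> g = 1\<^sub>m n \<and> \<rho> g * B = 1\<^sub>m n" if g: "g \<in> carrier G" for g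
    using assms(1)[of "inv g"] assms(2)[of g "inv g"] assms(2)[of "inv g" g] assms(3) g
    by (intro bexI[of _ "\<rho> (inv g)"]) auto
  thus ?thesis using assms(1,2) by (auto simp: representation_def hom_def)
qed

lemma rep_carrier: "representation G n \<rho> \<Longrightarrow> g \<in> carrier G \<Longrightarrow> \<rho> g \<in> carrier_mat n n"
  by (auto simp: representation_def hom_def)

lemma rep_mult:
  "representation G n \<rho> \<Longrightarrow> g \<in> carrier G \<Longrightarrow> h \<in> carrier G \<Longrightarrow> \<rho> (g \<otimes> h) = \<rho> g * \<rho> h"
  by (auto simp: representation_def hom_def)

lemma rep_one:
  assumes r: "representation G n \<rho>"
  shows "\<rho> \<one> = 1\<^sub>m n"
proof -
  obtain B where B: "B \<in> carrier_mat n n" "B * \<rho> \<one> = 1\<^sub>m n"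
    using r by (auto simp: representation_def hom_def Pi_def)
  have c: "\<rho> \<one> \<in> carrier_mat n n" using rep_carrier[OF r] by simp
  have "\<rho> \<one> = (B * \<rho> \<one>) * \<rho> \<one>" using B c by simp
  also have "\<dots> = B * (\<rho> \<one> * \<rho> \<one>)" using B c by (intro assoc_mult_mat) auto
  also have "\<rho> \<one> * \<rho> \<one> = \<rho> \<one>" using rep_mult[OF r, of \<one> \<one>] by simp
  finally show ?thesis using B by simp
qed

lemma rep_inv:
  assumes r: "representation G n \<rho>" and g: "g \<in> carrier G"
  shows "\<rho> g * \<rho> (inv g) = 1\<^sub>m n" "\<rho> (inv g) * \<rho> g = 1\<^sub>m n"
  using rep_mult[OF r, of g "inv g"] rep_mult[OF r, of "inv g" g] rep_one[OF r] g by auto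

lemma rep_pow:
  assumes r: "representation G n \<rho>" and g: "g \<in> carrier G"
  shows "\<rho> (g [^] (k::nat)) = \<rho> g ^\<^sub>m k"
proof (induction k)
  case 0
  thus ?case using rep_one[OF r] rep_carrier[OF r g] by simp
next
  case (Suc k)
  thus ?case using rep_mult[OF r, of "g [^] k" g] g by simp
qed

lemma irr_iff:
  "irreducible_representation G n \<rho> \<longleftrightarrow> representation G n \<rho> \<and> n > 0 \<and>
     (\<forall>W. lin_subspace n W \<and> (\<forall>g \<in> carrier G. \<forall>v \<in> W. \<rho> g *\<^sub>v v \<in> W) \<longrightarrow> W = {0\<^sub>v n} \<or> W = carrier_vec n)"
  by (simp add: irreducible_representation_def lin_subspace_iff)

lemma irrD:
  assumes "irreducible_representation G n \<rho>"
  shows "representation G n \<rho>" "n > 0"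
    "\<lbrakk>lin_subspace n W; \<And>g v. g \<in> carrier G \<Longrightarrow> v \<in> W \<Longrightarrow> \<rho> g *\<^sub>v v \<in> W\<rbrakk> \<Longrightarrow> W = {0\<^sub>v n} \<or> W = carrier_vec n"
  using assms unfolding irr_iff by blast+

text \<open>Range and kernel of \<open>T\<close> are invariant, so \<open>T\<close> is onto and
  injective. The two dimensions may differ a priori: surjectivity gives a right inverse and hence
  \<open>m \<le> n\<close>, injectivity gives \<open>n \<le> m\<close>.\<close>

lemma schur:
  assumes i1: "irreducible_representation G n \<rho>" and i2: "irreducible_representation G m \<sigma>"
    and T: "T \<in> carrier_mat m n" and eq: "\<And>g. g \<in> carrier G \<Longrightarrow> \<sigma> g * T = T * \<rho> g"
    and nz: "T \<noteq> 0\<^sub>m m n"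
  obtains R where "m = n" "R \<in> carrier_mat n n" "T * R = 1\<^sub>m n" "R * T = 1\<^sub>m n"
proof -
  note r1 = irrD(1)[OF i1] and r2 = irrD(1)[OF i2]
  have Tv: "\<sigma> g *\<^sub>v (T *\<^sub>v v) = T *\<^sub>v (\<rho> g *\<^sub>v v)" if "g \<in> carrier G" "v \<in> carrier_vec n" for g v
    using eq that T rep_carrier[OF r1, of g] rep_carrier[OF r2, of g]
    by (metis assoc_mult_mat_vec)
  have range: "mat_range T = carrier_vec m"
  proof -
    have "mat_range T = {0\<^sub>v m} \<or> mat_range T = carrier_vec m"
    proof (rule irrD(3)[OF i2 lin_subspace_range[OF T]])
      fix g v assume "g \<in> carrier G" "v \<in> mat_range T"
      thus "\<sigma> g *\<^sub>v v \<in> mat_range T"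
        using Tv[of g] rep_carrier[OF r1, of g] T
        by (auto simp: mat_range_def intro!: imageI)
    qed
    moreover have "mat_range T \<noteq> {0\<^sub>v m}"
      using mat_eq_zeroI[OF T] nz T by (auto simp: mat_range_def)
    ultimately show ?thesis by auto
  qed
  have inj: "inj_mat T"
  proof -
    define K where "K = {v \<in> carrier_vec n. T *\<^sub>v v = 0\<^sub>v m}"
    have "K = {0\<^sub>v n} \<or> K = carrier_vec n"
    proof (rule irrD(3)[OF i1])
      show "lin_subspace n K"
        using T by (auto simp: lin_subspace_def K_def mult_add_distrib_mat_vec mult_mat_vec)
      fix g v assume g: "g \<in> carrier G" and v: "v \<in> K"
      have "T *\<^sub>v (\<rho> g *\<^sub>v v) = \<sigma> g *\<^sub>v 0\<^sub>v m" using Tv[OF g, of v] v by (simp add: K_def)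
      also have "\<dots> = 0\<^sub>v m" using rep_carrier[OF r2 g] by auto
      finally show "\<rho> g *\<^sub>v v \<in> K" using rep_carrier[OF r1 g] v by (auto simp: K_def)
    qed
    moreover have "K \<noteq> carrier_vec n"
      using mat_eq_zeroI[OF T] nz by (auto simp: K_def)
    ultimately show ?thesis using T by (auto simp: inj_mat_def K_def)
  qed
  have "\<exists>c \<in> carrier_vec n. T *\<^sub>v c = unit_vec m j" for j
  proof -
    have "unit_vec m j \<in> mat_range T" using range by simp
    thus ?thesis using T by (auto simp: mat_range_def)
  qed
  then obtain c where c: "\<And>j. c j \<in> carrier_vec n" "\<And>j. T *\<^sub>v c j = unit_vec m j" by metis
  define R where "R = mat n m (\<lambda>(i,j). c j $ i)"
  have R: "R \<in> carrier_mat n m" by (simp add: R_def)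
  have colR: "col R j = c j" if "j < m" for j
    using that c(1)[of j] by (intro eq_vecI) (auto simp: R_def)
  have TR: "T * R = 1\<^sub>m m"
  proof (rule eq_matI)
    fix i j assume ij: "i < dim_row (1\<^sub>m m :: complex mat)" "j < dim_col (1\<^sub>m m :: complex mat)"
    hence "(T * R) $$ (i,j) = col (T * R) j $ i" using T R by simp
    also have "col (T * R) j = unit_vec m j" using col_mult2[OF T R] colR c ij by simp
    finally show "(T * R) $$ (i,j) = 1\<^sub>m m $$ (i,j)" using ij by (auto simp: unit_vec_def)
  qed (use T R in auto)
  have mn: "m = n"
    using inner_dim_le[OF T R TR] inj_mat_dim_le[OF inj T] by simp
  moreover have "R * T = 1\<^sub>m n" using mat_mult_left_right_inverse[of T n R] T R TR mn by simp
  ultimately show ?thesis using that R TR by simp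
qed

text \<open>\<open>T\<close> has a complex eigenvalue \<open>c\<close>, so \<open>T - c\<close> is
  an intertwiner with a nonzero kernel, hence zero.\<close>

lemma schur_scalar:
  assumes i: "irreducible_representation G n \<rho>" and T: "T \<in> carrier_mat n n"
    and eq: "\<And>g. g \<in> carrier G \<Longrightarrow> \<rho> g * T = T * \<rho> g"
  obtains c where "T = c \<cdot>\<^sub>m 1\<^sub>m n"
proof -
  have n: "n > 0" by (rule irrD(2)[OF i])
  have "degree (char_poly T) = n" using degree_monic_char_poly[OF T] by simp
  hence "\<not> constant (poly (char_poly T))" using n by (simp add: constant_degree)
  then obtain c where "poly (char_poly T) c = 0" using fundamental_theorem_of_algebra by blast
  hence "eigenvalue T c" using eigenvalue_root_char_poly[OF T] by simp
  then obtain v where v: "v \<in> carrier_vec n" "v \<noteq> 0\<^sub>v n" "T *\<^sub>v v = c \<cdot>\<^sub>v v"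
    using T by (auto simp: eigenvalue_def eigenvector_def)
  define S where "S = T - c \<cdot>\<^sub>m 1\<^sub>m n"
  have S: "S \<in> carrier_mat n n" unfolding S_def by (rule minus_carrier_mat) simp
  have "S *\<^sub>v v = 0\<^sub>v n"
  proof -
    have "S *\<^sub>v v = T *\<^sub>v v - (c \<cdot>\<^sub>m 1\<^sub>m n) *\<^sub>v v"
      unfolding S_def using T v by (intro minus_mult_distrib_mat_vec) auto
    moreover have "(c \<cdot>\<^sub>m 1\<^sub>m n) *\<^sub>v v = c \<cdot>\<^sub>v v"
      using v by (intro eq_vecI) (auto simp: scalar_prod_def if_distrib[of "\<lambda>x. _ * x"] if_distrib[of "\<lambda>x. x * _"] cong: if_cong)
    ultimately show ?thesis using v by simp
  qed
  have "S = 0\<^sub>m n n"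
  proof (rule ccontr)
    assume nz: "S \<noteq> 0\<^sub>m n n"
    have "\<rho> g * S = S * \<rho> g" if g: "g \<in> carrier G" for g
      using eq[OF g] T rep_carrier[OF irrD(1)[OF i] g]
      by (simp add: S_def mult_minus_distrib_mat minus_mult_distrib_mat[of _ n n] mult_smult_distrib[of "\<rho> g" n n "1\<^sub>m n" n] mult_smult_assoc_mat[of _ n n])
    from schur[OF i i S this nz] obtain R where R: "R \<in> carrier_mat n n" "R * S = 1\<^sub>m n" by metis
    have "v = R *\<^sub>v (S *\<^sub>v v)" using R S v by (metis assoc_mult_mat_vec one_mult_mat_vec)
    thus False using \<open>S *\<^sub>v v = 0\<^sub>v n\<close> R v by auto
  qed
  have "T = c \<cdot>\<^sub>m 1\<^sub>m n"
  proof (rule eq_matI)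
    fix i j assume ij: "i < dim_row (c \<cdot>\<^sub>m 1\<^sub>m n)" "j < dim_col (c \<cdot>\<^sub>m 1\<^sub>m n)"
    hence "S $$ (i,j) = 0" using \<open>S = 0\<^sub>m n n\<close> by simp
    thus "T $$ (i,j) = (c \<cdot>\<^sub>m 1\<^sub>m n) $$ (i,j)" using ij T by (simp add: S_def)
  qed (use T in auto)
  thus ?thesis by (rule that)
qed

end

text \<open>The two families are the factors of an identity matrix of size \<open>card J\<close>
  with inner dimension \<open>card Y\<close>. This is what bounds the number of irreducible
  characters.\<close>

lemma biorthogonal_card_le:
  fixes u w :: "'i \<Rightarrow> 'x \<Rightarrow> 'c :: field"
  assumes "finite J" "finite Y"
    and orth: "\<And>i j. i \<in> J \<Longrightarrow> j \<in> J \<Longrightarrow> (\<Sum>x\<in>Y. u i x * w j x) = (if i = j then 1 else 0)"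
  shows "card J \<le> card Y"
proof -
  obtain f where f: "bij_betw f {0..<card J} J" using ex_bij_betw_nat_finite[OF assms(1)] by blast
  obtain h where h: "bij_betw h {0..<card Y} Y" using ex_bij_betw_nat_finite[OF assms(2)] by blast
  define A where "A = mat (card J) (card Y) (\<lambda>(a,b). u (f a) (h b))"
  define B where "B = mat (card Y) (card J) (\<lambda>(b,a). w (f a) (h b))"
  have "A * B = 1\<^sub>m (card J)"
  proof (rule eq_matI)
    fix a b assume "a < dim_row (1\<^sub>m (card J) :: 'c mat)" "b < dim_col (1\<^sub>m (card J) :: 'c mat)"
    hence ab: "a < card J" "b < card J" by auto
    have "(A * B) $$ (a,b) = (\<Sum>k\<in>{0..<card Y}. u (f a) (h k) * w (f b) (h k))"
      using ab by (simp add: A_def B_def scalar_prod_def)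
    also have "\<dots> = (\<Sum>x\<in>Y. u (f a) x * w (f b) x)" by (rule sum.reindex_bij_betw[OF h])
    also have "\<dots> = (if f a = f b then 1 else 0)"
      using ab f by (intro orth) (auto simp: bij_betw_def)
    also have "f a = f b \<longleftrightarrow> a = b" using ab f by (auto simp: bij_betw_def inj_on_def)
    finally show "(A * B) $$ (a,b) = 1\<^sub>m (card J) $$ (a,b)" using ab by simp
  qed (auto simp: A_def B_def)
  thus ?thesis by (intro inner_dim_le[of A _ _ B]) (auto simp: A_def B_def)
qed

lemma (in group) inv_mult_cancel [simp]:
  "g \<in> carrier G \<Longrightarrow> x \<in> carrier G \<Longrightarrow> inv g \<otimes> (g \<otimes> x) = x"
  "g \<in> carrier G \<Longrightarrow> x \<in> carrier G \<Longrightarrow> g \<otimes> (inv g \<otimes> x) = x"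
  by (simp_all add: m_assoc[symmetric])

section \<open>Orthogonality relations\<close>

locale fin_group = group G for G (structure) +
  assumes finite_carrier: "finite (carrier G)"
begin

lemma order_pos: "Coset.order G > 0"
  using finite_carrier by (auto simp: Coset.order_def card_gt_0_iff)

text \<open>\<open>T\<close> is the average of the \<open>\<sigma>(g) * E\<^sub>j\<^sub>k * \<rho>(g\<inverse>)\<close>, where \<open>E\<^sub>j\<^sub>k\<close> is a matrix unit.\<close>

lemma matrix_unit_intertwiner:
  assumes r: "representation G n \<rho>" and s: "representation G m \<sigma>" and jk: "j < m" "k < n"
    and h: "h \<in> carrier G"
  defines "T \<equiv> mat m n (\<lambda>(i,l). \<Sum>g\<in>carrier G. \<sigma> g $$ (i,j) * \<rho> (inv g) $$ (k,l))"
  shows "\<sigma> h * T = T * \<rho> h"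
proof (rule eq_matI)
  note rc = rep_carrier[OF r] and sc = rep_carrier[OF s]
  fix i l assume "i < dim_row (T * \<rho> h)" "l < dim_col (T * \<rho> h)"
  hence il: "i < m" "l < n" using rc[OF h] by (auto simp: T_def)
  have "(\<sigma> h * T) $$ (i,l) = (\<Sum>a\<in>{0..<m}. \<Sum>g\<in>carrier G. \<sigma> h $$ (i,a) * \<sigma> g $$ (a,j) * \<rho> (inv g) $$ (k,l))"
    using il sc[OF h] by (simp add: T_def scalar_prod_def sum_distrib_left mult.assoc)
  also have "\<dots> = (\<Sum>g\<in>carrier G. \<Sum>a\<in>{0..<m}. \<sigma> h $$ (i,a) * \<sigma> g $$ (a,j) * \<rho> (inv g) $$ (k,l))"
    by (rule sum.swap)
  also have "\<dots> = (\<Sum>g\<in>carrier G. \<sigma> (h \<otimes> g) $$ (i,j) * \<rho> (inv g) $$ (k,l))"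
  proof (intro sum.cong refl)
    fix g assume "g \<in> carrier G"
    thus "(\<Sum>a\<in>{0..<m}. \<sigma> h $$ (i,a) * \<sigma> g $$ (a,j) * \<rho> (inv g) $$ (k,l)) = \<sigma> (h \<otimes> g) $$ (i,j) * \<rho> (inv g) $$ (k,l)"
      using il jk sc[OF h] sc[of g] rep_mult[OF s h] by (simp add: scalar_prod_def sum_distrib_right)
  qed
  also have "\<dots> = (\<Sum>g\<in>carrier G. \<sigma> g $$ (i,j) * \<rho> (inv g \<otimes> h) $$ (k,l))"
    using h by (intro sum.reindex_bij_witness[of _ "\<lambda>g. inv h \<otimes> g" "\<lambda>g. h \<otimes> g"])
      (auto simp: inv_mult_group m_assoc)
  also have "\<dots> = (\<Sum>g\<in>carrier G. \<Sum>b\<in>{0..<n}. \<sigma> g $$ (i,j) * (\<rho> (inv g) $$ (k,b) * \<rho> h $$ (b,l)))"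
  proof (intro sum.cong refl)
    fix g assume "g \<in> carrier G"
    thus "\<sigma> g $$ (i,j) * \<rho> (inv g \<otimes> h) $$ (k,l) = (\<Sum>b\<in>{0..<n}. \<sigma> g $$ (i,j) * (\<rho> (inv g) $$ (k,b) * \<rho> h $$ (b,l)))"
      using il jk rc[OF h] rc[of "inv g"] rep_mult[OF r, of "inv g" h] h
      by (simp add: scalar_prod_def sum_distrib_left)
  qed
  also have "\<dots> = (\<Sum>b\<in>{0..<n}. \<Sum>g\<in>carrier G. \<sigma> g $$ (i,j) * \<rho> (inv g) $$ (k,b) * \<rho> h $$ (b,l))"
    by (subst sum.swap) (simp add: mult.assoc)
  also have "\<dots> = (T * \<rho> h) $$ (i,l)"
    using il rc[OF h] by (simp add: T_def scalar_prod_def sum_distrib_right)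
  finally show "(\<sigma> h * T) $$ (i,l) = (T * \<rho> h) $$ (i,l)" .
qed (use rep_carrier[OF r h] rep_carrier[OF s h] in \<open>auto simp: T_def\<close>)

lemma character_of_eq: "g \<in> carrier G \<Longrightarrow> character_of G \<rho> g = mat_trace (\<rho> g)"
  by (simp add: character_of_def)

lemma character_of_one: "representation G n \<rho> \<Longrightarrow> character_of G \<rho> \<one> = of_nat n"
  by (simp add: character_of_eq rep_one mat_trace_def)

lemma similar_imp_same_character:
  assumes r: "representation G n \<rho>" and s: "representation G n \<sigma>"
    and T: "T \<in> carrier_mat n n" "R \<in> carrier_mat n n" "T * R = 1\<^sub>m n" "R * T = 1\<^sub>m n"
    and eq: "\<And>g. g \<in> carrier G \<Longrightarrow> \<sigma> g * T = T * \<rho> g"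
  shows "character_of G \<sigma> = character_of G \<rho>"
proof
  fix g
  show "character_of G \<sigma> g = character_of G \<rho> g"
  proof (cases "g \<in> carrier G")
    case True
    note c = rep_carrier[OF r True] rep_carrier[OF s True]
    have "mat_trace (\<sigma> g) = mat_trace (\<sigma> g * (T * R))" using T c by simp
    also have "\<sigma> g * (T * R) = (T * \<rho> g) * R" using T c eq[OF True] by (metis assoc_mult_mat)
    also have "mat_trace \<dots> = mat_trace (R * (T * \<rho> g))" using T c by (intro trace_cyclic) auto
    also have "R * (T * \<rho> g) = \<rho> g" using T c by (metis assoc_mult_mat left_mult_one_mat)
    finally show ?thesis using True by (simp add: character_of_eq)
  qed (simp add: character_of_def)
qed

text \<open>A nonzero averaged matrix unit would be an invertible intertwiner by Schur, so the two
  representations would be similar and have the same character.\<close>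

lemma orthogonality_neq:
  assumes r: "irreducible_representation G n \<rho>" and s: "irreducible_representation G m \<sigma>"
    and neq: "character_of G \<sigma> \<noteq> character_of G \<rho>"
    and ij: "i < m" "j < m" "k < n" "l < n"
  shows "(\<Sum>g\<in>carrier G. \<sigma> g $$ (i,j) * \<rho> (inv g) $$ (k,l)) = 0"
proof -
  define T where "T = mat m n (\<lambda>(i,l). \<Sum>g\<in>carrier G. \<sigma> g $$ (i,j) * \<rho> (inv g) $$ (k,l))"
  have T: "T \<in> carrier_mat m n" by (simp add: T_def)
  have eq: "\<sigma> h * T = T * \<rho> h" if "h \<in> carrier G" for h
    unfolding T_def using irrD(1)[OF r] irrD(1)[OF s] ij(2,3) that by (rule matrix_unit_intertwiner)
  have "T = 0\<^sub>m m n"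
  proof (rule ccontr)
    assume "T \<noteq> 0\<^sub>m m n"
    from schur[OF r s T eq this] obtain R where "m = n" "R \<in> carrier_mat n n" "T * R = 1\<^sub>m n" "R * T = 1\<^sub>m n" by metis
    thus False using similar_imp_same_character[of n \<rho> \<sigma> T R] irrD(1)[OF r] irrD(1)[OF s] T eq neq by simp
  qed
  hence "T $$ (i,l) = 0" using ij by simp
  thus ?thesis using ij by (simp add: T_def)
qed

text \<open>By Schur the averaged matrix unit is a scalar matrix. The scalar comes from the trace,
  where summing over the diagonal produces entries of
  \<open>\<rho> (inv g) * \<rho> g = 1\<close>.\<close>

lemma orthogonality_eq:
  assumes r: "irreducible_representation G n \<rho>"
    and ij: "i < n" "j < n" "k < n" "l < n"
  shows "(\<Sum>g\<in>carrier G. \<rho> g $$ (i,j) * \<rho> (inv g) $$ (k,l)) =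
    (if i = l \<and> j = k then of_nat (Coset.order G) / of_nat n else 0)"
proof -
  define T where "T = mat n n (\<lambda>(i,l). \<Sum>g\<in>carrier G. \<rho> g $$ (i,j) * \<rho> (inv g) $$ (k,l))"
  have T: "T \<in> carrier_mat n n" by (simp add: T_def)
  note r1 = irrD(1)[OF r]
  have eq: "\<rho> h * T = T * \<rho> h" if "h \<in> carrier G" for h
    unfolding T_def using r1 r1 ij(2,3) that by (rule matrix_unit_intertwiner)
  obtain c where c: "T = c \<cdot>\<^sub>m 1\<^sub>m n" using schur_scalar[OF r T eq] by blast
  have "of_nat n * c = (\<Sum>i\<in>{0..<n}. T $$ (i,i))" by (simp add: c)
  also have "\<dots> = (\<Sum>g\<in>carrier G. \<Sum>i\<in>{0..<n}. \<rho> (inv g) $$ (k,i) * \<rho> g $$ (i,j))"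
    by (subst sum.swap) (simp add: T_def mult.commute)
  also have "\<dots> = (\<Sum>g\<in>carrier G. (\<rho> (inv g) * \<rho> g) $$ (k,j))"
  proof (intro sum.cong refl)
    fix g assume g: "g \<in> carrier G"
    show "(\<Sum>i\<in>{0..<n}. \<rho> (inv g) $$ (k,i) * \<rho> g $$ (i,j)) = (\<rho> (inv g) * \<rho> g) $$ (k,j)"
      using rep_carrier[OF r1 g] rep_carrier[OF r1, of "inv g"] g ij by (simp add: scalar_prod_def)
  qed
  also have "\<dots> = (\<Sum>g\<in>carrier G. if j = k then 1 else 0)"
    using ij by (intro sum.cong) (auto simp: rep_inv[OF r1])
  also have "\<dots> = (if j = k then of_nat (Coset.order G) else 0)" by (simp add: Coset.order_def)
  finally have "c = (if j = k then of_nat (Coset.order G) / of_nat n else 0)"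
    using ij by (auto simp: field_simps split: if_splits)
  moreover have "(\<Sum>g\<in>carrier G. \<rho> g $$ (i,j) * \<rho> (inv g) $$ (k,l)) = T $$ (i,l)"
    using ij by (simp add: T_def)
  ultimately show ?thesis using ij by (simp add: c)
qed

lemma character_inner_expand:
  assumes r: "representation G n \<rho>" and s: "representation G m \<sigma>"
  shows "(\<Sum>g\<in>carrier G. character_of G \<sigma> g * character_of G \<rho> (inv g)) =
    (\<Sum>i<m. \<Sum>k<n. \<Sum>g\<in>carrier G. \<sigma> g $$ (i,i) * \<rho> (inv g) $$ (k,k))"
proof -
  have "(\<Sum>g\<in>carrier G. character_of G \<sigma> g * character_of G \<rho> (inv g)) =
    (\<Sum>g\<in>carrier G. \<Sum>i<m. \<Sum>k<n. \<sigma> g $$ (i,i) * \<rho> (inv g) $$ (k,k))"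
  proof (intro sum.cong refl)
    fix g assume g: "g \<in> carrier G"
    show "character_of G \<sigma> g * character_of G \<rho> (inv g) = (\<Sum>i<m. \<Sum>k<n. \<sigma> g $$ (i,i) * \<rho> (inv g) $$ (k,k))"
      using rep_carrier[OF s g] rep_carrier[OF r, of "inv g"] g by (simp add: character_of_eq mat_trace_def sum_product)
  qed
  also have "\<dots> = (\<Sum>i<m. \<Sum>g\<in>carrier G. \<Sum>k<n. \<sigma> g $$ (i,i) * \<rho> (inv g) $$ (k,k))" by (rule sum.swap)
  also have "\<dots> = (\<Sum>i<m. \<Sum>k<n. \<Sum>g\<in>carrier G. \<sigma> g $$ (i,i) * \<rho> (inv g) $$ (k,k))"
    by (intro sum.cong refl sum.swap)
  finally show ?thesis .
qed

lemma character_inner_self: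
  assumes r: "irreducible_representation G n \<rho>"
  shows "(\<Sum>g\<in>carrier G. character_of G \<rho> g * character_of G \<rho> (inv g)) = of_nat (Coset.order G)"
proof -
  have "(\<Sum>g\<in>carrier G. character_of G \<rho> g * character_of G \<rho> (inv g)) =
    (\<Sum>i<n. \<Sum>k<n. if i = k then of_nat (Coset.order G) / of_nat n else 0)"
    unfolding character_inner_expand[OF irrD(1)[OF r] irrD(1)[OF r]]
    by (intro sum.cong refl) (simp add: orthogonality_eq[OF r])
  thus ?thesis using irrD(2)[OF r] by simp
qed

text \<open>The hypothesis is the vanishing of the coefficient sums rather than inequality of the
  characters, because the contrapositive is what locates a nonzero intertwiner in the next
  lemma.\<close>

lemma character_inner_neq:
  assumes r: "irreducible_representation G n \<rho>" and s: "irreducible_representation G m \<sigma>"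
    and 0: "\<And>i k. i < m \<Longrightarrow> k < n \<Longrightarrow> (\<Sum>g\<in>carrier G. \<sigma> g $$ (i,i) * \<rho> (inv g) $$ (k,k)) = 0"
  shows "(\<Sum>g\<in>carrier G. character_of G \<sigma> g * character_of G \<rho> (inv g)) = 0"
  unfolding character_inner_expand[OF irrD(1)[OF r] irrD(1)[OF s]] using 0 by simp

text \<open>The inner product of a character with itself is nonzero, so one of the coefficient sums
  it expands into is nonzero. That sum is an entry of an averaged matrix unit, which is therefore a
  nonzero intertwiner, and Schur applies.\<close>

lemma same_character_imp_similar:
  assumes r: "irreducible_representation G n \<rho>" and s: "irreducible_representation G m \<sigma>"
    and eq: "character_of G \<sigma> = character_of G \<rho>"
  obtains T R where "m = n" "T \<in> carrier_mat n n" "R \<in> carrier_mat n n" "T * R = 1\<^sub>m n"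
    "\<And>g. g \<in> carrier G \<Longrightarrow> \<sigma> g = T * \<rho> g * R"
proof -
  have "(\<Sum>g\<in>carrier G. character_of G \<sigma> g * character_of G \<rho> (inv g)) \<noteq> 0"
    using character_inner_self[OF r] order_pos eq by simp
  then obtain i k where ik: "i < m" "k < n" and nz: "(\<Sum>g\<in>carrier G. \<sigma> g $$ (i,i) * \<rho> (inv g) $$ (k,k)) \<noteq> 0"
    using character_inner_neq[OF r s] by metis
  define T where "T = mat m n (\<lambda>(a,b). \<Sum>g\<in>carrier G. \<sigma> g $$ (a,i) * \<rho> (inv g) $$ (k,b))"
  have T: "T \<in> carrier_mat m n" by (simp add: T_def)
  have Teq: "\<sigma> h * T = T * \<rho> h" if "h \<in> carrier G" for h
    unfolding T_def using irrD(1)[OF r] irrD(1)[OF s] ik that by (rule matrix_unit_intertwiner)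
  have "T $$ (i,k) \<noteq> 0" using nz ik by (simp add: T_def)
  hence "T \<noteq> 0\<^sub>m m n" using ik by auto
  from schur[OF r s T Teq this] obtain R where R: "m = n" "R \<in> carrier_mat n n" "T * R = 1\<^sub>m n" "R * T = 1\<^sub>m n" by metis
  have "\<sigma> g = T * \<rho> g * R" if g: "g \<in> carrier G" for g
  proof -
    have c: "\<sigma> g \<in> carrier_mat n n" using rep_carrier[OF irrD(1)[OF s] g] R by simp
    have "\<sigma> g = \<sigma> g * (T * R)" using R c by simp
    also have "\<dots> = \<sigma> g * T * R" using R c T by (metis assoc_mult_mat)
    finally show ?thesis using Teq[OF g] by simp
  qed
  thus ?thesis using that R T by blast
qed

text \<open>On any finite set of irreducible characters, \<chi> and the functions
  \<open>\<psi> (inv g) / |G|\<close> are biorthogonal. So no such set has more than |G|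
  elements.\<close>

lemma finite_Irr: "finite (Irr G)"
proof (rule ccontr)
  assume "infinite (Irr G)"
  then obtain S where S: "finite S" "card S = Suc (Coset.order G)" "S \<subseteq> Irr G"
    using infinite_arbitrarily_large by blast
  have "card S \<le> card (carrier G)"
  proof (rule biorthogonal_card_le[OF S(1) finite_carrier])
    fix \<chi> \<psi> assume "\<chi> \<in> S" "\<psi> \<in> S"
    then obtain m \<sigma> n \<rho> where s: "irreducible_representation G m \<sigma>" "\<chi> = character_of G \<sigma>"
      and r: "irreducible_representation G n \<rho>" "\<psi> = character_of G \<rho>"
      using S(3) unfolding Irr_def by blast
    have "(\<Sum>g\<in>carrier G. \<chi> g * (\<psi> (inv g) / of_nat (Coset.order G))) =
      (\<Sum>g\<in>carrier G. \<chi> g * \<psi> (inv g)) / of_nat (Coset.order G)"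
      by (simp add: sum_divide_distrib)
    also have "\<dots> = (if \<chi> = \<psi> then 1 else 0)"
      using character_inner_self[OF r(1)] character_inner_neq[OF r(1) s(1)] orthogonality_neq[OF r(1) s(1)]
        order_pos s r by auto
    finally show "(\<Sum>g\<in>carrier G. \<chi> g * (\<psi> (inv g) / of_nat (Coset.order G))) = (if \<chi> = \<psi> then 1 else 0)" .
  qed
  thus False using S by (simp add: Coset.order_def)
qed

end

lemma mat_eqI_vec:
  fixes A B :: "'a :: comm_ring_1 mat"
  assumes A: "A \<in> carrier_mat m n" and B: "B \<in> carrier_mat m n"
    and eq: "\<And>v. v \<in> carrier_vec n \<Longrightarrow> A *\<^sub>v v = B *\<^sub>v v"
  shows "A = B"
proof (rule eq_matI)
  fix i j assume "i < dim_row B" "j < dim_col B"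
  hence ij: "i < m" "j < n" using B by auto
  have "(A *\<^sub>v unit_vec n j) $ i = (B *\<^sub>v unit_vec n j) $ i" using eq by simp
  thus "A $$ (i,j) = B $$ (i,j)" using A B ij by simp
qed (use A B in auto)

section \<open>Kernels of characters\<close>

lemma upper_triangular_mult:
  fixes A B :: "'a :: comm_ring_1 mat"
  assumes A: "A \<in> carrier_mat n n" "upper_triangular A" and B: "B \<in> carrier_mat n n" "upper_triangular B"
  shows "upper_triangular (A * B)" "i < n \<Longrightarrow> (A * B) $$ (i,i) = A $$ (i,i) * B $$ (i,i)"
proof -
  have "(A * B) $$ (i,j) = 0" if "i < n" "j < i" for i j
  proof -
    have "(A * B) $$ (i,j) = (\<Sum>k\<in>{0..<n}. A $$ (i,k) * B $$ (k,j))"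
      using A B that by (simp add: scalar_prod_def)
    also have "\<dots> = 0"
    proof (intro sum.neutral ballI)
      fix k assume "k \<in> {0..<n}"
      thus "A $$ (i,k) * B $$ (k,j) = 0"
        using that A B by (cases "k < i") (auto simp: upper_triangular_def)
    qed
    finally show ?thesis .
  qed
  thus "upper_triangular (A * B)" using A B by (auto simp: upper_triangular_def)
  assume i: "i < n"
  have "(A * B) $$ (i,i) = (\<Sum>k\<in>{0..<n}. A $$ (i,k) * B $$ (k,i))"
    using A B i by (simp add: scalar_prod_def)
  also have "\<dots> = (\<Sum>k\<in>{0..<n}. if k = i then A $$ (i,i) * B $$ (i,i) else 0)"
  proof (intro sum.cong refl)
    fix k assume k: "k \<in> {0..<n}"
    show "A $$ (i,k) * B $$ (k,i) = (if k = i then A $$ (i,i) * B $$ (i,i) else 0)"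
      using k i A B by (cases k i rule: linorder_cases) (auto simp: upper_triangular_def)
  qed
  finally show "(A * B) $$ (i,i) = A $$ (i,i) * B $$ (i,i)" using i by simp
qed

lemma upper_triangular_pow:
  fixes A :: "'a :: comm_ring_1 mat"
  assumes A: "A \<in> carrier_mat n n" "upper_triangular A"
  shows "upper_triangular (A ^\<^sub>m k) \<and> (\<forall>i<n. (A ^\<^sub>m k) $$ (i,i) = (A $$ (i,i)) ^ k)"
proof (induction k)
  case 0
  thus ?case using A by simp
next
  case (Suc k)
  have c: "A ^\<^sub>m k \<in> carrier_mat n n" using A by simp
  show ?case using upper_triangular_mult[OF c _ A] Suc by (simp add: mult.commute)
qed

text \<open>Each real part is at most 1 and they add up to the number of terms, so each equals 1;
  with modulus 1 the imaginary part vanishes.\<close>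

lemma sum_unit_complex_eq_card:
  assumes "finite J" "\<And>i. i \<in> J \<Longrightarrow> norm (z i :: complex) = 1" "sum z J = of_nat (card J)" "i \<in> J"
  shows "z i = 1"
proof -
  have le: "Re (z i) \<le> 1" if "i \<in> J" for i using complex_Re_le_cmod[of "z i"] assms(2)[OF that] by simp
  have "(\<Sum>i\<in>J. 1 - Re (z i)) = 0"
    using arg_cong[OF assms(3), of Re] by (simp add: sum_subtractf)
  hence re: "Re (z i) = 1" using sum_nonneg_eq_0_iff[of J "\<lambda>i. 1 - Re (z i)"] assms(1,4) le by auto
  moreover have "(Re (z i))\<^sup>2 + (Im (z i))\<^sup>2 = 1" using assms(2)[OF assms(4)] cmod_power2[of "z i"] by simp
  ultimately show ?thesis by (simp add: complex_eq_iff)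
qed

text \<open>After triangularization \<open>A\<close> is unipotent, so \<open>S = \<Sum>\<^sub>j\<^sub><\<^sub>k A\<^sup>j\<close> is invertible, while \<open>A * S = S\<close>.\<close>

lemma finite_order_trace_eq_dim:
  fixes A :: "complex mat"
  assumes A: "A \<in> carrier_mat n n" and k: "k > 0" "A ^\<^sub>m k = 1\<^sub>m n" and tr: "mat_trace A = of_nat n"
  shows "A = 1\<^sub>m n"
proof -
  obtain es where es: "char_poly A = (\<Prod>a\<leftarrow>es. [:- a, 1:])" using char_poly_factorized[OF A] by auto
  obtain B where B: "B \<in> carrier_mat n n" "upper_triangular B" "similar_mat A B"
    using schur_decomposition_exists[OF A es] by auto
  then obtain P Q where "similar_mat_wit A B P Q" by (auto simp: similar_mat_def)
  hence wit: "similar_mat_wit B A Q P" by (rule similar_mat_wit_sym)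
  have n: "n = dim_row B" using B by simp
  note w = similar_mat_witD[OF n wit]
  have Bk: "B ^\<^sub>m k = 1\<^sub>m n"
    using similar_mat_wit_pow_id[OF wit, of k] k w by simp
  have bi: "(B $$ (i,i)) ^ k = 1" if "i < n" for i
    using upper_triangular_pow[OF B(1,2), of k] Bk that by auto
  have trB: "mat_trace B = of_nat n"
  proof -
    have "mat_trace B = mat_trace (Q * (A * P))" using w by (metis assoc_mult_mat)
    also have "\<dots> = mat_trace (A * P * Q)" using w by (intro trace_cyclic) auto
    also have "A * P * Q = A" using w by (metis assoc_mult_mat right_mult_one_mat)
    finally show ?thesis using tr by simp
  qed
  \<comment> \<open>The diagonal entries of \<open>B\<close> are roots of unity with sum
    \<open>n\<close>, so all of them are 1.\<close>
  have diag: "B $$ (i,i) = 1" if i: "i < n" for i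
  proof (rule sum_unit_complex_eq_card[where J="{..<n}" and z="\<lambda>i. B $$ (i,i)"])
    fix i assume "i \<in> {..<n}"
    hence "norm (B $$ (i,i)) ^ k = 1" using bi[of i] by (simp add: norm_power[symmetric])
    thus "norm (B $$ (i,i)) = 1" using power_eq_imp_eq_base[of "norm (B $$ (i,i))" k 1] k(1) by simp
  qed (use trB i B in \<open>auto simp: mat_trace_def\<close>)
  define S where "S = mat n n (\<lambda>(i,j). \<Sum>t<k. (B ^\<^sub>m t) $$ (i,j))"
  have S: "S \<in> carrier_mat n n" by (simp add: S_def)
  have Bt: "B ^\<^sub>m t \<in> carrier_mat n n" for t using B by simp
  have BS: "B * S = S"
  proof (rule eq_matI)
    fix i j assume "i < dim_row S" "j < dim_col S"
    hence ij: "i < n" "j < n" by (auto simp: S_def)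
    have "(B * S) $$ (i,j) = (\<Sum>l\<in>{0..<n}. \<Sum>t<k. B $$ (i,l) * (B ^\<^sub>m t) $$ (l,j))"
      using ij B S by (simp add: scalar_prod_def S_def sum_distrib_left)
    also have "\<dots> = (\<Sum>t<k. \<Sum>l\<in>{0..<n}. B $$ (i,l) * (B ^\<^sub>m t) $$ (l,j))" by (rule sum.swap)
    also have "\<dots> = (\<Sum>t<k. (B ^\<^sub>m Suc t) $$ (i,j))"
    proof (intro sum.cong refl)
      fix t
      have "(B * B ^\<^sub>m t) $$ (i,j) = (\<Sum>l\<in>{0..<n}. B $$ (i,l) * (B ^\<^sub>m t) $$ (l,j))"
        using ij B Bt[of t] by (simp add: scalar_prod_def)
      moreover have "B * B ^\<^sub>m t = B ^\<^sub>m Suc t"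
        by (induction t) (use B in \<open>auto simp flip: assoc_mult_mat[of B n n _ n _ n]\<close>)
      ultimately show "(\<Sum>l\<in>{0..<n}. B $$ (i,l) * (B ^\<^sub>m t) $$ (l,j)) = (B ^\<^sub>m Suc t) $$ (i,j)" by simp
    qed
    \<comment> \<open>Multiplication by \<open>B\<close> shifts the sum by one place, and the two
      end terms cancel because \<open>B ^\<^sub>m k\<close> and \<open>B ^\<^sub>m 0\<close> are
      both the identity.\<close>
    also have "\<dots> = (\<Sum>t<k. (B ^\<^sub>m t) $$ (i,j)) + (B ^\<^sub>m k) $$ (i,j) - (B ^\<^sub>m 0) $$ (i,j)"
      using sum.lessThan_Suc_shift[of "\<lambda>t. (B ^\<^sub>m t) $$ (i,j)" k] by simp
    also have "\<dots> = S $$ (i,j)" using ij B Bk by (simp add: S_def)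
    finally show "(B * S) $$ (i,j) = S $$ (i,j)" .
  qed (use B S in auto)
  have "upper_triangular S"
    using upper_triangular_pow[OF B(1,2)] B by (auto simp: upper_triangular_def S_def intro!: sum.neutral)
  moreover have "S $$ (i,i) = of_nat k" if "i < n" for i
    using upper_triangular_pow[OF B(1,2)] diag that by (simp add: S_def)
  ultimately have "det S \<noteq> 0"
    using det_upper_triangular[of S n] S k(1) by (auto simp: diag_mat_def prod_list_zero_iff)
  then obtain R where R: "R \<in> carrier_mat n n" "S * R = 1\<^sub>m n" using det_nonzero_inverse[OF S] by metis
  have "B = B * (S * R)" using B R by simp
  also have "\<dots> = 1\<^sub>m n" using B S R BS by (metis assoc_mult_mat)
  finally have "A = P * 1\<^sub>m n * Q"
    using similar_mat_witD[OF _ \<open>similar_mat_wit A B P Q\<close>, of n] A by simp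
  thus ?thesis using w by simp
qed

context fin_group
begin

text \<open>A group element acts by a matrix of finite order, and such a matrix with trace
  \<open>n\<close> is the identity. Hence the kernel defined through character values is the kernel
  of the representation.\<close>

lemma char_ker_character_of:
  assumes r: "representation G n \<rho>"
  shows "char_ker G (character_of G \<rho>) = {g \<in> carrier G. \<rho> g = 1\<^sub>m n}"
proof (intro equalityI subsetI)
  fix g assume "g \<in> char_ker G (character_of G \<rho>)"
  hence g: "g \<in> carrier G" and eq: "mat_trace (\<rho> g) = of_nat n"
    using character_of_one[OF r] by (auto simp: char_ker_def character_of_eq)
  have "\<rho> g ^\<^sub>m Coset.order G = 1\<^sub>m n"
    using rep_pow[OF r g, of "Coset.order G"] pow_order_eq_1[OF g] rep_one[OF r] by simp
  hence "\<rho> g = 1\<^sub>m n"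
    using finite_order_trace_eq_dim[OF rep_carrier[OF r g] order_pos _ eq] by simp
  thus "g \<in> {g \<in> carrier G. \<rho> g = 1\<^sub>m n}" using g by simp
next
  fix g assume "g \<in> {g \<in> carrier G. \<rho> g = 1\<^sub>m n}"
  thus "g \<in> char_ker G (character_of G \<rho>)"
    using rep_one[OF r] by (auto simp: char_ker_def character_of_eq)
qed

end

section \<open>Irreducible subrepresentations\<close>

context group
begin

text \<open>The equation \<open>\<sigma> g * S = S * D\<close> has a solution by invariance and at
  most one by injectivity of \<open>S\<close>; uniqueness makes the solutions multiplicative in
  \<open>g\<close>.\<close>

lemma subrepresentation:
  assumes s: "representation G N \<sigma>" and S: "S \<in> carrier_mat N m" "inj_mat S"
    and inv: "\<And>g v. g \<in> carrier G \<Longrightarrow> v \<in> mat_range S \<Longrightarrow> \<sigma> g *\<^sub>v v \<in> mat_range S"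
  obtains \<rho> where "representation G m \<rho>" "\<And>g. g \<in> carrier G \<Longrightarrow> \<sigma> g * S = S * \<rho> g"
proof -
  have "\<exists>D. D \<in> carrier_mat m m \<and> \<sigma> g * S = S * D" if g: "g \<in> carrier G" for g
  proof -
    have "col (\<sigma> g * S) j \<in> mat_range S" if j: "j < m" for j
    proof -
      have "col S j = S *\<^sub>v unit_vec m j" using S(1) j by (intro eq_vecI) auto
      hence "col S j \<in> mat_range S" using S(1) by (auto simp: mat_range_def)
      thus ?thesis using inv[OF g] col_mult2[OF rep_carrier[OF s g] S(1) j] by simp
    qed
    thus ?thesis using mat_range_factor[OF S(1) mult_carrier_mat[OF rep_carrier[OF s g] S(1)]] by blast
  qed
  then obtain \<rho> where \<rho>c: "\<And>g. g \<in> carrier G \<Longrightarrow> \<rho> g \<in> carrier_mat m m"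
    and eq: "\<And>g. g \<in> carrier G \<Longrightarrow> \<sigma> g * S = S * \<rho> g" by metis
  have "representation G m \<rho>"
  proof (rule representationI)
    fix g h assume g: "g \<in> carrier G" and h: "h \<in> carrier G"
    note sc = rep_carrier[OF s g] rep_carrier[OF s h]
    have "S * \<rho> (g \<otimes> h) = (\<sigma> g * \<sigma> h) * S" using eq[of "g \<otimes> h"] rep_mult[OF s g h] g h by simp
    also have "\<dots> = \<sigma> g * (\<sigma> h * S)" using sc S by (intro assoc_mult_mat) auto
    also have "\<dots> = (\<sigma> g * S) * \<rho> h" unfolding eq[OF h] using sc S \<rho>c[OF h] by (intro assoc_mult_mat[symmetric]) auto
    also have "\<dots> = S * (\<rho> g * \<rho> h)" unfolding eq[OF g] using S \<rho>c[OF g] \<rho>c[OF h] by (intro assoc_mult_mat) auto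
    finally show "\<rho> (g \<otimes> h) = \<rho> g * \<rho> h" 
      
      using inj_mat_cancel[OF S(2,1) \<rho>c mult_carrier_mat[OF \<rho>c[OF g] \<rho>c[OF h]]] g h by simp
  next
    have "S * \<rho> \<one> = S * 1\<^sub>m m" using eq[of \<one>] rep_one[OF s] S by simp
    thus "\<rho> \<one> = 1\<^sub>m m" using inj_mat_cancel[OF S(2,1) \<rho>c one_carrier_mat] by simp
  qed (rule \<rho>c)
  thus ?thesis using that eq by blast
qed

text \<open>A nonzero invariant subspace of least dimension is irreducible: an invariant subspace
  with basis \<open>T\<close> in its coordinates has basis \<open>S * T\<close> in the ambient
  space, contradicting minimality if it is proper and nonzero.\<close>

lemma irreducible_subrepresentation:
  assumes s: "representation G N \<sigma>" and V: "lin_subspace N V" "V \<noteq> {0\<^sub>v N}"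
    and inv: "\<And>g v. g \<in> carrier G \<Longrightarrow> v \<in> V \<Longrightarrow> \<sigma> g *\<^sub>v v \<in> V"
  obtains m S \<rho> where "irreducible_representation G m \<rho>" "S \<in> carrier_mat N m" "inj_mat S"
    "mat_range S \<subseteq> V" "\<And>g. g \<in> carrier G \<Longrightarrow> \<sigma> g * S = S * \<rho> g"
proof -
  define P where "P m \<longleftrightarrow> m > 0 \<and> (\<exists>S \<in> carrier_mat N m. inj_mat S \<and> mat_range S \<subseteq> V \<and>
    (\<forall>g\<in>carrier G. \<forall>v\<in>mat_range S. \<sigma> g *\<^sub>v v \<in> mat_range S))" for m
  have "\<exists>m. P m"
  proof -
    obtain m S where S: "S \<in> carrier_mat N m" "inj_mat S" "mat_range S = V"
      using subspace_basis[OF V(1)] by blast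
    have "m > 0"
    proof (rule ccontr)
      assume "\<not> m > 0"
      hence "mat_range S \<subseteq> {0\<^sub>v N}" using S(1) by (auto simp: mat_range_def scalar_prod_def intro!: eq_vecI)
      thus False using S(3) V by (auto simp: lin_subspace_def)
    qed
    thus ?thesis using S inv by (auto simp: P_def)
  qed
  define m where "m = (LEAST m. P m)"
  have Pm: "P m" unfolding m_def using \<open>\<exists>m. P m\<close> by (metis LeastI)
  then obtain S where S: "S \<in> carrier_mat N m" "inj_mat S" "mat_range S \<subseteq> V"
    and Sinv: "\<And>g v. g \<in> carrier G \<Longrightarrow> v \<in> mat_range S \<Longrightarrow> \<sigma> g *\<^sub>v v \<in> mat_range S"
    by (auto simp: P_def)
  obtain \<rho> where \<rho>: "representation G m \<rho>" and eq: "\<And>g. g \<in> carrier G \<Longrightarrow> \<sigma> g * S = S * \<rho> g"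
    using subrepresentation[OF s S(1,2) Sinv] by blast
  have "W = {0\<^sub>v m} \<or> W = carrier_vec m"
    if W: "lin_subspace m W" and Winv: "\<And>g v. g \<in> carrier G \<Longrightarrow> v \<in> W \<Longrightarrow> \<rho> g *\<^sub>v v \<in> W" for W
  proof -
    obtain k T where T: "T \<in> carrier_mat m k" "inj_mat T" "mat_range T = W"
      using subspace_basis[OF W] by blast
    have ST: "S * T \<in> carrier_mat N k" using S T by auto
    have rST: "mat_range (S * T) = (\<lambda>w. S *\<^sub>v w) ` W"
      unfolding T(3)[symmetric] mat_range_def using S T
      by (auto simp: image_image assoc_mult_mat_vec[of S N m T k] intro!: image_cong)
    consider "k = 0" | "k > 0" "k < m" | "k = m"
      using inj_mat_dim_le[OF T(2,1)] by linarith
    thus ?thesis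
    proof cases
      case 1
      hence "mat_range T \<subseteq> {0\<^sub>v m}" using T(1) by (auto simp: mat_range_def scalar_prod_def intro!: eq_vecI)
      thus ?thesis using T(3) W by (auto simp: lin_subspace_def)
    next
      case 2
      have "P k" unfolding P_def
      proof (intro conjI bexI[OF _ ST] ballI)
        show "inj_mat (S * T)" by (rule inj_mat_mult[OF S(2,1) T(2,1)])
        have "W \<subseteq> carrier_vec m" using W by (simp add: lin_subspace_def)
        thus "mat_range (S * T) \<subseteq> V" using S(1,3) rST by (auto simp: mat_range_def)
        fix g v assume g: "g \<in> carrier G" and "v \<in> mat_range (S * T)"
        then obtain w where w: "w \<in> W" "v = S *\<^sub>v w" using rST by auto
        have wc: "w \<in> carrier_vec m" using w W by (auto simp: lin_subspace_def)
        have "\<sigma> g *\<^sub>v v = (\<sigma> g * S) *\<^sub>v w" using w wc S rep_carrier[OF s g] by (simp add: assoc_mult_mat_vec)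
        also have "\<dots> = S *\<^sub>v (\<rho> g *\<^sub>v w)" unfolding eq[OF g] using S(1) rep_carrier[OF \<rho> g] wc by (intro assoc_mult_mat_vec) auto
        finally show "\<sigma> g *\<^sub>v v \<in> mat_range (S * T)" using rST Winv[OF g w(1)] by auto
      qed (use 2 in auto)
      hence "m \<le> k" unfolding m_def by (rule Least_le)
      thus ?thesis using 2 by simp
    next
      case 3
      have "carrier_vec m \<subseteq> mat_range T"
        using inj_mat_square_surj[OF T(2)] T(1) 3 by (fastforce simp: mat_range_def image_iff)
      thus ?thesis using T(3) W by (auto simp: lin_subspace_def)
    qed
  qed
  hence "irreducible_representation G m \<rho>" using \<rho> Pm by (auto simp: irr_iff P_def)
  thus ?thesis using that S eq by blast
qed

end

section \<open>The sum of the squared degrees\<close>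

context fin_group
begin

text \<open>The space of functions on \<open>G\<close> that are invariant under \<open>N\<close> and orthogonal to all matrix coefficients
  of irreducible representations trivial on \<open>N\<close> is invariant under right translations. If it were nonzero,
  it would contain an irreducible subrepresentation, whose elements are matrix coefficients themselves.\<close>

lemma matrix_coefficients_complete:
  assumes N: "N \<lhd> G" and fN: "\<And>x t. x \<in> N \<Longrightarrow> t \<in> carrier G \<Longrightarrow> f (x \<otimes> t) = f t"
    and f0: "\<And>n \<rho> k l. \<lbrakk>irreducible_representation G n \<rho>; \<And>x. x \<in> N \<Longrightarrow> \<rho> x = 1\<^sub>m n; k < n; l < n\<rbrakk> \<Longrightarrow>
      (\<Sum>t\<in>carrier G. f t * \<rho> (inv t) $$ (k,l)) = 0"
    and t: "t \<in> carrier G"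
  shows "f t = (0 :: complex)"
proof -
  define d where "d = Coset.order G"
  obtain h where h: "bij_betw h {0..<d} (carrier G)"
    unfolding d_def Coset.order_def using ex_bij_betw_nat_finite[OF finite_carrier] by blast
  define ix where "ix = inv_into {0..<d} h"
  have ix: "ix g < d" "h (ix g) = g" if "g \<in> carrier G" for g
    using h that by (auto simp: ix_def bij_betw_def f_inv_into_f) (metis atLeastLessThan_iff inv_into_into)
  have hc: "h a \<in> carrier G" if "a < d" for a using h that by (auto simp: bij_betw_def)
  have hix: "h c = g \<longleftrightarrow> c = ix g" if "c < d" "g \<in> carrier G" for c g
    using h that ix[OF that(2)] by (auto simp: bij_betw_def inj_on_def)
  \<comment> \<open>The right regular representation in coordinates: a vector \<open>v\<close> is a
    function on the group through \<open>ix\<close>, and \<open>\<sigma> g\<close> sends it to the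
    function mapping \<open>t\<close> to the value of \<open>v\<close> at
    \<open>t \<otimes> g\<close>.\<close>
  define \<sigma> :: "'a \<Rightarrow> complex mat" where "\<sigma> g = mat d d (\<lambda>(a,b). if b = ix (h a \<otimes> g) then 1 else 0)" for g
  have \<sigma>c: "\<sigma> g \<in> carrier_mat d d" for g by (simp add: \<sigma>_def)
  have \<sigma>v: "(\<sigma> g *\<^sub>v v) $ a = v $ ix (h a \<otimes> g)"
    if "g \<in> carrier G" "v \<in> carrier_vec d" "a < d" for g v a
  proof -
    have "(\<sigma> g *\<^sub>v v) $ a = (\<Sum>b\<in>{0..<d}. (if b = ix (h a \<otimes> g) then 1 else 0) * v $ b)"
      using that by (simp add: \<sigma>_def scalar_prod_def)
    also have "\<dots> = (\<Sum>b\<in>{0..<d}. if b = ix (h a \<otimes> g) then v $ b else 0)" by (intro sum.cong) auto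
    finally show ?thesis using ix(1)[of "h a \<otimes> g"] hc that by simp
  qed
  have rep: "representation G d \<sigma>"
  proof (rule representationI)
    fix g k assume g: "g \<in> carrier G" and k: "k \<in> carrier G"
    have "\<sigma> (g \<otimes> k) *\<^sub>v v = \<sigma> g * \<sigma> k *\<^sub>v v" if v: "v \<in> carrier_vec d" for v
    proof -
      have "\<sigma> (g \<otimes> k) *\<^sub>v v = \<sigma> g *\<^sub>v (\<sigma> k *\<^sub>v v)"
      proof (rule eq_vecI)
        fix a assume "a < dim_vec (\<sigma> g *\<^sub>v (\<sigma> k *\<^sub>v v))"
        hence a: "a < d" by (simp add: \<sigma>_def)
        have c: "\<sigma> k *\<^sub>v v \<in> carrier_vec d" using \<sigma>c by (rule mult_mat_vec_carrier) (rule v)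
        show "(\<sigma> (g \<otimes> k) *\<^sub>v v) $ a = (\<sigma> g *\<^sub>v (\<sigma> k *\<^sub>v v)) $ a"
          using \<sigma>v[OF _ v a, of "g \<otimes> k"] \<sigma>v[OF g c a] \<sigma>v[OF k v, of "ix (h a \<otimes> g)"] ix[of "h a \<otimes> g"] g k hc[OF a]
          by (simp add: m_assoc)
      qed (simp add: \<sigma>_def)
      also have "\<dots> = \<sigma> g * \<sigma> k *\<^sub>v v" using assoc_mult_mat_vec[OF \<sigma>c \<sigma>c v] by simp
      finally show ?thesis .
    qed
    note act = this
    show "\<sigma> (g \<otimes> k) = \<sigma> g * \<sigma> k"
      by (rule mat_eqI_vec[OF \<sigma>c mult_carrier_mat[OF \<sigma>c \<sigma>c] act])
  next
    show "\<sigma> \<one> = 1\<^sub>m d"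
      using hc hix[OF _ hc] by (intro eq_matI) (auto simp: \<sigma>_def)
  qed (rule \<sigma>c)
  define V where "V = {v \<in> carrier_vec d.
    (\<forall>x\<in>N. \<forall>t\<in>carrier G. v $ ix (x \<otimes> t) = v $ ix t) \<and>
    (\<forall>n \<rho> k l. irreducible_representation G n \<rho> \<longrightarrow> (\<forall>x\<in>N. \<rho> x = 1\<^sub>m n) \<longrightarrow> k < n \<longrightarrow> l < n \<longrightarrow>
      (\<Sum>t\<in>carrier G. v $ ix t * \<rho> (inv t) $$ (k,l)) = 0)}"
  interpret N: normal N G by (rule N)
  have NG: "x \<in> carrier G" if "x \<in> N" for x using N.subset that by auto
  have V: "lin_subspace d V"
    using ix(1) NG unfolding lin_subspace_def V_def
    by (auto simp: algebra_simps sum.distrib sum_distrib_left[symmetric])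
  have inv: "\<sigma> g *\<^sub>v v \<in> V" if g: "g \<in> carrier G" and v: "v \<in> V" for g v
  proof -
    have vc: "v \<in> carrier_vec d" using v by (simp add: V_def)
    have e: "(\<sigma> g *\<^sub>v v) $ ix t = v $ ix (t \<otimes> g)" if "t \<in> carrier G" for t
      using \<sigma>v[OF g vc ix(1)[OF that]] ix(2)[OF that] by simp
    show ?thesis unfolding V_def mem_Collect_eq
    proof (intro conjI ballI allI impI)
      show "\<sigma> g *\<^sub>v v \<in> carrier_vec d" using \<sigma>c by (rule mult_mat_vec_carrier) (rule vc)
      fix x t assume "x \<in> N" "t \<in> carrier G"
      thus "(\<sigma> g *\<^sub>v v) $ ix (x \<otimes> t) = (\<sigma> g *\<^sub>v v) $ ix t"
        using v g NG[of x] by (simp add: e m_assoc V_def)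
    next
      fix n \<rho> k l
      assume r: "irreducible_representation G n \<rho>" and rN: "\<forall>x\<in>N. \<rho> x = 1\<^sub>m n" and kl: "k < n" "l < n"
      note r1 = irrD(1)[OF r]
      have "(\<Sum>t\<in>carrier G. (\<sigma> g *\<^sub>v v) $ ix t * \<rho> (inv t) $$ (k,l)) =
        (\<Sum>t\<in>carrier G. v $ ix (t \<otimes> g) * \<rho> (inv t) $$ (k,l))"
        by (intro sum.cong) (auto simp: e)
      also have "\<dots> = (\<Sum>t\<in>carrier G. v $ ix t * \<rho> (inv (t \<otimes> inv g)) $$ (k,l))"
        using g by (intro sum.reindex_bij_witness[of _ "\<lambda>t. t \<otimes> inv g" "\<lambda>t. t \<otimes> g"]) (auto simp: m_assoc)
      also have "\<dots> = (\<Sum>t\<in>carrier G. \<Sum>j\<in>{0..<n}. \<rho> g $$ (k,j) * (v $ ix t * \<rho> (inv t) $$ (j,l)))"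
      proof (intro sum.cong refl)
        fix t assume t: "t \<in> carrier G"
        have "inv (t \<otimes> inv g) = g \<otimes> inv t" using g t by (simp add: inv_mult_group)
        hence "\<rho> (inv (t \<otimes> inv g)) $$ (k,l) = (\<rho> g * \<rho> (inv t)) $$ (k,l)" using rep_mult[OF r1 g, of "inv t"] t by simp
        also have "\<dots> = (\<Sum>j\<in>{0..<n}. \<rho> g $$ (k,j) * \<rho> (inv t) $$ (j,l))"
          using rep_carrier[OF r1 g] rep_carrier[OF r1, of "inv t"] t kl by (simp add: scalar_prod_def)
        finally show "v $ ix t * \<rho> (inv (t \<otimes> inv g)) $$ (k,l) =
          (\<Sum>j\<in>{0..<n}. \<rho> g $$ (k,j) * (v $ ix t * \<rho> (inv t) $$ (j,l)))"
          by (simp add: sum_distrib_left algebra_simps)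
      qed
      also have "\<dots> = (\<Sum>j\<in>{0..<n}. \<Sum>t\<in>carrier G. \<rho> g $$ (k,j) * (v $ ix t * \<rho> (inv t) $$ (j,l)))"
        by (rule sum.swap)
      also have "\<dots> = 0"
      proof (rule sum.neutral, rule ballI)
        fix j assume "j \<in> {0..<n}"
        hence "(\<Sum>t\<in>carrier G. v $ ix t * \<rho> (inv t) $$ (j,l)) = 0" using v r rN kl by (auto simp: V_def)
        thus "(\<Sum>t\<in>carrier G. \<rho> g $$ (k,j) * (v $ ix t * \<rho> (inv t) $$ (j,l))) = 0"
          by (simp add: sum_distrib_left[symmetric])
      qed
      finally show "(\<Sum>t\<in>carrier G. (\<sigma> g *\<^sub>v v) $ ix t * \<rho> (inv t) $$ (k,l)) = 0" .
    qed
  qed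
  have "V = {0\<^sub>v d}"
  proof (rule ccontr)
    assume "V \<noteq> {0\<^sub>v d}"
    from irreducible_subrepresentation[OF rep V this inv] obtain m S \<rho> where
      \<rho>: "irreducible_representation G m \<rho>" and S: "S \<in> carrier_mat d m" "inj_mat S" "mat_range S \<subseteq> V"
      and eq: "\<And>g. g \<in> carrier G \<Longrightarrow> \<sigma> g * S = S * \<rho> g" by metis
    note r1 = irrD(1)[OF \<rho>] and m0 = irrD(2)[OF \<rho>]
    have colV: "col S j \<in> V" if "j < m" for j
    proof -
      have "col S j = S *\<^sub>v unit_vec m j" using S(1) that by (intro eq_vecI) auto
      thus ?thesis using S by (auto simp: mat_range_def)
    qed
    have colc: "col S j \<in> carrier_vec d" for j using S(1) by (intro carrier_vecI) simp
    have act: "S $$ (ix (t \<otimes> g), j) = (\<Sum>i\<in>{0..<m}. S $$ (ix t, i) * \<rho> g $$ (i,j))"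
      if "g \<in> carrier G" "t \<in> carrier G" "j < m" for g t j
    proof -
      have "(\<sigma> g *\<^sub>v col S j) $ ix t = col S j $ ix (t \<otimes> g)"
        using \<sigma>v[OF that(1) colc, of "ix t"] ix[OF that(2)] by simp
      moreover have "\<sigma> g *\<^sub>v col S j = col (S * \<rho> g) j"
        using col_mult2[OF \<sigma>c[of g] S(1) that(3)] eq[OF that(1)] by simp
      ultimately show ?thesis
        using that S(1) ix(1)[OF that(2)] ix(1)[of "t \<otimes> g"] rep_carrier[OF r1 that(1)]
        by (simp add: scalar_prod_def)
    qed
    \<comment> \<open>Right translation by \<open>x\<close> at the point \<open>t\<close> is left
      translation by the conjugate \<open>t \<otimes> x \<otimes> inv t\<close>, which is again in
      \<open>N\<close>. Functions in \<open>V\<close> are invariant under the latter.\<close>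
    have \<rho>N: "\<rho> x = 1\<^sub>m m" if x: "x \<in> N" for x
    proof (rule inj_mat_cancel[OF S(2,1)])
      show "\<rho> x \<in> carrier_mat m m" using rep_carrier[OF r1 NG[OF x]] .
      have "\<sigma> x * S = S"
      proof (rule mat_col_eqI)
        fix j assume "j < dim_col S"
        hence j: "j < m" using S(1) by simp
        have "\<sigma> x *\<^sub>v col S j = col S j"
        proof (rule eq_vecI)
          fix a assume "a < dim_vec (col S j)"
          hence a: "a < d" using S(1) by simp
          have y: "h a \<otimes> x \<otimes> inv (h a) \<in> N" using N.inv_op_closed2[OF hc[OF a] x] .
          have "(\<sigma> x *\<^sub>v col S j) $ a = col S j $ ix (h a \<otimes> x)"
            by (rule \<sigma>v[OF NG[OF x] colc a])
          also have "h a \<otimes> x = (h a \<otimes> x \<otimes> inv (h a)) \<otimes> h a" using hc[OF a] NG[OF x] by (simp add: m_assoc)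
          also have "col S j $ ix \<dots> = col S j $ ix (h a)" using colV[OF j] y hc[OF a] by (auto simp: V_def)
          also have "ix (h a) = a" using hix[OF a hc[OF a]] by simp
          finally show "(\<sigma> x *\<^sub>v col S j) $ a = col S j $ a" .
        qed (use S(1) in \<open>simp add: \<sigma>_def\<close>)
        thus "col (\<sigma> x * S) j = col S j" using col_mult2[OF \<sigma>c[of x] S(1) j] by simp
      qed (use S(1) in \<open>auto simp: \<sigma>_def\<close>)
      thus "S * \<rho> x = S * 1\<^sub>m m" using eq[OF NG[OF x]] S(1) by simp
    qed simp
    \<comment> \<open>By \<open>act\<close> the row of \<open>S\<close> at \<open>t\<close> is its
      row at \<open>\<one>\<close> times \<open>\<rho> t\<close>. Pairing column 0 with
      \<open>\<rho> (inv t)\<close> gives zero since the column lies in \<open>V\<close>, while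
      orthogonality turns the sum into a nonzero multiple of the entry at
      \<open>(\<one>, l)\<close>.\<close>
    have S1: "S $$ (ix \<one>, l) = 0" if l: "l < m" for l
    proof -
      have "0 = (\<Sum>t\<in>carrier G. col S 0 $ ix t * \<rho> (inv t) $$ (0,l))"
        using colV[OF m0] \<rho> \<rho>N m0 l by (auto simp: V_def)
      also have "\<dots> = (\<Sum>t\<in>carrier G. \<Sum>i\<in>{0..<m}. S $$ (ix \<one>, i) * (\<rho> t $$ (i,0) * \<rho> (inv t) $$ (0,l)))"
      proof (intro sum.cong refl)
        fix t assume t: "t \<in> carrier G"
        have "col S 0 $ ix t = (\<Sum>i\<in>{0..<m}. S $$ (ix \<one>, i) * \<rho> t $$ (i,0))"
          using act[OF t one_closed m0] ix(1)[OF t] S(1) m0 t by simp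
        thus "col S 0 $ ix t * \<rho> (inv t) $$ (0,l) =
          (\<Sum>i\<in>{0..<m}. S $$ (ix \<one>, i) * (\<rho> t $$ (i,0) * \<rho> (inv t) $$ (0,l)))"
          by (simp add: sum_distrib_right mult.assoc)
      qed
      also have "\<dots> = (\<Sum>i\<in>{0..<m}. S $$ (ix \<one>, i) * (\<Sum>t\<in>carrier G. \<rho> t $$ (i,0) * \<rho> (inv t) $$ (0,l)))"
        by (subst sum.swap) (simp add: sum_distrib_left)
      also have "\<dots> = (\<Sum>i\<in>{0..<m}. if i = l then S $$ (ix \<one>, l) * (of_nat d / of_nat m) else 0)"
        using m0 l by (intro sum.cong refl) (auto simp: orthogonality_eq[OF \<rho>] d_def)
      finally show ?thesis using l order_pos m0 by (simp add: d_def)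
    qed
    have "S $$ (a, j) = 0" if a: "a < d" and j: "j < m" for a j
      using act[OF hc[OF a] one_closed j] S1 hc[OF a] hix[OF a hc[OF a]] by simp
    hence "S *\<^sub>v unit_vec m 0 = 0\<^sub>v d" using S(1) m0 by (intro eq_vecI) auto
    hence "unit_vec m 0 = (0\<^sub>v m :: complex vec)" using inj_matD[OF S(2,1)] by auto
    thus False using m0 by (metis index_unit_vec(1) index_zero_vec(1) zero_neq_one)
  qed
  moreover have "vec d (\<lambda>a. f (h a)) \<in> V"
    unfolding V_def mem_Collect_eq
  proof (intro conjI ballI allI impI)
    fix n \<rho> k l
    assume r: "irreducible_representation G n \<rho>" "\<forall>x\<in>N. \<rho> x = 1\<^sub>m n" "k < n" "l < n"
    have "(\<Sum>t\<in>carrier G. vec d (\<lambda>a. f (h a)) $ ix t * \<rho> (inv t) $$ (k,l)) =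
      (\<Sum>t\<in>carrier G. f t * \<rho> (inv t) $$ (k,l))"
      using ix by (intro sum.cong) auto
    thus "(\<Sum>t\<in>carrier G. vec d (\<lambda>a. f (h a)) $ ix t * \<rho> (inv t) $$ (k,l)) = 0"
      using f0[OF r(1)] r by simp
  qed (use ix fN NG in auto)
  ultimately have "vec d (\<lambda>a. f (h a)) $ ix t = 0" using ix(1)[OF t] by auto
  thus ?thesis using ix[OF t] by simp
qed

text \<open>Expand the indicator function of the coset \<open>N h\<close> in the \<open>u e\<close>, evaluate at \<open>h\<close> and sum over \<open>h\<close>:
  this compares the trace of the identity with the number of basis elements.\<close>

lemma biorthogonal_basis_card:
  fixes u w :: "'e \<Rightarrow> 'a \<Rightarrow> complex"
  assumes E: "finite E" and N: "N \<lhd> G"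
    and uN: "\<And>e x t. e \<in> E \<Longrightarrow> x \<in> N \<Longrightarrow> t \<in> carrier G \<Longrightarrow> u e (x \<otimes> t) = u e t"
    and wN: "\<And>e x t. e \<in> E \<Longrightarrow> x \<in> N \<Longrightarrow> t \<in> carrier G \<Longrightarrow> w e (x \<otimes> t) = w e t"
    and orth: "\<And>e e'. e \<in> E \<Longrightarrow> e' \<in> E \<Longrightarrow> (\<Sum>g\<in>carrier G. u e g * w e' g) = (if e = e' then 1 else 0)"
    and complete: "\<And>f t. \<lbrakk>\<And>x t. x \<in> N \<Longrightarrow> t \<in> carrier G \<Longrightarrow> f (x \<otimes> t) = f t;
      \<And>e. e \<in> E \<Longrightarrow> (\<Sum>g\<in>carrier G. f g * w e g) = 0; t \<in> carrier G\<rbrakk> \<Longrightarrow> f t = 0"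
  shows "card E * card N = Coset.order G"
proof -
  interpret N: normal N G by (rule N)
  have NG: "x \<in> carrier G" if "x \<in> N" for x using N.subset that by auto
  have one: "1 = (\<Sum>e\<in>E. (\<Sum>x\<in>N. w e (x \<otimes> h)) * u e h)" if h: "h \<in> carrier G" for h
  proof -
    define \<delta> :: "'a \<Rightarrow> complex" where "\<delta> t = (if t \<otimes> inv h \<in> N then 1 else 0)" for t
    have \<delta>N: "\<delta> (x \<otimes> t) = \<delta> t" if "x \<in> N" "t \<in> carrier G" for x t
    proof -
      have eq: "x \<otimes> t \<otimes> inv h = x \<otimes> (t \<otimes> inv h)" using that NG h by (simp add: m_assoc)
      have "t \<otimes> inv h \<in> N" if "x \<otimes> (t \<otimes> inv h) \<in> N"
      proof -
        have "inv x \<otimes> (x \<otimes> (t \<otimes> inv h)) \<in> N" using that \<open>x \<in> N\<close> by simp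
        thus ?thesis using NG[OF \<open>x \<in> N\<close>] \<open>t \<in> carrier G\<close> h by (simp add: m_assoc[symmetric])
      qed
      thus ?thesis using that eq by (auto simp: \<delta>_def)
    qed
    define c where "c e = (\<Sum>g\<in>carrier G. \<delta> g * w e g)" for e
    have "\<delta> h - (\<Sum>e\<in>E. c e * u e h) = 0"
    proof (rule complete[where f = "\<lambda>t. \<delta> t - (\<Sum>e\<in>E. c e * u e t)"])
      fix x t assume "x \<in> N" "t \<in> carrier G"
      thus "\<delta> (x \<otimes> t) - (\<Sum>e\<in>E. c e * u e (x \<otimes> t)) = \<delta> t - (\<Sum>e\<in>E. c e * u e t)"
        using \<delta>N uN by simp
    next
      fix e assume e: "e \<in> E"
      have "(\<Sum>g\<in>carrier G. (\<Sum>e'\<in>E. c e' * u e' g) * w e g) = (\<Sum>g\<in>carrier G. \<Sum>e'\<in>E. c e' * (u e' g * w e g))"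
        by (simp add: sum_distrib_right mult.assoc)
      also have "\<dots> = (\<Sum>e'\<in>E. c e' * (\<Sum>g\<in>carrier G. u e' g * w e g))"
        by (subst sum.swap) (simp add: sum_distrib_left)
      also have "\<dots> = (\<Sum>e'\<in>E. if e' = e then c e else 0)"
        using e orth by (intro sum.cong) auto
      also have "\<dots> = c e" using e E by simp
      finally show "(\<Sum>g\<in>carrier G. (\<delta> g - (\<Sum>e'\<in>E. c e' * u e' g)) * w e g) = 0"
        by (simp add: left_diff_distrib sum_subtractf c_def)
    qed (rule h)
    moreover have "\<delta> h = 1" using h by (simp add: \<delta>_def)
    moreover have "c e = (\<Sum>x\<in>N. w e (x \<otimes> h))" for e
    proof -
      have "c e = (\<Sum>g | g \<in> carrier G \<and> g \<otimes> inv h \<in> N. w e g)"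
        unfolding c_def \<delta>_def using finite_carrier
        by (intro sum.mono_neutral_cong_right) auto
      also have "\<dots> = (\<Sum>x\<in>N. w e (x \<otimes> h))"
        using h NG by (intro sum.reindex_bij_witness[of _ "\<lambda>x. x \<otimes> h" "\<lambda>g. g \<otimes> inv h"]) (auto simp: m_assoc)
      finally show ?thesis .
    qed
    ultimately show ?thesis by simp
  qed
  have "of_nat (Coset.order G) = (\<Sum>h\<in>carrier G. 1 :: complex)" by (simp add: Coset.order_def)
  also have "\<dots> = (\<Sum>h\<in>carrier G. \<Sum>e\<in>E. (\<Sum>x\<in>N. w e (x \<otimes> h)) * u e h)"
    using one by (intro sum.cong) auto
  also have "\<dots> = (\<Sum>h\<in>carrier G. \<Sum>e\<in>E. of_nat (card N) * (u e h * w e h))"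
    using wN by (intro sum.cong refl) (simp add: algebra_simps)
  also have "\<dots> = (\<Sum>e\<in>E. of_nat (card N) * (\<Sum>h\<in>carrier G. u e h * w e h))"
    by (subst sum.swap) (simp add: sum_distrib_left)
  also have "\<dots> = of_nat (card E * card N)" using orth by simp
  finally show ?thesis by (metis of_nat_eq_iff)
qed

text \<open>Similar representations have matrix coefficients spanning the same space. So
  orthogonality to one chosen representation per character implies it for all of them.\<close>

lemma orthogonal_same_character:
  assumes r: "irreducible_representation G n \<rho>" and s: "irreducible_representation G m \<sigma>"
    and eq: "character_of G \<sigma> = character_of G \<rho>"
    and 0: "\<And>k l. k < n \<Longrightarrow> l < n \<Longrightarrow> (\<Sum>t\<in>carrier G. f t * \<rho> (inv t) $$ (k,l)) = 0"
    and kl: "k < m" "l < m"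
  shows "(\<Sum>t\<in>carrier G. f t * \<sigma> (inv t) $$ (k,l)) = 0"
proof -
  obtain T R where mn: "m = n" and T: "T \<in> carrier_mat n n" and R: "R \<in> carrier_mat n n"
    and \<sigma>: "\<And>g. g \<in> carrier G \<Longrightarrow> \<sigma> g = T * \<rho> g * R"
    using same_character_imp_similar[OF r s eq] by metis
  have "(\<Sum>t\<in>carrier G. f t * \<sigma> (inv t) $$ (k,l)) =
    (\<Sum>t\<in>carrier G. \<Sum>b\<in>{0..<n}. \<Sum>a\<in>{0..<n}. T $$ (k,a) * R $$ (b,l) * (f t * \<rho> (inv t) $$ (a,b)))"
  proof (intro sum.cong refl)
    fix t assume t: "t \<in> carrier G"
    have c: "\<rho> (inv t) \<in> carrier_mat n n" using rep_carrier[OF irrD(1)[OF r]] t by simp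
    have "(T * \<rho> (inv t) * R) $$ (k,l) = (\<Sum>b\<in>{0..<n}. (T * \<rho> (inv t)) $$ (k,b) * R $$ (b,l))"
      using c T R kl mn by (simp add: scalar_prod_def del: assoc_mult_mat)
    also have "\<dots> = (\<Sum>b\<in>{0..<n}. (\<Sum>a\<in>{0..<n}. T $$ (k,a) * \<rho> (inv t) $$ (a,b)) * R $$ (b,l))"
      using c T kl mn by (intro sum.cong refl) (simp add: scalar_prod_def)
    finally show "f t * \<sigma> (inv t) $$ (k,l) =
      (\<Sum>b\<in>{0..<n}. \<Sum>a\<in>{0..<n}. T $$ (k,a) * R $$ (b,l) * (f t * \<rho> (inv t) $$ (a,b)))"
      using \<sigma>[of "inv t"] t by (simp add: sum_distrib_left sum_distrib_right algebra_simps)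
  qed
  also have "\<dots> = (\<Sum>b\<in>{0..<n}. \<Sum>a\<in>{0..<n}. T $$ (k,a) * R $$ (b,l) * (\<Sum>t\<in>carrier G. f t * \<rho> (inv t) $$ (a,b)))"
    by (subst sum.swap, intro sum.cong refl, subst sum.swap) (simp add: sum_distrib_left)
  also have "\<dots> = 0" using 0 by simp
  finally show ?thesis .
qed

text \<open>Character values are complex; this extracts \<chi>(1) as a natural number, which is
  exact on characters.\<close>

definition char_degree :: "('a \<Rightarrow> complex) \<Rightarrow> nat" where
  "char_degree \<chi> = nat \<lfloor>Re (\<chi> \<one>)\<rfloor>"

lemma char_degree_character_of: "representation G n \<rho> \<Longrightarrow> char_degree (character_of G \<rho>) = n"
  by (simp add: char_degree_def character_of_one)

lemma IrrE:
  assumes "\<chi> \<in> Irr G"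
  obtains \<rho> where "irreducible_representation G (char_degree \<chi>) \<rho>" "\<chi> = character_of G \<rho>"
proof -
  obtain n \<rho> where r: "irreducible_representation G n \<rho>" "\<chi> = character_of G \<rho>"
    using assms by (auto simp: Irr_def)
  thus ?thesis using that char_degree_character_of[OF irrD(1)[OF r(1)]] by simp
qed

lemma IrrI: "irreducible_representation G n \<rho> \<Longrightarrow> character_of G \<rho> \<in> Irr G"
  by (auto simp: Irr_def)

lemma char_one: "\<chi> \<in> Irr G \<Longrightarrow> \<chi> \<one> = of_nat (char_degree \<chi>)"
  by (elim IrrE) (metis character_of_one irrD(1))

lemma char_degree_pos: "\<chi> \<in> Irr G \<Longrightarrow> char_degree \<chi> > 0"
  by (elim IrrE) (metis irrD(2))

lemma group_index_mult_card:
  assumes "subgroup H G"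
  shows "group_index G H * card H = Coset.order G"
  using lagrange[OF assms] by (simp add: group_index_def)

text \<open>Choose one representation for each character with \<open>N\<close> in its kernel. Their
  matrix coefficients form a basis of the functions constant on the cosets of \<open>N\<close>, a
  space of dimension |G:N|.\<close>

theorem sum_degree_squares:
  assumes N: "N \<lhd> G"
  shows "(\<Sum>\<chi> | \<chi> \<in> Irr G \<and> N \<subseteq> char_ker G \<chi>. (char_degree \<chi>)\<^sup>2) = group_index G N"
proof -
  define K where "K = {\<chi>. \<chi> \<in> Irr G \<and> N \<subseteq> char_ker G \<chi>}"
  interpret N: normal N G by (rule N)
  have NG: "x \<in> carrier G" if "x \<in> N" for x using N.subset that by auto
  have finK: "finite K" using finite_Irr by (simp add: K_def)
  have "\<exists>\<rho>. irreducible_representation G (char_degree \<chi>) \<rho> \<and> \<chi> = character_of G \<rho>" if "\<chi> \<in> K" for \<chi>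
    using that IrrE by (auto simp: K_def)
  then obtain \<rho> where \<rho>: "\<And>\<chi>. \<chi> \<in> K \<Longrightarrow> irreducible_representation G (char_degree \<chi>) (\<rho> \<chi>)"
    and \<rho>\<chi>: "\<And>\<chi>. \<chi> \<in> K \<Longrightarrow> \<chi> = character_of G (\<rho> \<chi>)" by metis
  note r1 = irrD(1)[OF \<rho>]
  have \<rho>N: "\<rho> \<chi> x = 1\<^sub>m (char_degree \<chi>)" if "\<chi> \<in> K" "x \<in> N" for \<chi> x
    using char_ker_character_of[OF r1[OF that(1)]] \<rho>\<chi>[OF that(1)] that by (auto simp: K_def)
  define E where "E = (SIGMA \<chi>:K. {..<char_degree \<chi>} \<times> {..<char_degree \<chi>})"
  define u where "u = (\<lambda>(\<chi>,i,j) g. \<rho> \<chi> g $$ (i,j))"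
  \<comment> \<open>The dual basis: orthogonality pairs the coefficient \<open>(i,j)\<close> of
    \<open>\<rho> g\<close> with the coefficient \<open>(j,i)\<close> of
    \<open>\<rho> (inv g)\<close>, and the factor normalizes that pairing to 1.\<close>
  define w where "w = (\<lambda>(\<chi>,i,j) g. of_nat (char_degree \<chi>) / of_nat (Coset.order G) * \<rho> \<chi> (inv g) $$ (j,i))"
  have "card E * card N = Coset.order G"
  proof (rule biorthogonal_basis_card[where u = u and w = w])
    show "finite E" using finK by (simp add: E_def)
  next
    fix e x t assume e: "e \<in> E" and x: "x \<in> N" and t: "t \<in> carrier G"
    obtain \<chi> i j where e': "e = (\<chi>,i,j)" by (cases e)
    hence \<chi>: "\<chi> \<in> K" "i < char_degree \<chi>" "j < char_degree \<chi>" using e by (auto simp: E_def)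
    note c = rep_carrier[OF r1[OF \<chi>(1)]]
    show "u e (x \<otimes> t) = u e t"
      using rep_mult[OF r1[OF \<chi>(1)] NG[OF x] t] \<rho>N[OF \<chi>(1) x] c[OF t] by (simp add: u_def e')
    have "\<rho> \<chi> (inv (x \<otimes> t)) = \<rho> \<chi> (inv t) * \<rho> \<chi> (inv x)"
      using rep_mult[OF r1[OF \<chi>(1)], of "inv t" "inv x"] NG[OF x] t by (simp add: inv_mult_group)
    also have "\<dots> = \<rho> \<chi> (inv t)" using \<rho>N[OF \<chi>(1), of "inv x"] x c[of "inv t"] t by simp
    finally show "w e (x \<otimes> t) = w e t" by (simp add: w_def e')
  next
    fix e e' assume "e \<in> E" "e' \<in> E"
    then obtain \<chi> i j \<psi> k l where e: "e = (\<chi>,i,j)" "\<chi> \<in> K" "i < char_degree \<chi>" "j < char_degree \<chi>"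
      and e': "e' = (\<psi>,k,l)" "\<psi> \<in> K" "k < char_degree \<psi>" "l < char_degree \<psi>"
      by (auto simp: E_def)
    have "(\<Sum>g\<in>carrier G. u e g * w e' g) =
      of_nat (char_degree \<psi>) / of_nat (Coset.order G) * (\<Sum>g\<in>carrier G. \<rho> \<chi> g $$ (i,j) * \<rho> \<psi> (inv g) $$ (l,k))"
      by (simp add: u_def w_def e(1) e'(1) sum_distrib_left mult.left_commute)
    also have "\<dots> = (if e = e' then 1 else 0)"
    proof (cases "\<chi> = \<psi>")
      case True
      have lk: "l < char_degree \<chi>" "k < char_degree \<chi>" using True e'(3,4) by auto
      have "(\<Sum>g\<in>carrier G. \<rho> \<chi> g $$ (i,j) * \<rho> \<chi> (inv g) $$ (l,k)) =
        (if i = k \<and> j = l then of_nat (Coset.order G) / of_nat (char_degree \<chi>) else 0)"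
        by (rule orthogonality_eq[OF \<rho>[OF e(2)] e(3,4) lk])
      moreover have "e = e' \<longleftrightarrow> i = k \<and> j = l" using True e(1) e'(1) by simp
      ultimately show ?thesis using True order_pos e(3) by simp
    next
      case False
      hence "character_of G (\<rho> \<chi>) \<noteq> character_of G (\<rho> \<psi>)" using \<rho>\<chi>[OF e(2)] \<rho>\<chi>[OF e'(2)] by simp
      hence "(\<Sum>g\<in>carrier G. \<rho> \<chi> g $$ (i,j) * \<rho> \<psi> (inv g) $$ (l,k)) = 0"
        by (rule orthogonality_neq[OF \<rho>[OF e'(2)] \<rho>[OF e(2)] _ e(3,4) e'(4,3)])
      thus ?thesis using False e(1) e'(1) by simp
    qed
    finally show "(\<Sum>g\<in>carrier G. u e g * w e' g) = (if e = e' then 1 else 0)" .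
  next
    fix f :: "'a \<Rightarrow> complex" and t
    assume fN: "\<And>x t. x \<in> N \<Longrightarrow> t \<in> carrier G \<Longrightarrow> f (x \<otimes> t) = f t"
      and f0: "\<And>e. e \<in> E \<Longrightarrow> (\<Sum>g\<in>carrier G. f g * w e g) = 0" and t: "t \<in> carrier G"
    show "f t = 0"
    proof (rule matrix_coefficients_complete[OF N fN _ t])
      fix n \<sigma> k l
      assume s: "irreducible_representation G n \<sigma>" "\<And>x. x \<in> N \<Longrightarrow> \<sigma> x = 1\<^sub>m n" "k < n" "l < n"
      define \<chi> where "\<chi> = character_of G \<sigma>"
      have \<chi>: "\<chi> \<in> K"
        using IrrI[OF s(1)] char_ker_character_of[OF irrD(1)[OF s(1)]] s(2) NG by (auto simp: K_def \<chi>_def)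
      show "(\<Sum>t\<in>carrier G. f t * \<sigma> (inv t) $$ (k,l)) = 0"
      proof (rule orthogonal_same_character[OF \<rho>[OF \<chi>] s(1) _ _ s(3,4)])
        show "character_of G \<sigma> = character_of G (\<rho> \<chi>)" using \<rho>\<chi>[OF \<chi>] by (simp add: \<chi>_def)
        fix k l assume kl: "k < char_degree \<chi>" "l < char_degree \<chi>"
        hence "(\<chi>,l,k) \<in> E" using \<chi> by (simp add: E_def)
        from f0[OF this] have "of_nat (char_degree \<chi>) / of_nat (Coset.order G) *
          (\<Sum>t\<in>carrier G. f t * \<rho> \<chi> (inv t) $$ (k,l)) = 0"
          by (simp add: w_def sum_distrib_left mult.left_commute)
        thus "(\<Sum>t\<in>carrier G. f t * \<rho> \<chi> (inv t) $$ (k,l)) = 0" using order_pos kl by simp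
      qed
    qed auto
  qed (use N in auto)
  moreover have "card E = (\<Sum>\<chi>\<in>K. (char_degree \<chi>)\<^sup>2)"
    using finK by (simp add: E_def power2_eq_square)
  moreover have "card N > 0" using N.subgroup_axioms finite_subset[OF N.subset finite_carrier]
    by (metis card_gt_0_iff N.one_closed empty_iff)
  ultimately show ?thesis
    using group_index_mult_card[OF N.subgroup_axioms] by (metis K_def mult_cancel2 less_numeral_extra(3))
qed

end

section \<open>Degrees and linear characters\<close>

context fin_group
begin

lemma group_index_pos: "subgroup H G \<Longrightarrow> group_index G H > 0"
  using group_index_mult_card[of H] order_pos by (metis gr0I mult_0)

text \<open>\<open>H\<close> only rescales \<open>v\<close>, so up to scalars the orbit of
  \<open>v\<close> has one vector for each coset of \<open>H\<close>. These vectors span a nonzero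
  invariant subspace, which is the whole space.\<close>

lemma irr_dim_le_index:
  assumes r: "irreducible_representation G n \<rho>" and H: "subgroup H G"
    and v: "v \<in> carrier_vec n" "v \<noteq> 0\<^sub>v n"
    and eig: "\<And>h. h \<in> H \<Longrightarrow> \<exists>c. \<rho> h *\<^sub>v v = c \<cdot>\<^sub>v v"
  shows "n \<le> group_index G H"
proof -
  interpret H: subgroup H G by (rule H)
  note r1 = irrD(1)[OF r] and rc = rep_carrier[OF irrD(1)[OF r]]
  have fin: "finite (rcosets H)" using finite_carrier by (simp add: RCOSETS_def)
  obtain C where C: "bij_betw C {0..<group_index G H} (rcosets H)"
    unfolding group_index_def using ex_bij_betw_nat_finite[OF fin] by blast
  define k where "k = group_index G H"
  \<comment> \<open>The cosets are right cosets of \<open>H\<close>, while the orbit of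
    \<open>v\<close> depends on left cosets; hence the representatives are inverted.\<close>
  have ex: "\<exists>t \<in> carrier G. inv t \<in> C j" if "j < k" for j
  proof -
    have "C j \<in> rcosets H" using C that by (auto simp: bij_betw_def k_def)
    then obtain g where g: "g \<in> carrier G" "C j = H #> g" by (auto simp: RCOSETS_def)
    thus ?thesis using rcos_self[OF g(1) H] by (intro bexI[of _ "inv g"]) auto
  qed
  then obtain t where t: "\<And>j. j < k \<Longrightarrow> t j \<in> carrier G" "\<And>j. j < k \<Longrightarrow> inv (t j) \<in> C j" by metis
  define M where "M = mat n k (\<lambda>(i,j). (\<rho> (t j) *\<^sub>v v) $ i)"
  have M: "M \<in> carrier_mat n k" by (simp add: M_def)
  have colM: "col M j = \<rho> (t j) *\<^sub>v v" if "j < k" for j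
    using that rc[OF t(1)[OF that]] v by (intro eq_vecI) (auto simp: M_def)
  have W: "lin_subspace n (mat_range M)" by (rule lin_subspace_range[OF M])
  have orbit: "\<rho> g *\<^sub>v v \<in> mat_range M" if g: "g \<in> carrier G" for g
  proof -
    have "H #> inv g \<in> rcosets H" using g by (auto simp: RCOSETS_def)
    hence "H #> inv g \<in> C ` {0..<k}" using C by (simp add: bij_betw_def k_def)
    then obtain j where j: "j < k" "C j = H #> inv g" by auto
    then obtain h where h: "h \<in> H" "inv (t j) = h \<otimes> inv g" using t(2)[OF j(1)] by (auto simp: r_coset_def)
    have "t j = inv (h \<otimes> inv g)" using h(2) t(1)[OF j(1)] by (metis inv_inv)
    hence "t j = g \<otimes> inv h" using g h(1) by (simp add: inv_mult_group)
    hence gt: "g = t j \<otimes> h" using g h(1) by (simp add: m_assoc)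
    obtain c where c: "\<rho> h *\<^sub>v v = c \<cdot>\<^sub>v v" using eig[OF h(1)] by blast
    have "\<rho> g *\<^sub>v v = \<rho> (t j) *\<^sub>v (\<rho> h *\<^sub>v v)"
      using rep_mult[OF r1 t(1)[OF j(1)], of h] gt h(1)
        assoc_mult_mat_vec[OF rc[OF t(1)[OF j(1)]] rc[of h] v(1)] by simp
    also have "\<dots> = c \<cdot>\<^sub>v col M j"
      using c colM[OF j(1)] mult_mat_vec[OF rc[OF t(1)[OF j(1)]] v(1)] by simp
    also have "col M j = M *\<^sub>v unit_vec k j" using M j by (intro eq_vecI) auto
    finally show ?thesis using W M unfolding lin_subspace_def by (auto simp: mat_range_def)
  qed
  have inv: "\<rho> g *\<^sub>v w \<in> mat_range M" if g: "g \<in> carrier G" and w: "w \<in> mat_range M" for g w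
  proof -
    have gM: "\<rho> g * M \<in> carrier_mat n k" using rc[OF g] M by simp
    have "col (\<rho> g * M) j \<in> mat_range M" if j: "j < k" for j
    proof -
      have "col (\<rho> g * M) j = \<rho> (g \<otimes> t j) *\<^sub>v v"
        using col_mult2[OF rc[OF g] M j] colM[OF j] rep_mult[OF r1 g t(1)[OF j]]
          assoc_mult_mat_vec[OF rc[OF g] rc[OF t(1)[OF j]] v(1)] by simp
      thus ?thesis using orbit g t(1)[OF j] by simp
    qed
    then obtain D where D: "D \<in> carrier_mat k k" "\<rho> g * M = M * D" using mat_range_factor[OF M gM] by blast
    obtain c where c: "c \<in> carrier_vec k" "w = M *\<^sub>v c" using w M by (auto simp: mat_range_def)
    have "\<rho> g *\<^sub>v w = (\<rho> g * M) *\<^sub>v c" using assoc_mult_mat_vec[OF rc[OF g] M c(1)] c(2) by simp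
    also have "\<dots> = M *\<^sub>v (D *\<^sub>v c)" using D assoc_mult_mat_vec[OF M D(1) c(1)] by simp
    finally show ?thesis using M mult_mat_vec_carrier[OF D(1) c(1)] by (auto simp: mat_range_def)
  qed
  have "mat_range M \<noteq> {0\<^sub>v n}" using orbit[OF one_closed] v rep_one[OF r1] by auto
  hence full: "mat_range M = carrier_vec n" using irrD(3)[OF r W inv] by auto
  have "col (1\<^sub>m n) j \<in> mat_range M" for j unfolding full by (intro carrier_vecI) simp
  then obtain D where "D \<in> carrier_mat k n" "1\<^sub>m n = M * D" using mat_range_factor[OF M one_carrier_mat] by metis
  thus ?thesis using inner_dim_le[OF M] by (auto simp: k_def)
qed

text \<open>An eigenvector of the matrix of \<open>x\<close> is a common eigenvector for all powers
  of \<open>x\<close>, hence for \<open>H\<close>.\<close>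

lemma char_degree_le_index_cyclic:
  assumes \<chi>: "\<chi> \<in> Irr G" and x: "x \<in> carrier G" and H: "subgroup H G"
    and pow: "\<And>h. h \<in> H \<Longrightarrow> \<exists>i::nat. h = x [^] i"
  shows "char_degree \<chi> \<le> group_index G H"
proof -
  obtain \<rho> where r: "irreducible_representation G (char_degree \<chi>) \<rho>" using \<chi> by (rule IrrE)
  define n where "n = char_degree \<chi>"
  note r = r[folded n_def]
  note rc = rep_carrier[OF irrD(1)[OF r] x]
  have "degree (char_poly (\<rho> x)) = n" using degree_monic_char_poly[OF rc] by simp
  hence "\<not> constant (poly (char_poly (\<rho> x)))" using irrD(2)[OF r] by (simp add: constant_degree)
  then obtain c where "poly (char_poly (\<rho> x)) c = 0" using fundamental_theorem_of_algebra by blast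
  hence "eigenvalue (\<rho> x) c" using eigenvalue_root_char_poly[OF rc] by simp
  then obtain v where v: "v \<in> carrier_vec n" "v \<noteq> 0\<^sub>v n" "\<rho> x *\<^sub>v v = c \<cdot>\<^sub>v v"
    using rc by (auto simp: eigenvalue_def eigenvector_def)
  have p: "\<rho> (x [^] (i::nat)) *\<^sub>v v = c ^ i \<cdot>\<^sub>v v" for i
  proof (induction i)
    case 0
    thus ?case using rep_one[OF irrD(1)[OF r]] v by simp
  next
    case (Suc i)
    have "\<rho> (x [^] Suc i) *\<^sub>v v = \<rho> (x [^] i) *\<^sub>v (\<rho> x *\<^sub>v v)"
      using rep_mult[OF irrD(1)[OF r], of "x [^] i" x] x
        assoc_mult_mat_vec[OF rep_carrier[OF irrD(1)[OF r], of "x [^] i"] rc v(1)] by simp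
    also have "\<dots> = c \<cdot>\<^sub>v (\<rho> (x [^] i) *\<^sub>v v)"
      using v mult_mat_vec[OF rep_carrier[OF irrD(1)[OF r], of "x [^] i"] v(1)] x by simp
    finally show ?case using Suc v by (simp add: smult_smult_assoc)
  qed
  show ?thesis unfolding n_def[symmetric]
    by (rule irr_dim_le_index[OF r H v(1,2)]) (metis pow p)
qed

text \<open>By Schur every group element acts as a scalar, so every nonzero vector is a common
  eigenvector for the whole group, which has index 1 in itself.\<close>

lemma irr_commuting_dim:
  assumes r: "irreducible_representation G n \<rho>"
    and comm: "\<And>g h. g \<in> carrier G \<Longrightarrow> h \<in> carrier G \<Longrightarrow> \<rho> g * \<rho> h = \<rho> h * \<rho> g"
  shows "n = 1"
proof -
  have "\<exists>c. \<rho> h *\<^sub>v unit_vec n 0 = c \<cdot>\<^sub>v unit_vec n 0" if h: "h \<in> carrier G" for h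
  proof -
    obtain c where c: "\<rho> h = c \<cdot>\<^sub>m 1\<^sub>m n"
      using schur_scalar[OF r rep_carrier[OF irrD(1)[OF r] h] comm[OF _ h]] by blast
    have "\<rho> h *\<^sub>v unit_vec n 0 = c \<cdot>\<^sub>v unit_vec n 0"
      using irrD(2)[OF r] by (intro eq_vecI) (auto simp: c)
    thus ?thesis by blast
  qed
  moreover have "unit_vec n 0 \<noteq> (0\<^sub>v n :: complex vec)"
    using irrD(2)[OF r] by (metis index_unit_vec(1) index_zero_vec(1) zero_neq_one)
  ultimately have "n \<le> group_index G (carrier G)"
    by (intro irr_dim_le_index[OF r subgroup_self unit_vec_carrier])
  moreover have "group_index G (carrier G) = 1"
    using group_index_mult_card[OF subgroup_self] order_pos by (simp add: Coset.order_def)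
  ultimately show ?thesis using irrD(2)[OF r] by simp
qed

lemma char_ker_normal:
  assumes "\<chi> \<in> Irr G"
  shows "char_ker G \<chi> \<lhd> G"
proof -
  obtain n \<rho> where r: "irreducible_representation G n \<rho>" "\<chi> = character_of G \<rho>"
    using assms by (auto simp: Irr_def)
  note r1 = irrD(1)[OF r(1)]
  have K: "char_ker G \<chi> = {g \<in> carrier G. \<rho> g = 1\<^sub>m n}" using char_ker_character_of[OF r1] r(2) by simp
  show ?thesis unfolding normal_inv_iff K
  proof (intro conjI ballI subgroupI)
    show "{g \<in> carrier G. \<rho> g = 1\<^sub>m n} \<noteq> {}" using rep_one[OF r1] by blast
    fix g assume g: "g \<in> {g \<in> carrier G. \<rho> g = 1\<^sub>m n}"
    thus "inv g \<in> {g \<in> carrier G. \<rho> g = 1\<^sub>m n}"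
      using rep_inv(1)[OF r1, of g] rep_carrier[OF r1, of "inv g"] by simp
    show "g \<otimes> h \<in> {g \<in> carrier G. \<rho> g = 1\<^sub>m n}" if "h \<in> {g \<in> carrier G. \<rho> g = 1\<^sub>m n}" for h
      using g that rep_mult[OF r1] by simp
  next
    fix x k assume x: "x \<in> carrier G" and k: "k \<in> {g \<in> carrier G. \<rho> g = 1\<^sub>m n}"
    have "\<rho> (x \<otimes> k \<otimes> inv x) = \<rho> x * 1\<^sub>m n * \<rho> (inv x)"
      using rep_mult[OF r1, of "x \<otimes> k" "inv x"] rep_mult[OF r1 x, of k] x k by simp
    also have "\<dots> = 1\<^sub>m n" using rep_inv(1)[OF r1 x] rep_carrier[OF r1 x] by simp
    finally show "x \<otimes> k \<otimes> inv x \<in> {g \<in> carrier G. \<rho> g = 1\<^sub>m n}" using x k by simp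
  qed auto
qed

section \<open>Linear characters and the derived subgroup\<close>

lemma linear_char_mult:
  assumes "\<chi> \<in> Irr G" "char_degree \<chi> = 1" "g \<in> carrier G" "h \<in> carrier G"
  shows "\<chi> (g \<otimes> h) = \<chi> g * \<chi> h"
proof -
  obtain \<rho> where r: "irreducible_representation G 1 \<rho>" "\<chi> = character_of G \<rho>"
    using assms(1,2) IrrE by metis
  note c = rep_carrier[OF irrD(1)[OF r(1)]]
  have "\<rho> (g \<otimes> h) = \<rho> g * \<rho> h" using rep_mult[OF irrD(1)[OF r(1)]] assms by simp
  moreover have "mat_trace A = A $$ (0,0)" if "A \<in> carrier_mat 1 1" for A using that by (simp add: mat_trace_def)
  ultimately show ?thesis
    using r(2) assms c[of g] c[of h] by (simp add: character_of_eq scalar_prod_def)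
qed

lemma linear_char_pow:
  assumes "\<chi> \<in> Irr G" "char_degree \<chi> = 1" "g \<in> carrier G"
  shows "\<chi> (g [^] (k::nat)) = \<chi> g ^ k"
  using assms char_one[OF assms(1)] by (induction k) (auto simp: linear_char_mult)

lemma linear_char_in_ker:
  assumes "\<chi> \<in> Irr G" "char_degree \<chi> = 1"
  shows "g \<in> char_ker G \<chi> \<longleftrightarrow> g \<in> carrier G \<and> \<chi> g = 1"
  using char_one[OF assms(1)] assms(2) by (auto simp: char_ker_def)

lemma linear_charI:
  assumes mult: "\<And>g h. g \<in> carrier G \<Longrightarrow> h \<in> carrier G \<Longrightarrow> f (g \<otimes> h) = f g * f h" and one: "f \<one> = 1"
  shows "restrict f (carrier G) \<in> Irr G" "char_degree (restrict f (carrier G)) = 1"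
proof -
  define \<rho> where "\<rho> g = mat 1 1 (\<lambda>_. f g)" for g
  have rep: "representation G 1 \<rho>"
    by (rule representationI) (auto simp: \<rho>_def mult one scalar_prod_def intro!: eq_matI)
  have irr: "irreducible_representation G 1 \<rho>"
    unfolding irr_iff
  proof (intro conjI allI impI rep)
    fix W assume W: "lin_subspace 1 W \<and> (\<forall>g\<in>carrier G. \<forall>v\<in>W. \<rho> g *\<^sub>v v \<in> W)"
    show "W = {0\<^sub>v 1} \<or> W = carrier_vec 1"
    proof (cases "W \<subseteq> {0\<^sub>v 1}")
      case True
      thus ?thesis using W by (auto simp: lin_subspace_def)
    next
      case False
      then obtain w where w: "w \<in> W" "w \<noteq> 0\<^sub>v 1" by auto
      hence wc: "w \<in> carrier_vec 1" using W by (auto simp: lin_subspace_def)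
      hence w0: "w $ 0 \<noteq> 0" using w(2) by (metis eq_vecI carrier_vecD index_zero_vec less_one)
      have "v \<in> W" if v: "v \<in> carrier_vec 1" for v
      proof -
        have "v = (v $ 0 / w $ 0) \<cdot>\<^sub>v w" using v wc w0 by (intro eq_vecI) auto
        thus ?thesis using W w(1) unfolding lin_subspace_def by metis
      qed
      thus ?thesis using W by (auto simp: lin_subspace_def)
    qed
  qed simp
  have eq: "character_of G \<rho> = restrict f (carrier G)"
    by (auto simp: character_of_def \<rho>_def mat_trace_def)
  show "restrict f (carrier G) \<in> Irr G" using IrrI[OF irr] eq by simp
  show "char_degree (restrict f (carrier G)) = 1" using char_degree_character_of[OF rep] eq by simp
qed

lemma derived_le_iff:
  assumes "subgroup K G"
  shows "derived G (carrier G) \<subseteq> K \<longleftrightarrow> (\<forall>g\<in>carrier G. \<forall>h\<in>carrier G. g \<otimes> h \<otimes> inv g \<otimes> inv h \<in> K)"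
proof
  assume le: "derived G (carrier G) \<subseteq> K"
  show "\<forall>g\<in>carrier G. \<forall>h\<in>carrier G. g \<otimes> h \<otimes> inv g \<otimes> inv h \<in> K"
  proof (intro ballI)
    fix g h assume "g \<in> carrier G" "h \<in> carrier G"
    hence "g \<otimes> h \<otimes> inv g \<otimes> inv h \<in> derived_set G (carrier G)" by blast
    thus "g \<otimes> h \<otimes> inv g \<otimes> inv h \<in> K"
      using le unfolding derived_def by (meson generate.incl subsetD)
  qed
next
  assume "\<forall>g\<in>carrier G. \<forall>h\<in>carrier G. g \<otimes> h \<otimes> inv g \<otimes> inv h \<in> K"
  thus "derived G (carrier G) \<subseteq> K"
    unfolding derived_def by (intro generate_subgroup_incl assms) auto
qed

lemma linear_iff_derived_le_ker:
  assumes \<chi>: "\<chi> \<in> Irr G"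
  shows "char_degree \<chi> = 1 \<longleftrightarrow> derived G (carrier G) \<subseteq> char_ker G \<chi>"
proof
  assume d: "char_degree \<chi> = 1"
  show "derived G (carrier G) \<subseteq> char_ker G \<chi>"
    unfolding derived_le_iff[OF normal_imp_subgroup[OF char_ker_normal[OF \<chi>]]]
  proof (intro ballI)
    fix g h assume gh: "g \<in> carrier G" "h \<in> carrier G"
    have i: "\<chi> k * \<chi> (inv k) = 1" if "k \<in> carrier G" for k
      using linear_char_mult[OF \<chi> d that, of "inv k"] char_one[OF \<chi>] d that by simp
    have "\<chi> (g \<otimes> h \<otimes> inv g \<otimes> inv h) = (\<chi> g * \<chi> (inv g)) * (\<chi> h * \<chi> (inv h))"
      using gh by (simp add: linear_char_mult[OF \<chi> d])
    thus "g \<otimes> h \<otimes> inv g \<otimes> inv h \<in> char_ker G \<chi>"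
      using gh i linear_char_in_ker[OF \<chi> d] by simp
  qed
next
  assume le: "derived G (carrier G) \<subseteq> char_ker G \<chi>"
  obtain \<rho> where r: "irreducible_representation G (char_degree \<chi>) \<rho>" "\<chi> = character_of G \<rho>"
    using \<chi> by (rule IrrE)
  note r1 = irrD(1)[OF r(1)]
  show "char_degree \<chi> = 1"
  proof (rule irr_commuting_dim[OF r(1)])
    fix g h assume gh: "g \<in> carrier G" "h \<in> carrier G"
    have "g \<otimes> h \<otimes> inv g \<otimes> inv h \<in> char_ker G \<chi>"
      using le gh derived_le_iff[OF normal_imp_subgroup[OF char_ker_normal[OF \<chi>]]] by blast
    hence k: "\<rho> (g \<otimes> h \<otimes> inv g \<otimes> inv h) = 1\<^sub>m (char_degree \<chi>)"
      using char_ker_character_of[OF r1] r(2) by simp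
    have "g \<otimes> h = (g \<otimes> h \<otimes> inv g \<otimes> inv h) \<otimes> (h \<otimes> g)" using gh by (simp add: m_assoc)
    hence "\<rho> (g \<otimes> h) = \<rho> (g \<otimes> h \<otimes> inv g \<otimes> inv h) * \<rho> (h \<otimes> g)"
      using rep_mult[OF r1, of "g \<otimes> h \<otimes> inv g \<otimes> inv h" "h \<otimes> g"] gh by simp
    thus "\<rho> g * \<rho> h = \<rho> h * \<rho> g"
      using k rep_mult[OF r1] gh rep_carrier[OF r1 gh(1)] rep_carrier[OF r1 gh(2)] by simp
  qed
qed

lemma card_Irr_ker_ge_derived:
  assumes "N \<lhd> G" "derived G (carrier G) \<subseteq> N"
  shows "card {\<chi> \<in> Irr G. N \<subseteq> char_ker G \<chi>} = group_index G N"
proof -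
  have "(\<Sum>\<chi> | \<chi> \<in> Irr G \<and> N \<subseteq> char_ker G \<chi>. (char_degree \<chi>)\<^sup>2) = card {\<chi> \<in> Irr G. N \<subseteq> char_ker G \<chi>}"
    using assms(2) linear_iff_derived_le_ker by (subst card_eq_sum, intro sum.cong) (auto dest: subset_trans)
  thus ?thesis using sum_degree_squares[OF assms(1)] by simp
qed

text \<open>Strictness comes from the trivial character, which also contributes to the sum of
  squares over the characters that contain ker \<chi> in their kernel.\<close>

lemma char_degree_square_less:
  assumes \<chi>: "\<chi> \<in> Irr G" and d: "char_degree \<chi> \<noteq> 1"
  shows "(char_degree \<chi>)\<^sup>2 < group_index G (char_ker G \<chi>)"
proof -
  define K where "K = char_ker G \<chi>"
  define \<iota> where "\<iota> = restrict (\<lambda>_. 1 :: complex) (carrier G)"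
  have \<iota>: "\<iota> \<in> Irr G" "char_degree \<iota> = 1" unfolding \<iota>_def by (rule linear_charI; simp)+
  have K: "K \<subseteq> char_ker G \<iota>" by (auto simp: K_def char_ker_def \<iota>_def)
  have "(\<Sum>\<psi>\<in>{\<chi>,\<iota>}. (char_degree \<psi>)\<^sup>2) \<le> (\<Sum>\<psi> | \<psi> \<in> Irr G \<and> K \<subseteq> char_ker G \<psi>. (char_degree \<psi>)\<^sup>2)"
    using finite_Irr \<chi> \<iota>(1) K by (intro sum_mono2) (auto simp: K_def)
  also have "\<dots> = group_index G K" unfolding K_def by (rule sum_degree_squares[OF char_ker_normal[OF \<chi>]])
  finally have "(\<Sum>\<psi>\<in>{\<chi>,\<iota>}. (char_degree \<psi>)\<^sup>2) \<le> group_index G K" .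
  moreover have "\<chi> \<noteq> \<iota>" using d \<iota>(2) by auto
  ultimately show ?thesis using \<iota>(2) by (simp add: K_def)
qed

lemma cod_eq_iff:
  assumes "\<chi> \<in> Irr G"
  shows "cod G \<chi> = of_nat c \<longleftrightarrow> group_index G (char_ker G \<chi>) = c * char_degree \<chi>"
  using char_degree_pos[OF assms] unfolding cod_def char_one[OF assms]
  by (simp add: divide_eq_eq) (metis of_nat_eq_iff of_nat_mult)

lemma pow_group_index_normal:
  assumes N: "N \<lhd> G" and g: "g \<in> carrier G"
  shows "g [^] group_index G N \<in> N"
proof -
  interpret N: normal N G by (rule N)
  have grp: "group (G Mod N)" by (rule N.factorgroup_is_group)
  have "(N #> g) [^]\<^bsub>G Mod N\<^esub> Coset.order (G Mod N) = N"
    using group.pow_order_eq_1[OF grp, of "N #> g"] g by (simp add: carrier_FactGroup)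
  hence "N #> (g [^] group_index G N) = N"
    using N.FactGroup_pow[OF g] by (simp add: Coset.order_def group_index_def FactGroup_def)
  thus ?thesis using rcos_self[OF _ N.subgroup_axioms, of "g [^] group_index G N"] g by simp
qed

text \<open>A linear character separates the cosets of its kernel, and here its values are
  \<open>m\<close>-th roots of unity, of which there are \<open>m\<close>.\<close>

lemma linear_char_index_le:
  assumes \<chi>: "\<chi> \<in> Irr G" "char_degree \<chi> = 1" and m: "m > 0"
    and pow: "\<And>g. g \<in> carrier G \<Longrightarrow> \<chi> g ^ m = 1"
  shows "group_index G (char_ker G \<chi>) \<le> m"
proof -
  define K where "K = char_ker G \<chi>"
  interpret K: normal K G unfolding K_def by (rule char_ker_normal[OF \<chi>(1)])
  have inj: "g \<in> K #> h" if "g \<in> carrier G" "h \<in> carrier G" "\<chi> g = \<chi> h" for g h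
  proof -
    have "\<chi> (g \<otimes> inv h) = \<chi> (h \<otimes> inv h)"
      using linear_char_mult[OF \<chi>, of g "inv h"] linear_char_mult[OF \<chi>, of h "inv h"] that by simp
    hence "g \<otimes> inv h \<in> K" unfolding K_def linear_char_in_ker[OF \<chi>] using that char_one[OF \<chi>(1)] \<chi>(2) by simp
    thus ?thesis using that by (intro K.rcos_module_rev) (auto intro: is_group)
  qed
  have "\<exists>g. g \<in> carrier G \<and> C = K #> g" if "C \<in> rcosets K" for C using that by (auto simp: RCOSETS_def)
  then obtain f where f: "\<And>C. C \<in> rcosets K \<Longrightarrow> f C \<in> carrier G \<and> C = K #> f C" by metis
  have "inj_on (\<lambda>C. \<chi> (f C)) (rcosets K)"
  proof (rule inj_onI)
    fix C D assume CD: "C \<in> rcosets K" "D \<in> rcosets K" "\<chi> (f C) = \<chi> (f D)"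
    have "f C \<in> K #> f D" using inj f CD by blast
    hence "K #> f D = K #> f C" using f[OF CD(2)] K.subgroup_axioms repr_independence by metis
    thus "C = D" using f CD(1,2) by metis
  qed
  moreover have "(\<lambda>C. \<chi> (f C)) ` (rcosets K) \<subseteq> {z. z ^ m = 1}" using f pow by auto
  moreover have "finite {z :: complex. z ^ m = 1}" "card {z :: complex. z ^ m = 1} = m"
    using m finite_roots_unity[of m] card_roots_unity_eq[of m] by auto
  ultimately show ?thesis
    unfolding K_def[symmetric] group_index_def by (metis card_inj_on_le)
qed

text \<open>The index of the kernel acts as the order of \<chi> in the dual group. One direction
  raises \<open>g\<close> to that index, which lands in the kernel; the other bounds the index by
  the number of roots of unity.\<close>

lemma linear_char_p_power_iff:
  assumes \<chi>: "\<chi> \<in> Irr G" "char_degree \<chi> = 1" and p: "p > 1" and j: "group_index G (char_ker G \<chi>) = p ^ j"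
  shows "j \<le> i \<longleftrightarrow> (\<forall>g\<in>carrier G. \<chi> g ^ (p ^ i) = 1)"
proof
  assume ji: "j \<le> i"
  show "\<forall>g\<in>carrier G. \<chi> g ^ (p ^ i) = 1"
  proof
    fix g assume g: "g \<in> carrier G"
    have "g [^] (p ^ j) \<in> char_ker G \<chi>"
      using pow_group_index_normal[OF char_ker_normal[OF \<chi>(1)] g] j by simp
    hence "\<chi> g ^ (p ^ j) = 1" using linear_char_in_ker[OF \<chi>] linear_char_pow[OF \<chi> g] by simp
    moreover have "p ^ i = p ^ j * p ^ (i - j)" using ji by (simp add: power_add[symmetric])
    ultimately show "\<chi> g ^ (p ^ i) = 1" by (simp add: power_mult)
  qed
next
  assume "\<forall>g\<in>carrier G. \<chi> g ^ (p ^ i) = 1"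
  hence "p ^ j \<le> p ^ i" using linear_char_index_le[OF \<chi>, of "p ^ i"] j p by simp
  thus "j \<le> i" using p by (metis power_le_imp_le_exp)
qed

end

section \<open>Finite p-groups\<close>

lemma (in monoid) pow_mod:
  assumes "x \<in> carrier G" "x [^] (m::nat) = \<one>"
  shows "x [^] (i mod m) = x [^] (i::nat)"
proof -
  have "x [^] i = x [^] (m * (i div m) + i mod m)" by simp
  also have "\<dots> = (x [^] m) [^] (i div m) \<otimes> x [^] (i mod m)"
    using assms(1) by (simp only: nat_pow_mult[symmetric] nat_pow_pow nat_pow_closed)
  finally show ?thesis using assms by simp
qed

lemma (in group) conj_pow:
  assumes "g \<in> carrier G" "x \<in> carrier G"
  shows "(g \<otimes> x \<otimes> inv g) [^] (i::nat) = g \<otimes> x [^] i \<otimes> inv g"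
  by (induction i) (use assms in \<open>auto simp: m_assoc\<close>)

context fin_group
begin

lemma finite_subgroupI:
  assumes S: "S \<subseteq> carrier G" "\<one> \<in> S" and mult: "\<And>x y. x \<in> S \<Longrightarrow> y \<in> S \<Longrightarrow> x \<otimes> y \<in> S"
  shows "subgroup S G"
proof (rule subgroupI)
  fix x assume x: "x \<in> S"
  have p: "x [^] (k::nat) \<in> S" for k by (induction k) (auto simp: S mult x)
  have xG: "x \<in> carrier G" using S x by auto
  have "x [^] (Coset.order G - 1) \<otimes> x = \<one>"
    using pow_order_eq_1[OF xG] order_pos nat_pow_Suc[of x "Coset.order G - 1"] by simp
  hence "inv x = x [^] (Coset.order G - 1)" using xG by (intro inv_equality) auto
  thus "inv x \<in> S" using p by simp
qed (use S mult in auto)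

lemma subgroup_pow_closed: "subgroup H G \<Longrightarrow> x \<in> H \<Longrightarrow> x [^] (k::nat) \<in> H"
  by (induction k) (auto intro: subgroup.one_closed subgroup.m_closed)

lemma finite_subset_carrier: "subgroup H G \<Longrightarrow> finite H"
  using finite_carrier finite_subset subgroup.subset by blast

lemma subgroup_card_pos: "subgroup H G \<Longrightarrow> card H > 0"
  using finite_subset_carrier[of H] subgroup.one_closed[of H G] by (metis card_gt_0_iff empty_iff)

lemma subgroup_card_dvd:
  assumes "subgroup H G" "subgroup K G" "H \<subseteq> K"
  shows "card H dvd card K"
proof -
  have "subgroup H (G\<lparr>carrier := K\<rparr>)" using subgroup_incl[OF assms] .
  from group.lagrange[OF subgroup_imp_group[OF assms(2)] this] show ?thesis
    by (simp add: Coset.order_def) (metis dvd_triv_right)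
qed

text \<open>The preimage in \<open>G\<close> of the centralizer of \<open>gK\<close> in G/K, for
  normal \<open>K\<close>. That a section D/K is central is written as
  \<open>D \<subseteq> commutes_mod K g\<close> for all \<open>g\<close>.\<close>

definition commutes_mod :: "'a set \<Rightarrow> 'a \<Rightarrow> 'a set" where
  "commutes_mod K g = {h \<in> carrier G. g \<otimes> h \<otimes> inv g \<otimes> inv h \<in> K}"

lemma commutes_modD:
  assumes K: "K \<lhd> G" and g: "g \<in> carrier G" and h: "h \<in> commutes_mod K g"
  obtains k where "k \<in> K" "g \<otimes> h = k \<otimes> (h \<otimes> g)"
proof
  have hG: "h \<in> carrier G" using h by (simp add: commutes_mod_def)
  show "g \<otimes> h \<otimes> inv g \<otimes> inv h \<in> K" using h by (simp add: commutes_mod_def)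
  show "g \<otimes> h = (g \<otimes> h \<otimes> inv g \<otimes> inv h) \<otimes> (h \<otimes> g)" using g hG by (simp add: m_assoc)
qed

lemma commutes_modI:
  assumes K: "K \<lhd> G" and g: "g \<in> carrier G" and h: "h \<in> carrier G" and k: "k \<in> K" "g \<otimes> h = k \<otimes> (h \<otimes> g)"
  shows "h \<in> commutes_mod K g"
proof -
  interpret K: normal K G by (rule K)
  have "g \<otimes> h \<otimes> inv g \<otimes> inv h = k" unfolding k(2) using g h k(1) by (simp add: m_assoc)
  thus ?thesis using h k(1) by (simp add: commutes_mod_def)
qed

lemma commutes_mod_sym:
  assumes K: "K \<lhd> G" and g: "g \<in> carrier G" and h: "h \<in> commutes_mod K g"
  shows "g \<in> commutes_mod K h"
proof -
  interpret K: normal K G by (rule K)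
  have hG: "h \<in> carrier G" using h by (simp add: commutes_mod_def)
  obtain k where k: "k \<in> K" "g \<otimes> h = k \<otimes> (h \<otimes> g)" using commutes_modD[OF K g h] .
  have "h \<otimes> g = inv k \<otimes> (g \<otimes> h)" unfolding k(2) using k(1) g hG by simp
  thus ?thesis using commutes_modI[OF K hG g] k(1) by blast
qed

lemma commutes_mod_subgroup:
  assumes K: "K \<lhd> G" and g: "g \<in> carrier G"
  shows "subgroup (commutes_mod K g) G"
proof (rule finite_subgroupI)
  interpret K: normal K G by (rule K)
  show "commutes_mod K g \<subseteq> carrier G" by (auto simp: commutes_mod_def)
  show "\<one> \<in> commutes_mod K g" using g by (intro commutes_modI[OF K g, of _ \<one>]) auto
  fix h h' assume h: "h \<in> commutes_mod K g" and h': "h' \<in> commutes_mod K g"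
  hence hG: "h \<in> carrier G" "h' \<in> carrier G" by (auto simp: commutes_mod_def)
  obtain k where k: "k \<in> K" "g \<otimes> h = k \<otimes> (h \<otimes> g)" using commutes_modD[OF K g h] .
  obtain k' where k': "k' \<in> K" "g \<otimes> h' = k' \<otimes> (h' \<otimes> g)" using commutes_modD[OF K g h'] .
  have "g \<otimes> (h \<otimes> h') = k \<otimes> h \<otimes> (g \<otimes> h')" using k g hG by (simp add: m_assoc[symmetric])
  also have "\<dots> = (k \<otimes> (h \<otimes> k' \<otimes> inv h)) \<otimes> (h \<otimes> h' \<otimes> g)"
    unfolding k'(2) using k k' g hG by (simp add: m_assoc)
  finally show "h \<otimes> h' \<in> commutes_mod K g"
    using k k' K.inv_op_closed2[OF hG(1) k'(1)] hG by (intro commutes_modI[OF K g]) auto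
qed

text \<open>In the induction step \<open>n [^] q\<close> has to move past \<open>y\<close>. The
  resulting error lies in \<open>M\<close> and is carried to the front by conjugation with a power
  of \<open>y\<close>, which keeps it in \<open>M\<close>.\<close>

lemma mult_pow_mod:
  assumes M: "M \<lhd> G" and y: "y \<in> carrier G" and n: "n \<in> carrier G" and c: "y \<in> commutes_mod M n"
  shows "\<exists>m\<in>M. (y \<otimes> n) [^] (q::nat) = m \<otimes> (y [^] q \<otimes> n [^] q)"
proof (induction q)
  case 0
  interpret M: normal M G by (rule M)
  show ?case by (intro bexI[of _ \<one>]) auto
next
  case (Suc q)
  interpret M: normal M G by (rule M)
  obtain m where m: "m \<in> M" "(y \<otimes> n) [^] q = m \<otimes> (y [^] q \<otimes> n [^] q)" using Suc by blast
  have "n \<in> commutes_mod M y" using commutes_mod_sym[OF M n c] .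
  hence "n [^] q \<in> commutes_mod M y" using subgroup_pow_closed[OF commutes_mod_subgroup[OF M y]] by blast
  hence "y \<in> commutes_mod M (n [^] q)" using commutes_mod_sym[OF M y] by blast
  then obtain k where k: "k \<in> M" "n [^] q \<otimes> y = k \<otimes> (y \<otimes> n [^] q)"
    using commutes_modD[OF M _ , of "n [^] q" y] n by auto
  define m' where "m' = y [^] q \<otimes> k \<otimes> inv (y [^] q)"
  have m': "m' \<in> M" unfolding m'_def using M.inv_op_closed2[of "y [^] q" k] y k by simp
  have yk: "y [^] q \<otimes> k = m' \<otimes> y [^] q" unfolding m'_def using y k(1) by (simp add: m_assoc)
  have "(y \<otimes> n) [^] Suc q = m \<otimes> (y [^] q \<otimes> (n [^] q \<otimes> y) \<otimes> n)"
    using m y n by (simp add: m_assoc)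
  also have "\<dots> = m \<otimes> ((y [^] q \<otimes> k) \<otimes> (y \<otimes> n [^] q \<otimes> n))"
    unfolding k(2) using k(1) y n by (simp add: m_assoc)
  also have "\<dots> = (m \<otimes> m') \<otimes> (y [^] Suc q \<otimes> n [^] Suc q)"
    unfolding yk using m(1) m' y n by (simp add: m_assoc)
  finally show ?case using m(1) m' by blast
qed

text \<open>The product of \<langle>x\<rangle> and \<open>M\<close>, a subgroup for normal
  \<open>M\<close>; in a finite group natural exponents reach all of \<langle>x\<rangle>.\<close>

definition cyclic_ext :: "'a \<Rightarrow> 'a set \<Rightarrow> 'a set" where
  "cyclic_ext x M = {x [^] (i::nat) \<otimes> m | i m. m \<in> M}"

lemma cyclic_ext_subgroup:
  assumes M: "M \<lhd> G" and x: "x \<in> carrier G"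
  shows "subgroup (cyclic_ext x M) G"
proof (rule finite_subgroupI)
  interpret M: normal M G by (rule M)
  show "cyclic_ext x M \<subseteq> carrier G" using x by (auto simp: cyclic_ext_def)
  show "\<one> \<in> cyclic_ext x M" unfolding cyclic_ext_def using x by (auto intro!: exI[of _ "0::nat"] exI[of _ \<one>])
  fix a b assume "a \<in> cyclic_ext x M" "b \<in> cyclic_ext x M"
  then obtain i j :: nat and m n where ab: "a = x [^] i \<otimes> m" "m \<in> M" "b = x [^] j \<otimes> n" "n \<in> M"
    by (auto simp: cyclic_ext_def)
  have "inv (x [^] j) \<otimes> m \<otimes> x [^] j \<in> M" using M.inv_op_closed1[of "x [^] j" m] x ab by simp
  moreover have "a \<otimes> b = x [^] (i + j) \<otimes> ((inv (x [^] j) \<otimes> m \<otimes> x [^] j) \<otimes> n)"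
    using x ab by (simp add: nat_pow_mult[symmetric] m_assoc)
  ultimately show "a \<otimes> b \<in> cyclic_ext x M" using ab(4) unfolding cyclic_ext_def by blast
qed

lemma cyclic_ext_incl:
  assumes "M \<lhd> G" "x \<in> carrier G"
  shows "M \<subseteq> cyclic_ext x M" "x \<in> cyclic_ext x M"
proof -
  interpret M: normal M G by (rule assms(1))
  show "M \<subseteq> cyclic_ext x M"
  proof
    fix m assume m: "m \<in> M"
    hence "m = x [^] (0::nat) \<otimes> m" by simp
    thus "m \<in> cyclic_ext x M" using m unfolding cyclic_ext_def by blast
  qed
  show "x \<in> cyclic_ext x M" unfolding cyclic_ext_def using assms(2)
    by (auto intro!: exI[of _ "1::nat"] exI[of _ \<one>])
qed

lemma cyclic_ext_normal:
  assumes M: "M \<lhd> G" and x: "x \<in> carrier G"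
    and c: "\<And>g. g \<in> carrier G \<Longrightarrow> g \<otimes> x \<otimes> inv g \<in> cyclic_ext x M"
  shows "cyclic_ext x M \<lhd> G"
  unfolding normal_inv_iff
proof (intro conjI ballI)
  interpret M: normal M G by (rule M)
  show S: "subgroup (cyclic_ext x M) G" by (rule cyclic_ext_subgroup[OF M x])
  fix g h assume g: "g \<in> carrier G" and "h \<in> cyclic_ext x M"
  then obtain i :: nat and m where h: "h = x [^] i \<otimes> m" "m \<in> M" by (auto simp: cyclic_ext_def)
  have "g \<otimes> h \<otimes> inv g = (g \<otimes> x \<otimes> inv g) [^] i \<otimes> (g \<otimes> m \<otimes> inv g)"
    unfolding conj_pow[OF g x] h(1) using g x h(2) by (simp add: m_assoc)
  moreover have "(g \<otimes> x \<otimes> inv g) [^] i \<in> cyclic_ext x M"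
    using subgroup_pow_closed[OF S c[OF g]] .
  moreover have "g \<otimes> m \<otimes> inv g \<in> cyclic_ext x M"
    using M.inv_op_closed2[OF g h(2)] cyclic_ext_incl(1)[OF M x] by auto
  ultimately show "g \<otimes> h \<otimes> inv g \<in> cyclic_ext x M" using subgroup.m_closed[OF S] by simp
qed

lemma normal_if_commutators:
  assumes S: "subgroup S G" and c: "\<And>g s. g \<in> carrier G \<Longrightarrow> s \<in> S \<Longrightarrow> g \<otimes> s \<otimes> inv g \<otimes> inv s \<in> S"
  shows "S \<lhd> G"
  unfolding normal_inv_iff
proof (intro conjI ballI S)
  fix g s assume g: "g \<in> carrier G" and s: "s \<in> S"
  interpret S: subgroup S G by (rule S)
  have "g \<otimes> s \<otimes> inv g = (g \<otimes> s \<otimes> inv g \<otimes> inv s) \<otimes> s" using g s by (simp add: m_assoc)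
  thus "g \<otimes> s \<otimes> inv g \<in> S" using c[OF g s] s by (metis S.m_closed)
qed

end

text \<open>An orbit that is not a fixed point has size a positive power of \<open>p\<close>. The
  count is restricted to an invariant subset \<open>S\<close> because the action used later is
  conjugation on all subsets of the group, with a set of cosets as \<open>S\<close>.\<close>

lemma (in group_action) p_group_fixed_points:
  assumes p: "Factorial_Ring.prime p" and o: "Coset.order G = p ^ k"
    and S: "finite S" "S \<subseteq> E" and inv: "\<And>g x. g \<in> carrier G \<Longrightarrow> x \<in> S \<Longrightarrow> \<phi> g x \<in> S"
    and d: "p dvd card S"
  shows "p dvd card {x \<in> S. \<forall>g\<in>carrier G. \<phi> g x = x}"
proof -
  interpret group G using group_hom group_hom.axioms(1) by blast
  define Orb where "Orb = orbit G \<phi> ` S"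
  have orb: "orbit G \<phi> x \<subseteq> S" "x \<in> orbit G \<phi> x" if "x \<in> S" for x
    using that inv S(2) orbit_refl by (auto simp: orbit_def)
  have disj: "A = B" if AB: "A \<in> Orb" "B \<in> Orb" and z: "z \<in> A" "z \<in> B" for A B z
  proof -
    obtain x y where xy: "x \<in> S" "A = orbit G \<phi> x" "y \<in> S" "B = orbit G \<phi> y" using AB by (auto simp: Orb_def)
    have eq: "orbit G \<phi> u = orbit G \<phi> v" if uv': "u \<in> S" "v \<in> orbit G \<phi> u" for u v
    proof -
      have v: "v \<in> S" using orb uv' by blast
      have uv: "u \<in> orbit G \<phi> v" using orbit_sym[of u v] uv' v S(2) by auto
      show ?thesis
      proof
        show "orbit G \<phi> u \<subseteq> orbit G \<phi> v"
        proof
          fix w assume w: "w \<in> orbit G \<phi> u"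
          hence "w \<in> S" using orb uv' by blast
          thus "w \<in> orbit G \<phi> v" using orbit_trans[of v u w] uv w uv' v S(2) by auto
        qed
        show "orbit G \<phi> v \<subseteq> orbit G \<phi> u"
        proof
          fix w assume w: "w \<in> orbit G \<phi> v"
          hence "w \<in> S" using orb v by blast
          thus "w \<in> orbit G \<phi> u" using orbit_trans[of u v w] w uv' v S(2) by auto
        qed
      qed
    qed
    show ?thesis using eq[OF xy(1)] eq[OF xy(3)] z xy by metis
  qed
  have UO: "\<Union>Orb = S" using orb by (auto simp: Orb_def)
  have finO: "finite Orb" using S by (simp add: Orb_def)
  have finA: "finite A" if "A \<in> Orb" for A using that UO S by (metis Union_upper finite_subset)
  have cardS: "card S = (\<Sum>A\<in>Orb. card A)"
    unfolding UO[symmetric] using finO finA disj by (intro card_Union_disjoint) (auto simp: pairwise_def disjnt_def)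
  define F where "F = {x \<in> S. \<forall>g\<in>carrier G. \<phi> g x = x}"
  define P where "P = (\<lambda>x. {x}) ` F"
  have orbF: "orbit G \<phi> x = {x}" if "x \<in> F" for x
    using that orb(2)[of x] by (auto simp: F_def orbit_def)
  hence PO: "P \<subseteq> Orb" by (auto simp: P_def Orb_def F_def image_iff)
  have pd: "p dvd card A" if A: "A \<in> Orb - P" for A
  proof -
    obtain x where x: "x \<in> S" "A = orbit G \<phi> x" using A by (auto simp: Orb_def)
    have "card A dvd p ^ k"
      using orbit_stabilizer_theorem[of x] x S(2) o by (metis dvd_triv_right mult.commute subsetD)
    then obtain j where j: "card A = p ^ j" using divides_primepow_nat[OF p] by blast
    have "j \<noteq> 0"
    proof
      assume "j = 0"
      hence "card A = 1" using j by simp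
      hence "A = {x}" using orb(2)[OF x(1)] x(2) by (metis card_1_singletonE singletonD)
      hence "\<phi> g x = x" if "g \<in> carrier G" for g using that x(2) by (auto simp: orbit_def)
      hence "x \<in> F" using x(1) by (simp add: F_def)
      thus False using A \<open>A = {x}\<close> by (auto simp: P_def)
    qed
    thus ?thesis using j by simp
  qed
  have "card S = (\<Sum>A\<in>Orb - P. card A) + (\<Sum>A\<in>P. card A)"
    unfolding cardS using sum.subset_diff[OF PO finO] by simp
  moreover have "(\<Sum>A\<in>P. card A) = card F"
    by (simp add: P_def sum.reindex)
  moreover have "p dvd (\<Sum>A\<in>Orb - P. card A)" using pd by (intro dvd_sum) auto
  ultimately show ?thesis using d unfolding F_def[symmetric] by (metis dvd_add_right_iff)
qed

section \<open>Chief factors of finite p-groups\<close>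

locale fin_p_group = fin_group +
  fixes p k :: nat
  assumes prime_p: "Factorial_Ring.prime p" and order_p_group: "Coset.order G = p ^ k"
begin

lemma p_gt_1: "p > 1"
  using prime_p by (rule prime_gt_1_nat)

lemma subgroup_card_p_power:
  assumes "subgroup H G"
  obtains j where "card H = p ^ j"
proof -
  have "card H dvd p ^ k" using subgroup_card_dvd[OF assms subgroup_self] assms subgroup.subset order_p_group
    by (auto simp: Coset.order_def)
  thus ?thesis using that divides_primepow_nat[OF prime_p] by blast
qed

lemma proper_subgroup_card:
  assumes "subgroup H G" "subgroup K G" "H \<subset> K"
  shows "p * card H dvd card K" "card H < card K"
proof -
  obtain i j where ij: "card H = p ^ i" "card K = p ^ j" using subgroup_card_p_power assms(1,2) by metis
  show lt: "card H < card K" using psubset_card_mono[OF finite_subset_carrier[OF assms(2)] assms(3)] .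
  hence "Suc i \<le> j" using ij p_gt_1 by (simp add: power_strict_increasing_iff Suc_le_eq)
  thus "p * card H dvd card K" unfolding ij by (metis le_imp_power_dvd power_Suc)
qed

text \<open>\<open>u\<close> is invertible modulo \<open>p ^ (k - a)\<close>, so a suitable power of
  \<open>x [^] i\<close> equals \<open>x [^] (p ^ a)\<close>, all exponents being read modulo the
  group order \<open>p ^ k\<close>.\<close>

lemma pow_mem_dvd:
  assumes H: "subgroup H G" and x: "x \<in> carrier G" and i: "x [^] (i::nat) \<in> H" "i = p ^ a * u" "\<not> p dvd u"
  shows "x [^] (p ^ a) \<in> H"
proof (cases "a \<ge> k")
  case True
  then obtain b where "p ^ a = p ^ k * b" by (metis le_imp_power_dvd dvdE)
  hence "x [^] (p ^ a) = (x [^] (p ^ k)) [^] b" using x by (simp add: nat_pow_pow)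
  also have "\<dots> = \<one>" using pow_order_eq_1[OF x] order_p_group by simp
  finally show ?thesis using subgroup.one_closed[OF H] by simp
next
  case False
  have "coprime u (p ^ (k - a))" using i(3) prime_p by (metis coprime_commute coprime_power_right_iff prime_imp_coprime)
  then obtain s where s: "[u * s = 1] (mod p ^ (k - a))" using cong_solve_coprime_nat[of u "p ^ (k - a)"] by auto
  have "[p ^ a * (u * s) = p ^ a * 1] (mod p ^ a * p ^ (k - a))"
    using s by (simp add: cong_def mult_mod_right[symmetric])
  hence "[i * s = p ^ a] (mod p ^ k)" using False i(2) by (simp add: mult.assoc power_add[symmetric])
  moreover have "x [^] j = x [^] (j mod p ^ k)" for j :: nat
    using pow_mod[OF x, of "p ^ k" j] pow_order_eq_1[OF x] order_p_group by simp
  ultimately have "x [^] (i * s) = x [^] (p ^ a)" by (metis cong_def)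
  moreover have "x [^] (i * s) = (x [^] i) [^] s" using x by (simp add: nat_pow_pow)
  ultimately show ?thesis using subgroup_pow_closed[OF H i(1)] by metis
qed

text \<open>Let \<open>M\<close> be maximal among the normal subgroups from \<open>N1\<close> up to
  but excluding \<open>N2\<close>. A fixed point count for conjugation on the cosets of
  \<open>M\<close> in \<open>N2\<close> shows that N2/M meets the center of G/M nontrivially, so by
  maximality N2/M is central. An element of order \<open>p\<close> modulo \<open>M\<close> then
  generates \<open>N2\<close> over \<open>M\<close>.\<close>

lemma chief_step:
  assumes N1: "N1 \<lhd> G" and N2: "N2 \<lhd> G" and lt: "N1 \<subset> N2"
  obtains M where "M \<lhd> G" "N1 \<subseteq> M" "M \<subset> N2" "card N2 = p * card M"
    "\<And>g. g \<in> carrier G \<Longrightarrow> N2 \<subseteq> commutes_mod M g" "\<And>n. n \<in> N2 \<Longrightarrow> n [^] p \<in> M"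
proof -
  define Q where "Q = {M. M \<lhd> G \<and> N1 \<subseteq> M \<and> M \<subset> N2}"
  have finQ: "finite Q"
    by (rule finite_subset[of _ "Pow (carrier G)"]) (use finite_carrier normal_imp_subgroup[THEN subgroup.subset] in \<open>auto simp: Q_def\<close>)
  have "N1 \<in> Q" using N1 lt by (simp add: Q_def)
  then obtain M where MQ: "M \<in> Q" and max: "\<And>M'. M' \<in> Q \<Longrightarrow> M \<subseteq> M' \<Longrightarrow> M' = M"
    using finite_has_maximal2[OF finQ] by metis
  hence M: "M \<lhd> G" "N1 \<subseteq> M" "M \<subset> N2" by (auto simp: Q_def)
  interpret M: normal M G by (rule M(1))
  interpret N2: normal N2 G by (rule N2)
  have up: "M' = N2" if "M' \<lhd> G" "M \<subset> M'" "M' \<subseteq> N2" for M'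
    using max[of M'] that M by (auto simp: Q_def)
  have cM: "M \<subseteq> commutes_mod M g" if g: "g \<in> carrier G" for g
  proof
    fix m assume m: "m \<in> M"
    have "g \<otimes> m \<otimes> inv g \<in> M" by (rule M.inv_op_closed2[OF g m])
    thus "m \<in> commutes_mod M g" using m by (auto simp: commutes_mod_def)
  qed
  \<comment> \<open>Z/M is the intersection of N2/M with the center of G/M.\<close>
  define Z where "Z = {z \<in> N2. \<forall>g\<in>carrier G. z \<in> commutes_mod M g}"
  have Zsub: "subgroup Z G"
    using N2.one_closed N2.subset commutes_mod_subgroup[OF M(1)]
    by (intro finite_subgroupI) (auto simp: Z_def intro: subgroup.one_closed subgroup.m_closed)
  have MZ: "M \<subseteq> Z" using cM M(3) by (auto simp: Z_def)
  have "Z \<lhd> G"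
  proof (rule normal_if_commutators[OF Zsub])
    fix g s assume "g \<in> carrier G" "s \<in> Z"
    hence "g \<otimes> s \<otimes> inv g \<otimes> inv s \<in> M" by (auto simp: Z_def commutes_mod_def)
    thus "g \<otimes> s \<otimes> inv g \<otimes> inv s \<in> Z" using MZ by auto
  qed
  moreover have "M \<noteq> Z"
  proof
    assume MZeq: "M = Z"
    interpret A: group_action G "{H. H \<subseteq> carrier G}" "\<lambda>g. \<lambda>H\<in>{H. H \<subseteq> carrier G}. g <# H #> inv g"
      by (rule action_by_conjugation_on_power_set)
    define S where "S = (\<lambda>n. M #> n) ` N2"
    have conj: "g <# (M #> n) #> inv g = M #> (g \<otimes> n \<otimes> inv g)" if g: "g \<in> carrier G" and n: "n \<in> carrier G" for g n
    proof -
      have "g <# (M #> n) = g <# (n <# M)" using M.coset_eq n by simp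
      also have "\<dots> = M #> (g \<otimes> n)" using M.coset_eq g n lcos_m_assoc[OF M.subset g n] by simp
      also have "\<dots> #> inv g = M #> (g \<otimes> n \<otimes> inv g)" using g n M.subset by (simp add: coset_mult_assoc)
      finally show ?thesis .
    qed
    have SE: "S \<subseteq> {H. H \<subseteq> carrier G}" unfolding S_def using r_coset_subset_G[OF M.subset] N2.subset by blast
    have inv: "(\<lambda>H\<in>{H. H \<subseteq> carrier G}. g <# H #> inv g) C \<in> S" if g: "g \<in> carrier G" and C: "C \<in> S" for g C
    proof -
      obtain n where n: "n \<in> N2" "C = M #> n" using C by (auto simp: S_def)
      show ?thesis using conj[OF g, of n] n SE C N2.inv_op_closed2[OF g n(1)] by (auto simp: S_def)
    qed
    have cardS: "card S * card M = card N2"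
    proof -
      have "S = rcosets\<^bsub>G\<lparr>carrier := N2\<rparr>\<^esub> M" by (auto simp: S_def RCOSETS_def r_coset_def)
      moreover have "subgroup M (G\<lparr>carrier := N2\<rparr>)"
        using subgroup_incl[OF M.subgroup_axioms N2.subgroup_axioms] M(3) by blast
      ultimately show ?thesis
        using group.lagrange[OF subgroup_imp_group[OF N2.subgroup_axioms], of M] by (simp add: Coset.order_def)
    qed
    have M0: "card M > 0" by (rule subgroup_card_pos[OF M.subgroup_axioms])
    have "p dvd card S"
      using proper_subgroup_card(1)[OF M.subgroup_axioms N2.subgroup_axioms M(3)] M0 by (simp flip: cardS)
    moreover have "finite S" using finite_subset_carrier[OF N2.subgroup_axioms] by (simp add: S_def)
    ultimately have "p dvd card {C \<in> S. \<forall>g\<in>carrier G. (\<lambda>H\<in>{H. H \<subseteq> carrier G}. g <# H #> inv g) C = C}"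
      using A.p_group_fixed_points[OF prime_p order_p_group _ SE inv] by simp
    \<comment> \<open>A fixed coset consists of elements of \<open>Z\<close>. If \<open>Z\<close>
      were \<open>M\<close>, only the coset \<open>M\<close> itself would be fixed, and 1 is not
      divisible by \<open>p\<close>.\<close>
    moreover have "{C \<in> S. \<forall>g\<in>carrier G. (\<lambda>H\<in>{H. H \<subseteq> carrier G}. g <# H #> inv g) C = C} = {M}"
    proof
      show "{M} \<subseteq> {C \<in> S. \<forall>g\<in>carrier G. (\<lambda>H\<in>{H. H \<subseteq> carrier G}. g <# H #> inv g) C = C}"
      proof -
        have "M = M #> \<one>" using M.subset by simp
        hence "M \<in> S" using N2.one_closed by (auto simp: S_def)
        moreover have "g <# M #> inv g = M" if "g \<in> carrier G" for g
          using conj[OF that one_closed] that M.subset by simp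
        ultimately show ?thesis using M.subset by auto
      qed
      show "{C \<in> S. \<forall>g\<in>carrier G. (\<lambda>H\<in>{H. H \<subseteq> carrier G}. g <# H #> inv g) C = C} \<subseteq> {M}"
      proof
        fix C assume C: "C \<in> {C \<in> S. \<forall>g\<in>carrier G. (\<lambda>H\<in>{H. H \<subseteq> carrier G}. g <# H #> inv g) C = C}"
        then obtain n where n: "n \<in> N2" "C = M #> n" by (auto simp: S_def)
        have nG: "n \<in> carrier G" using n N2.subset by auto
        have "n \<in> Z" unfolding Z_def
        proof (intro CollectI conjI ballI n(1))
          fix g assume g: "g \<in> carrier G"
          have "M #> (g \<otimes> n \<otimes> inv g) = M #> n" using C n conj[OF g nG] g SE by auto
          moreover have "g \<otimes> n \<otimes> inv g \<in> M #> (g \<otimes> n \<otimes> inv g)"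
            using rcos_self[OF _ M.subgroup_axioms] g nG by simp
          ultimately have "(g \<otimes> n \<otimes> inv g) \<otimes> inv n \<in> M"
            using M.rcos_module_imp[OF is_group nG] by simp
          thus "n \<in> commutes_mod M g" using nG by (simp add: commutes_mod_def)
        qed
        thus "C \<in> {M}" using MZeq n coset_join2[OF nG M.subgroup_axioms] by simp
      qed
    qed
    ultimately show False using p_gt_1 by simp
  qed
  ultimately have "Z = N2" using up MZ by (auto simp: Z_def)
  hence comm: "N2 \<subseteq> commutes_mod M g" if "g \<in> carrier G" for g using that by (auto simp: Z_def)
  obtain z where z: "z \<in> N2" "z \<notin> M" using M(3) by auto
  have zG: "z \<in> carrier G" using z N2.subset by auto
  \<comment> \<open>The last of the iterated \<open>p\<close>-th powers of \<open>z\<close> outside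
    \<open>M\<close> has order \<open>p\<close> modulo \<open>M\<close>.\<close>
  define j where "j = (LEAST j. z [^] (p ^ j) \<in> M)"
  have "z [^] (p ^ k) \<in> M" using pow_order_eq_1[OF zG] order_p_group by simp
  hence jM: "z [^] (p ^ j) \<in> M" unfolding j_def by (rule LeastI)
  have j0: "j > 0" using jM z zG by (metis gr0I nat_pow_eone power_0)
  define n where "n = z [^] (p ^ (j - 1))"
  have n: "n \<in> N2" unfolding n_def using subgroup_pow_closed[OF N2.subgroup_axioms z(1)] .
  have nG: "n \<in> carrier G" using n N2.subset by auto
  have nM: "n \<notin> M" using not_less_Least[of "j - 1" "\<lambda>j. z [^] (p ^ j) \<in> M"] j0 by (simp add: n_def j_def)
  have npM: "n [^] p \<in> M"
  proof -
    have "n [^] p = z [^] (p ^ (j - 1) * p)" using zG by (simp add: n_def nat_pow_pow)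
    also have "p ^ (j - 1) * p = p ^ j" using j0 by (metis Suc_diff_1 power_Suc2)
    finally show ?thesis using jM by simp
  qed
  have extN: "cyclic_ext n M = N2"
  proof (rule up)
    show "M \<subset> cyclic_ext n M" using cyclic_ext_incl[OF M(1) nG] nM by auto
    show "cyclic_ext n M \<subseteq> N2"
      using subgroup_pow_closed[OF N2.subgroup_axioms n] M(3) N2.m_closed by (auto simp: cyclic_ext_def)
    show "cyclic_ext n M \<lhd> G"
    proof (rule normal_if_commutators[OF cyclic_ext_subgroup[OF M(1) nG]])
      fix g s assume g: "g \<in> carrier G" and "s \<in> cyclic_ext n M"
      hence "s \<in> commutes_mod M g" using \<open>cyclic_ext n M \<subseteq> N2\<close> comm by blast
      thus "g \<otimes> s \<otimes> inv g \<otimes> inv s \<in> cyclic_ext n M"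
        using cyclic_ext_incl(1)[OF M(1) nG] by (auto simp: commutes_mod_def)
    qed
  qed
  have red: "n [^] i \<in> M" if "p dvd i" for i :: nat
  proof -
    have "n [^] i = (n [^] p) [^] (i div p)" using that nG by (simp add: nat_pow_pow)
    thus ?thesis using subgroup_pow_closed[OF M.subgroup_axioms npM] by simp
  qed
  have "N2 \<subseteq> (\<lambda>(i,m). n [^] (i::nat) \<otimes> m) ` ({0..<p} \<times> M)"
  proof
    fix y assume "y \<in> N2"
    then obtain i :: nat and m where y: "y = n [^] i \<otimes> m" "m \<in> M" using extN by (auto simp: cyclic_ext_def)
    have "n [^] i = n [^] (i mod p) \<otimes> n [^] (i div p * p)"
      using nG nat_pow_mult[of n "i mod p" "i div p * p"] by simp
    hence "y = n [^] (i mod p) \<otimes> (n [^] (i div p * p) \<otimes> m)" using y nG by (simp add: m_assoc)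
    moreover have "n [^] (i div p * p) \<otimes> m \<in> M" using red[of "i div p * p"] y(2) by simp
    ultimately show "y \<in> (\<lambda>(i,m). n [^] (i::nat) \<otimes> m) ` ({0..<p} \<times> M)"
      using p_gt_1 by (intro image_eqI[of _ _ "(i mod p, n [^] (i div p * p) \<otimes> m)"]) auto
  qed
  hence "card N2 \<le> card ({0..<p} \<times> M)"
    using finite_subset_carrier[OF M.subgroup_axioms] by (intro surj_card_le) auto
  hence "card N2 \<le> p * card M" by (simp add: card_cartesian_product)
  moreover have "p * card M \<le> card N2"
    using proper_subgroup_card[OF M.subgroup_axioms N2.subgroup_axioms M(3)] by (intro dvd_imp_le) auto
  ultimately have card: "card N2 = p * card M" by simp
  have "y [^] p \<in> M" if yN: "y \<in> N2" for y
  proof -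
    obtain i :: nat and m where y: "y = n [^] i \<otimes> m" "m \<in> M" using yN unfolding extN[symmetric] cyclic_ext_def by blast
    have "n [^] i \<in> commutes_mod M m"
      using comm[of m] subgroup_pow_closed[OF N2.subgroup_axioms n] y(2) by auto
    then obtain m' where "m' \<in> M" "y [^] p = m' \<otimes> ((n [^] i) [^] p \<otimes> m [^] p)"
      using mult_pow_mod[OF M(1), of "n [^] i" m p] nG y by auto
    moreover have "(n [^] i) [^] p \<in> M" using red[of "i * p"] nG by (simp add: nat_pow_pow)
    ultimately show ?thesis using subgroup_pow_closed[OF M.subgroup_axioms y(2)] by simp
  qed
  thus ?thesis using that M card comm by blast
qed

end

section \<open>Groups generated by two elements modulo the derived subgroup\<close>

context fin_group
begin

lemma mult_normal:
  assumes N: "N \<lhd> G" and M: "M \<lhd> G"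
  shows "N <#> M \<lhd> G" "N \<subseteq> N <#> M" "M \<subseteq> N <#> M"
proof -
  interpret N: normal N G by (rule N)
  interpret M: normal M G by (rule M)
  show "N <#> M \<lhd> G" by (rule normal_subgroup_set_mult_closed[OF N M])
  show "N \<subseteq> N <#> M"
  proof
    fix x assume x: "x \<in> N"
    hence "x = x \<otimes> \<one>" by simp
    thus "x \<in> N <#> M" using x M.one_closed unfolding set_mult_def by blast
  qed
  show "M \<subseteq> N <#> M"
  proof
    fix x assume x: "x \<in> M"
    hence "x = \<one> \<otimes> x" by simp
    thus "x \<in> N <#> M" using x N.one_closed unfolding set_mult_def by blast
  qed
qed

text \<open>\<open>G\<close> is generated by \<open>x\<close>, \<open>y\<close> and
  \<open>D\<close>, and \<open>D\<close> is central modulo \<open>K\<close>. So once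
  \<open>x\<close> and \<open>y\<close> commute modulo \<open>K\<close>, the quotient G/K is
  abelian.\<close>

lemma commutator_generated_le:
  assumes K: "K \<lhd> G" and D: "D \<lhd> G" and KD: "\<And>g. g \<in> carrier G \<Longrightarrow> D \<subseteq> commutes_mod K g"
    and xy: "x \<in> carrier G" "y \<in> commutes_mod K x"
    and gen: "\<And>g. g \<in> carrier G \<Longrightarrow> \<exists>(j::nat) (i::nat). \<exists>c\<in>D. g = y [^] j \<otimes> (x [^] i \<otimes> c)"
  shows "derived G (carrier G) \<subseteq> K"
proof -
  interpret K: normal K G by (rule K)
  have yG: "y \<in> carrier G" using xy(2) by (simp add: commutes_mod_def)
  have all: "carrier G \<subseteq> commutes_mod K g"
    if g: "g \<in> carrier G" and gx: "x \<in> commutes_mod K g" and gy: "y \<in> commutes_mod K g" for g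
  proof
    fix h assume "h \<in> carrier G"
    then obtain j i :: nat and c where h: "h = y [^] j \<otimes> (x [^] i \<otimes> c)" "c \<in> D" using gen by blast
    note S = commutes_mod_subgroup[OF K g]
    show "h \<in> commutes_mod K g" unfolding h(1)
      using subgroup_pow_closed[OF S gx] subgroup_pow_closed[OF S gy] KD[OF g] h(2)
      by (intro subgroup.m_closed[OF S]) auto
  qed
  have self: "g \<in> commutes_mod K g" if "g \<in> carrier G" for g
    using that by (intro commutes_modI[OF K _ _ K.one_closed]) auto
  have "carrier G \<subseteq> commutes_mod K x" by (rule all[OF xy(1) self[OF xy(1)] xy(2)])
  moreover have "carrier G \<subseteq> commutes_mod K y"
    by (rule all[OF yG commutes_mod_sym[OF K xy(1,2)] self[OF yG]])
  ultimately have "carrier G \<subseteq> commutes_mod K g" if g: "g \<in> carrier G" for g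
    using g commutes_mod_sym[OF K xy(1), of g] commutes_mod_sym[OF K yG, of g] by (intro all[OF g]) auto
  thus ?thesis unfolding derived_le_iff[OF K.subgroup_axioms] by (auto simp: commutes_mod_def)
qed

end

context fin_p_group
begin

lemma index_p_power:
  assumes "subgroup H G"
  obtains j where "group_index G H = p ^ j"
proof -
  have "group_index G H dvd p ^ k" using group_index_mult_card[OF assms] order_p_group by (metis dvd_triv_left)
  thus ?thesis using that divides_primepow_nat[OF prime_p] by blast
qed

text \<open>\<open>G\<close> is generated by \<open>x\<close>, \<open>y\<close> and \<open>D\<close>, so \<open>D / (K1 \<inter> K2)\<close> is generated by the commutator \<open>c\<close> of \<open>x\<close> and
  \<open>y\<close> and cannot have two subgroups of index \<open>p\<close>.\<close>

lemma central_index_p_unique: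
  assumes D: "D = derived G (carrier G)" and xy: "x \<in> carrier G" "y \<in> carrier G"
    and gen: "\<And>g. g \<in> carrier G \<Longrightarrow> \<exists>(j::nat) (i::nat). \<exists>c\<in>D. g = y [^] j \<otimes> (x [^] i \<otimes> c)"
    and K1: "K1 \<lhd> G" "K1 \<subseteq> D" "card D = p * card K1" "\<And>g. g \<in> carrier G \<Longrightarrow> D \<subseteq> commutes_mod K1 g"
      "\<And>d. d \<in> D \<Longrightarrow> d [^] p \<in> K1"
    and K2: "K2 \<lhd> G" "K2 \<subseteq> D" "card D = p * card K2" "\<And>g. g \<in> carrier G \<Longrightarrow> D \<subseteq> commutes_mod K2 g"
      "\<And>d. d \<in> D \<Longrightarrow> d [^] p \<in> K2"
  shows "K1 = K2"
proof (rule ccontr)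
  assume neq: "K1 \<noteq> K2"
  have DN: "D \<lhd> G" unfolding D by (rule derived_self_is_normal)
  interpret D: normal D G by (rule DN)
  interpret K1: normal K1 G by (rule K1(1))
  interpret K2: normal K2 G by (rule K2(1))
  have pos: "card D > 0" by (rule subgroup_card_pos[OF D.subgroup_axioms])
  have c12: "card K1 = card K2" using K1(3) K2(3) p_gt_1 by simp
  have "\<not> K1 \<subseteq> K2"
    using neq c12 card_subset_eq[OF finite_subset_carrier[OF K2.subgroup_axioms]] by auto
  then obtain d where d: "d \<in> K1" "d \<notin> K2" by auto
  define K where "K = K1 \<inter> K2"
  have K: "K \<lhd> G" unfolding K_def by (rule normal_subgroup_intersect[OF K1(1) K2(1)])
  have KD: "D \<subseteq> commutes_mod K g" if "g \<in> carrier G" for g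
    using K1(4)[OF that] K2(4)[OF that] by (auto simp: commutes_mod_def K_def)
  define c where "c = x \<otimes> y \<otimes> inv x \<otimes> inv y"
  have cD: "c \<in> D" unfolding c_def D using derived_le_iff[OF D.subgroup_axioms[unfolded D]] xy by blast
  have cG: "c \<in> carrier G" using cD D.subset by auto
  have "cyclic_ext c K \<lhd> G"
  proof (rule normal_if_commutators[OF cyclic_ext_subgroup[OF K cG]])
    fix g s assume g: "g \<in> carrier G" and s: "s \<in> cyclic_ext c K"
    have "cyclic_ext c K \<subseteq> D"
      using subgroup_pow_closed[OF D.subgroup_axioms cD] K1(2) D.m_closed by (auto simp: cyclic_ext_def K_def)
    hence "s \<in> commutes_mod K g" using s KD[OF g] by auto
    thus "g \<otimes> s \<otimes> inv g \<otimes> inv s \<in> cyclic_ext c K"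
      using cyclic_ext_incl(1)[OF K cG] by (auto simp: commutes_mod_def)
  qed
  moreover have "D \<subseteq> commutes_mod (cyclic_ext c K) g" if "g \<in> carrier G" for g
    using KD[OF that] cyclic_ext_incl(1)[OF K cG] by (auto simp: commutes_mod_def)
  moreover have "y \<in> commutes_mod (cyclic_ext c K) x"
    using cyclic_ext_incl(2)[OF K cG] xy by (auto simp: commutes_mod_def c_def)
  ultimately have "D \<subseteq> cyclic_ext c K" unfolding D
    using commutator_generated_le[OF _ DN _ xy(1) _ gen] D by simp
  hence "d \<in> cyclic_ext c K" using d(1) K1(2) by auto
  then obtain i :: nat and z where iz: "d = c [^] i \<otimes> z" "z \<in> K" unfolding cyclic_ext_def by blast
  have z: "z \<in> K1" "z \<in> K2" "z \<in> carrier G" using iz(2) K1.subset by (auto simp: K_def)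
  have ci: "c [^] i = d \<otimes> inv z" using iz(1) z cG by (simp add: m_assoc)
  have "c [^] i \<in> K1" unfolding ci using d(1) z(1) by simp
  moreover have "c [^] i \<notin> K2" using iz(1) d(2) z(2) by auto
  moreover have "c [^] i \<in> K2" if "p dvd i"
  proof -
    have "c [^] i = (c [^] p) [^] (i div p)" using that cG by (simp add: nat_pow_pow)
    thus ?thesis using subgroup_pow_closed[OF K2.subgroup_axioms K2(5)[OF cD]] by simp
  qed
  \<comment> \<open>\<open>p\<close> does not divide \<open>i\<close>, so \<open>c\<close> itself is
    in \<open>K1\<close>. Then \<open>x\<close> and \<open>y\<close> commute modulo
    \<open>K1\<close>, which would put all of \<open>D\<close> into \<open>K1\<close>.\<close>
  ultimately have "c [^] (p ^ 0) \<in> K1"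
    using pow_mem_dvd[OF K1.subgroup_axioms cG, of i 0 i] by auto
  hence "y \<in> commutes_mod K1 x" using cG xy by (auto simp: commutes_mod_def c_def)
  hence "D \<subseteq> K1" using commutator_generated_le[OF K1(1) DN K1(4) xy(1) _ gen] D by simp
  hence "D = K1" using K1(2) by auto
  thus False using K1(3) pos p_gt_1 by simp
qed

text \<open>\<open>x\<close> has order at least \<open>p ^ (a + 1)\<close> modulo \<open>D\<close>,
  so \<langle>x\<rangle>D contains that many cosets of \<open>D\<close> out of
  \<open>p ^ (a + 2)\<close>.\<close>

lemma cyclic_ext_index_le:
  assumes D: "D \<lhd> G" and x: "x \<in> carrier G" "x [^] (p ^ a) \<notin> D" and idx: "group_index G D = p ^ (a + 2)"
  shows "group_index G (cyclic_ext x D) \<le> p"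
proof -
  interpret D: normal D G by (rule D)
  have D0: "card D > 0" by (rule subgroup_card_pos[OF D.subgroup_axioms])
  \<comment> \<open>The \<open>p\<close>-part of such an exponent is \<open>p ^ b\<close> with
    \<open>b \<le> a\<close>. So \<open>x [^] (p ^ b)\<close> would lie in \<open>D\<close>, and
    \<open>x [^] (p ^ a)\<close> with it.\<close>
  have nD: "x [^] i \<notin> D" if i: "0 < i" "i < p ^ (a + 1)" for i :: nat
  proof
    assume iD: "x [^] i \<in> D"
    obtain b u where bu: "i = p ^ b * u" "\<not> p dvd u"
      using multiplicity_decompose'[of i p] i prime_p by (metis not_prime_unit gr0_conv_Suc nat.discI mult.commute)
    have "p ^ b \<le> i" using bu i by (metis dvd_imp_le dvd_triv_left)
    hence "p ^ b < p ^ (a + 1)" using i by simp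
    hence ba: "b \<le> a" using power_less_imp_less_exp[of p b "a + 1"] p_gt_1 by simp
    have "x [^] (p ^ b) \<in> D" by (rule pow_mem_dvd[OF D.subgroup_axioms x(1) iD bu])
    hence "(x [^] (p ^ b)) [^] (p ^ (a - b)) \<in> D" by (rule subgroup_pow_closed[OF D.subgroup_axioms])
    thus False using x ba by (simp add: nat_pow_pow power_add[symmetric])
  qed
  have inj: "inj_on (\<lambda>(i,d). x [^] (i::nat) \<otimes> d) ({0..<p ^ (a + 1)} \<times> D)"
  proof (rule inj_onI, clarify)
    fix i d j e assume i: "i \<in> {0..<p ^ (a + 1)}" "d \<in> D" and j: "j \<in> {0..<p ^ (a + 1)}" "e \<in> D"
      and eq: "x [^] i \<otimes> d = x [^] j \<otimes> e"
    have aux: "i = j" if "i \<le> j" "j < p ^ (a + 1)" "d \<in> D" "e \<in> D" "x [^] i \<otimes> d = x [^] j \<otimes> e" for i j :: nat and d e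
    proof (rule ccontr)
      assume "i \<noteq> j"
      hence ij: "0 < j - i" "j - i < p ^ (a + 1)" using that by auto
      have "x [^] j = x [^] i \<otimes> x [^] (j - i)" using x that(1) by (simp add: nat_pow_mult)
      hence "x [^] i \<otimes> d = x [^] i \<otimes> (x [^] (j - i) \<otimes> e)" using that x by (simp add: m_assoc)
      hence "d = x [^] (j - i) \<otimes> e" using that x by simp
      hence "x [^] (j - i) = d \<otimes> inv e" using that x by (simp add: m_assoc)
      hence "x [^] (j - i) \<in> D" using that by simp
      thus False using nD[OF ij] by simp
    qed
    have ij: "i = j"
    proof (cases "i \<le> j")
      case True thus ?thesis using aux[OF _ _ i(2) j(2) eq] j by auto
    next
      case False thus ?thesis using aux[OF _ _ j(2) i(2) eq[symmetric]] i by auto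
    qed
    moreover have "d = e" using eq x i j unfolding ij by simp
    ultimately show "i = j \<and> d = e" by simp
  qed
  have "card ({0..<p ^ (a + 1)} \<times> D) \<le> card (cyclic_ext x D)"
    using finite_subset_carrier[OF cyclic_ext_subgroup[OF D x(1)]]
    by (intro card_inj_on_le[OF inj]) (auto simp: cyclic_ext_def)
  hence le: "p ^ (a + 1) * card D \<le> card (cyclic_ext x D)" by (simp add: card_cartesian_product)
  have "group_index G (cyclic_ext x D) * (p ^ (a + 1) * card D) \<le> group_index G (cyclic_ext x D) * card (cyclic_ext x D)"
    using le by simp
  also have "\<dots> = p ^ (a + 2) * card D"
    using group_index_mult_card[OF cyclic_ext_subgroup[OF D x(1)]] group_index_mult_card[OF D.subgroup_axioms] idx by simp
  also have "\<dots> = p * (p ^ (a + 1) * card D)" by simp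
  finally show ?thesis using D0 p_gt_1 by simp
qed

text \<open>\<langle>x\<rangle>D is normal because it contains the derived subgroup, and its index
  is 1 or \<open>p\<close>. Any \<open>y\<close> outside it completes a generating set; if nothing
  is outside, \<open>y = \<one>\<close> works.\<close>

lemma two_generated_mod:
  assumes D: "D = derived G (carrier G)" and x: "x \<in> carrier G"
    and idx: "group_index G (cyclic_ext x D) \<le> p"
  obtains y where "y \<in> carrier G" "\<And>g. g \<in> carrier G \<Longrightarrow> \<exists>(j::nat) (i::nat). \<exists>c\<in>D. g = y [^] j \<otimes> (x [^] i \<otimes> c)"
proof -
  have DN: "D \<lhd> G" unfolding D by (rule derived_self_is_normal)
  interpret D: normal D G by (rule DN)
  define E where "E = cyclic_ext x D"
  have Esub: "subgroup E G" unfolding E_def by (rule cyclic_ext_subgroup[OF DN x])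
  have EN: "E \<lhd> G"
  proof (rule normal_if_commutators[OF Esub])
    fix g s assume gs: "g \<in> carrier G" "s \<in> E"
    hence "g \<otimes> s \<otimes> inv g \<otimes> inv s \<in> D"
      using derived_le_iff[OF D.subgroup_axioms] D subgroup.mem_carrier[OF Esub] by auto
    thus "g \<otimes> s \<otimes> inv g \<otimes> inv s \<in> E" using cyclic_ext_incl(1)[OF DN x] by (auto simp: E_def)
  qed
  have "\<exists>y\<in>carrier G. carrier G \<subseteq> cyclic_ext y E"
  proof (cases "E = carrier G")
    case True
    thus ?thesis using cyclic_ext_incl(1)[OF EN one_closed] by auto
  next
    case False
    then obtain y where y: "y \<in> carrier G" "y \<notin> E" using subgroup.subset[OF Esub] by auto
    define F where "F = cyclic_ext y E"
    have F: "subgroup F G" unfolding F_def by (rule cyclic_ext_subgroup[OF EN y(1)])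
    have "E \<subset> F" using cyclic_ext_incl[OF EN y(1)] y(2) by (auto simp: F_def)
    hence "p * card E dvd card F" by (rule proper_subgroup_card(1)[OF Esub F])
    moreover have F0: "card F > 0" by (rule subgroup_card_pos[OF F])
    ultimately have "p * card E \<le> card F" by (rule dvd_imp_le)
    moreover have "card (carrier G) \<le> p * card E"
      using group_index_mult_card[OF Esub] idx[folded E_def] by (metis Coset.order_def mult_le_mono1)
    ultimately have "card (carrier G) \<le> card F" by simp
    hence "F = carrier G" using subgroup.subset[OF F] finite_carrier by (metis card_seteq)
    thus ?thesis using y(1) by (auto simp: F_def)
  qed
  then obtain y where y: "y \<in> carrier G" "carrier G \<subseteq> cyclic_ext y E" by blast
  have "\<exists>(j::nat) (i::nat). \<exists>c\<in>D. g = y [^] j \<otimes> (x [^] i \<otimes> c)" if g: "g \<in> carrier G" for g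
  proof -
    have "g \<in> cyclic_ext y E" using g y(2) by blast
    then obtain j :: nat and e where je: "g = y [^] j \<otimes> e" "e \<in> E" unfolding cyclic_ext_def by blast
    obtain i :: nat and c where "e = x [^] i \<otimes> c" "c \<in> D" using je(2) unfolding E_def cyclic_ext_def by blast
    thus ?thesis using je(1) by blast
  qed
  thus ?thesis using that y(1) by blast
qed

text \<open>Descend along a chief series \<open>N > M\<close> inside \<open>D\<close>, keeping \<open>D \<subseteq> \<langle>x\<rangle>N\<close>. Then \<open>\<langle>x\<rangle>N\<close> is normal, and since \<open>N/M\<close> is
  central of exponent \<open>p\<close>, so is \<open>\<langle>x\<^sup>p\<rangle>M\<close>; it is not contained in \<open>D\<close>, hence it contains \<open>D\<close>.\<close>

lemma derived_cyclic:
  assumes D: "D = derived G (carrier G)" and x: "x \<in> carrier G" "x [^] p \<notin> D"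
    and comparable: "\<And>N. N \<lhd> G \<Longrightarrow> D \<subseteq> N \<or> N \<subseteq> D"
    and c: "c \<in> D"
  shows "\<exists>i::nat. c = x [^] i"
proof -
  have DN: "D \<lhd> G" unfolding D by (rule derived_self_is_normal)
  interpret D: normal D G by (rule DN)
  define Q where "Q N \<longleftrightarrow> N \<lhd> G \<and> N \<subseteq> D \<and> D \<subseteq> cyclic_ext x N" for N
  have "Q D" using DN cyclic_ext_incl(1)[OF DN x(1)] by (simp add: Q_def)
  then obtain N where N: "Q N" and min: "\<And>M. Q M \<Longrightarrow> card N \<le> card M"
    using ex_has_least_nat[of Q D card] by blast
  hence NN: "N \<lhd> G" "N \<subseteq> D" "D \<subseteq> cyclic_ext x N" by (auto simp: Q_def)
  interpret N: normal N G by (rule NN(1))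
  have "N = {\<one>}"
  proof (rule ccontr)
    assume "N \<noteq> {\<one>}"
    hence "{\<one>} \<subset> N" using N.one_closed by auto
    from chief_step[OF one_is_normal NN(1) this] obtain M where
      M: "M \<lhd> G" "M \<subset> N" and MN: "\<And>g. g \<in> carrier G \<Longrightarrow> N \<subseteq> commutes_mod M g" and Np: "\<And>n. n \<in> N \<Longrightarrow> n [^] p \<in> M"
      by metis
    interpret M: normal M G by (rule M(1))
    define z where "z = x [^] p"
    have zG: "z \<in> carrier G" using x by (simp add: z_def)
    have "cyclic_ext z M \<lhd> G"
    proof (rule cyclic_ext_normal[OF M(1) zG])
      fix g assume g: "g \<in> carrier G"
      define y where "y = g \<otimes> x \<otimes> inv g"
      have zy: "g \<otimes> z \<otimes> inv g = y [^] p" unfolding y_def z_def conj_pow[OF g x(1)] ..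
      have "g \<otimes> x \<otimes> inv g \<otimes> inv x \<in> D"
        using derived_le_iff[OF D.subgroup_axioms] D g x by auto
      hence "g \<otimes> x \<otimes> inv g \<otimes> inv x \<in> cyclic_ext x N" using NN(3) by auto
      hence "(g \<otimes> x \<otimes> inv g \<otimes> inv x) \<otimes> x \<in> cyclic_ext x N"
        using subgroup.m_closed[OF cyclic_ext_subgroup[OF NN(1) x(1)]] cyclic_ext_incl(2)[OF NN(1) x(1)] by blast
      hence "y \<in> cyclic_ext x N" using g x by (simp add: y_def m_assoc)
      then obtain i :: nat and n where yn: "y = x [^] i \<otimes> n" "n \<in> N" unfolding cyclic_ext_def by blast
      have nG: "n \<in> carrier G" using yn(2) by simp
      have "x [^] i \<in> commutes_mod M n"
        using MN[of "x [^] i"] yn(2) x commutes_mod_sym[OF M(1), of "x [^] i" n] by auto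
      then obtain m where m: "m \<in> M" "y [^] p = m \<otimes> ((x [^] i) [^] p \<otimes> n [^] p)"
        using mult_pow_mod[OF M(1) _ nG, of "x [^] i" p] x yn(1) by auto
      \<comment> \<open>Modulo \<open>M\<close> the conjugate of \<open>z\<close> is a power of
        \<open>z\<close>: the factor \<open>n\<close> commutes with \<open>x [^] i\<close> and its
        \<open>p\<close>-th power is in \<open>M\<close>.\<close>
      have "(x [^] i) [^] p = z [^] i" using x by (simp add: z_def nat_pow_pow mult.commute)
      hence "(x [^] i) [^] p \<in> cyclic_ext z M"
        using subgroup_pow_closed[OF cyclic_ext_subgroup[OF M(1) zG] cyclic_ext_incl(2)[OF M(1) zG]] by simp
      thus "g \<otimes> z \<otimes> inv g \<in> cyclic_ext z M" unfolding zy m(2)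
        using m(1) Np[OF yn(2)] cyclic_ext_incl(1)[OF M(1) zG]
        by (intro subgroup.m_closed[OF cyclic_ext_subgroup[OF M(1) zG]]) auto
    qed
    from comparable[OF this] have "D \<subseteq> cyclic_ext z M"
      using cyclic_ext_incl(2)[OF M(1) zG] x(2) by (auto simp: z_def)
    also have "cyclic_ext z M \<subseteq> cyclic_ext x M"
    proof
      fix u assume "u \<in> cyclic_ext z M"
      then obtain i :: nat and m where "u = z [^] i \<otimes> m" "m \<in> M" unfolding cyclic_ext_def by blast
      hence "u = x [^] (p * i) \<otimes> m" "m \<in> M" using x by (auto simp: z_def nat_pow_pow)
      thus "u \<in> cyclic_ext x M" unfolding cyclic_ext_def by blast
    qed
    finally have "Q M" using M NN by (auto simp: Q_def)
    hence "card N \<le> card M" by (rule min)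
    thus False using psubset_card_mono[OF finite_subset_carrier[OF N.subgroup_axioms] M(2)] by simp
  qed
  hence "c \<in> cyclic_ext x {\<one>}" using c NN(3) by auto
  thus ?thesis using x by (auto simp: cyclic_ext_def)
qed

end

context fin_group
begin

text \<open>Let \<open>M\<close> be the intersection of the kernels containing \<open>N\<close>. The
  same characters have \<open>M\<close> and \<open>N\<close> in their kernels, so the sums of
  squares agree, and with them the indices.\<close>

lemma normal_eq_Inter_ker:
  assumes N: "N \<lhd> G" and g: "g \<in> carrier G"
    and ker: "\<And>\<chi>. \<chi> \<in> Irr G \<Longrightarrow> N \<subseteq> char_ker G \<chi> \<Longrightarrow> g \<in> char_ker G \<chi>"
  shows "g \<in> N"
proof -
  interpret N: normal N G by (rule N)
  define M where "M = {g \<in> carrier G. \<forall>\<chi>\<in>Irr G. N \<subseteq> char_ker G \<chi> \<longrightarrow> g \<in> char_ker G \<chi>}"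
  note kn = char_ker_normal[THEN normal_imp_subgroup]
  have Msub: "subgroup M G"
    by (rule finite_subgroupI) (auto simp: M_def intro: subgroup.one_closed[OF kn] subgroup.m_closed[OF kn])
  have "M \<lhd> G" unfolding normal_inv_iff
    using Msub by (auto simp: M_def intro: normal.inv_op_closed2[OF char_ker_normal])
  moreover have "{\<chi>. \<chi> \<in> Irr G \<and> M \<subseteq> char_ker G \<chi>} = {\<chi>. \<chi> \<in> Irr G \<and> N \<subseteq> char_ker G \<chi>}"
    using N.subset by (auto simp: M_def)
  ultimately have "group_index G M = group_index G N"
    using sum_degree_squares[OF N] sum_degree_squares[of M] by simp
  hence "card M = card N"
    using group_index_mult_card[OF Msub] group_index_mult_card[OF N.subgroup_axioms] group_index_pos[OF Msub]
    by (metis mult_cancel1 less_numeral_extra(3))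
  moreover have "N \<subseteq> M" using N.subset by (auto simp: M_def)
  ultimately have "M = N" using card_subset_eq[OF finite_subset_carrier[OF Msub]] by metis
  thus ?thesis using g ker by (auto simp: M_def)
qed

end

section \<open>Codegree counts\<close>

text \<open>The counts are cumulative: \<open>p ^ (i + 1)\<close> is the number of elements of order dividing \<open>p ^ i\<close> in
  the dual group of \<open>integer_mod_group (p ^ n) \<times>\<times> integer_mod_group p\<close>.\<close>

locale cod_counts = fin_p_group +
  fixes n :: nat
  assumes n_pos: "n \<ge> 1"
    and cods: "\<And>\<chi>. \<chi> \<in> Irr G \<Longrightarrow> \<exists>j\<le>n. cod G \<chi> = of_nat (p ^ j)"
    and counts: "\<And>i. 1 \<le> i \<Longrightarrow> i \<le> n \<Longrightarrow> card {\<chi> \<in> Irr G. \<exists>j\<le>i. cod G \<chi> = of_nat (p ^ j)} = p ^ (i + 1)"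
begin

definition cod_le :: "nat \<Rightarrow> ('a \<Rightarrow> complex) set" where
  "cod_le i = {\<chi> \<in> Irr G. \<exists>j\<le>i. cod G \<chi> = of_nat (p ^ j)}"

definition lin_le :: "nat \<Rightarrow> ('a \<Rightarrow> complex) set" where
  "lin_le i = {\<chi> \<in> cod_le i. char_degree \<chi> = 1}"

lemma finite_cod_le: "finite (cod_le i)"
  using finite_Irr by (simp add: cod_le_def)

lemma codE:
  assumes "\<chi> \<in> Irr G"
  obtains j where "j \<le> n" "cod G \<chi> = of_nat (p ^ j)" "group_index G (char_ker G \<chi>) = p ^ j * char_degree \<chi>"
  using cods[OF assms] cod_eq_iff[OF assms] by blast

lemma cod_le_iff:
  assumes "\<chi> \<in> Irr G" "cod G \<chi> = of_nat (p ^ j)"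
  shows "\<chi> \<in> cod_le i \<longleftrightarrow> j \<le> i"
proof -
  have "(of_nat (p ^ j) :: complex) = of_nat (p ^ j') \<longleftrightarrow> j = j'" for j'
    using p_gt_1 by (metis of_nat_eq_iff power_inject_exp)
  thus ?thesis using assms by (auto simp: cod_le_def)
qed

lemma char_degree_p_power:
  assumes "\<chi> \<in> Irr G"
  obtains e where "char_degree \<chi> = p ^ e"
proof -
  obtain j where j: "group_index G (char_ker G \<chi>) = p ^ j * char_degree \<chi>" using codE[OF assms] by metis
  obtain i where "group_index G (char_ker G \<chi>) = p ^ i"
    using index_p_power[OF normal_imp_subgroup[OF char_ker_normal[OF assms]]] .
  hence "char_degree \<chi> dvd p ^ i" using j by (metis dvd_triv_right)
  thus ?thesis using that divides_primepow_nat[OF prime_p] by blast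
qed

lemma nonlinear_degree_ge: "\<chi> \<in> Irr G \<Longrightarrow> char_degree \<chi> \<noteq> 1 \<Longrightarrow> p \<le> char_degree \<chi>"
  using p_gt_1 by (elim char_degree_p_power) (metis power_0 self_le_power gr0I less_imp_le_nat)

lemma nonlinear_degree_less:
  assumes "\<chi> \<in> Irr G" "char_degree \<chi> \<noteq> 1" "group_index G (char_ker G \<chi>) = c * char_degree \<chi>"
  shows "char_degree \<chi> < c"
  using char_degree_square_less[OF assms(1,2)] assms(3) by (simp add: power2_eq_square)

lemma cod_le_1_linear: "cod_le 1 = lin_le 1"
proof -
  have "char_degree \<chi> = 1" if \<chi>: "\<chi> \<in> cod_le 1" for \<chi>
  proof (rule ccontr)
    assume nl: "char_degree \<chi> \<noteq> 1"
    have I: "\<chi> \<in> Irr G" using \<chi> by (simp add: cod_le_def)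
    obtain j where j: "cod G \<chi> = of_nat (p ^ j)" "group_index G (char_ker G \<chi>) = p ^ j * char_degree \<chi>"
      using codE[OF I] by metis
    have "j \<le> 1" using cod_le_iff[OF I j(1)] \<chi> by simp
    hence "p ^ j \<le> p ^ 1" using p_gt_1 by (intro power_increasing) auto
    thus False using nonlinear_degree_less[OF I nl j(2)] nonlinear_degree_ge[OF I nl] by simp
  qed
  thus ?thesis by (auto simp: lin_le_def)
qed

lemma lin_le_iff:
  assumes \<chi>: "\<chi> \<in> Irr G" "char_degree \<chi> = 1"
  shows "\<chi> \<in> lin_le i \<longleftrightarrow> (\<forall>g\<in>carrier G. \<chi> g ^ (p ^ i) = 1)"
proof -
  obtain j where j: "cod G \<chi> = of_nat (p ^ j)" "group_index G (char_ker G \<chi>) = p ^ j"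
    using codE[OF \<chi>(1)] \<chi>(2) by (metis mult.right_neutral)
  have "\<chi> \<in> lin_le i \<longleftrightarrow> j \<le> i" using cod_le_iff[OF \<chi>(1) j(1)] \<chi>(2) by (simp add: lin_le_def)
  also have "\<dots> \<longleftrightarrow> (\<forall>g\<in>carrier G. \<chi> g ^ (p ^ i) = 1)"
    by (rule linear_char_p_power_iff[OF \<chi> p_gt_1 j(2)])
  finally show ?thesis .
qed

lemma exists_linear_char:
  assumes "card (lin_le i) < card (lin_le j)"
  obtains \<chi> x where "\<chi> \<in> Irr G" "char_degree \<chi> = 1" "x \<in> carrier G" "x [^] (p ^ i) \<notin> char_ker G \<chi>"
proof -
  have "\<not> lin_le j \<subseteq> lin_le i"
    using card_mono[of "lin_le i" "lin_le j"] finite_cod_le assms by (auto simp: lin_le_def)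
  then obtain \<chi> where \<chi>j: "\<chi> \<in> lin_le j" "\<chi> \<notin> lin_le i" by auto
  hence \<chi>: "\<chi> \<in> Irr G" "char_degree \<chi> = 1" by (auto simp: lin_le_def cod_le_def)
  obtain x where x: "x \<in> carrier G" "\<chi> x ^ (p ^ i) \<noteq> 1" using \<chi>j(2) lin_le_iff[OF \<chi>] by auto
  have "x [^] (p ^ i) \<notin> char_ker G \<chi>"
    using x linear_char_pow[OF \<chi> x(1)] linear_char_in_ker[OF \<chi>] by simp
  thus ?thesis using that \<chi> x(1) by blast
qed

text \<open>Let \<open>P\<close> be the common kernel of these characters. All
  \<open>p ^ i\<close>-th powers of group elements lie in \<open>P\<close>, so every character with
  \<open>P\<close> in its kernel satisfies the equation defining \<open>lin_le i\<close>. The count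
  is therefore |G:P|.\<close>

lemma card_lin_le_p_power:
  obtains j where "card (lin_le i) = p ^ j"
proof -
  define P where "P = {g \<in> carrier G. \<forall>\<chi>\<in>lin_le i. \<chi> g = 1}"
  have lin: "\<chi> \<in> Irr G" "char_degree \<chi> = 1" if "\<chi> \<in> lin_le i" for \<chi>
    using that by (auto simp: lin_le_def cod_le_def)
  have Psub: "subgroup P G"
  proof (rule finite_subgroupI)
    show "\<one> \<in> P" using lin(2) char_one[OF lin(1)] by (simp add: P_def)
    fix x y assume xy: "x \<in> P" "y \<in> P"
    have "\<chi> (x \<otimes> y) = 1" if \<chi>: "\<chi> \<in> lin_le i" for \<chi>
    proof -
      have "\<chi> x = 1" "\<chi> y = 1" using xy \<chi> by (auto simp: P_def)
      thus ?thesis using linear_char_mult[OF lin(1)[OF \<chi>] lin(2)[OF \<chi>], of x y] xy by (simp add: P_def)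
    qed
    thus "x \<otimes> y \<in> P" using xy by (simp add: P_def)
  qed (auto simp: P_def)
  have ker: "P \<subseteq> char_ker G \<chi>" if "\<chi> \<in> lin_le i" for \<chi>
    using that linear_char_in_ker[OF lin] by (auto simp: P_def)
  have DP: "derived G (carrier G) \<subseteq> P"
  proof
    fix g assume g: "g \<in> derived G (carrier G)"
    hence "g \<in> carrier G" using derived_in_carrier[of "carrier G"] by auto
    moreover have "g \<in> char_ker G \<chi>" if "\<chi> \<in> lin_le i" for \<chi>
      using linear_iff_derived_le_ker[OF lin(1)[OF that]] lin(2)[OF that] g by auto
    ultimately show "g \<in> P" using linear_char_in_ker[OF lin] by (auto simp: P_def)
  qed
  have PN: "P \<lhd> G"
  proof (rule normal_if_commutators[OF Psub])
    fix g s assume "g \<in> carrier G" "s \<in> P"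
    thus "g \<otimes> s \<otimes> inv g \<otimes> inv s \<in> P"
      using DP derived_le_iff[OF Psub] by (auto simp: P_def)
  qed
  have "{\<chi> \<in> Irr G. P \<subseteq> char_ker G \<chi>} = lin_le i"
  proof
    show "{\<chi> \<in> Irr G. P \<subseteq> char_ker G \<chi>} \<subseteq> lin_le i"
    proof
      fix \<chi> assume "\<chi> \<in> {\<chi> \<in> Irr G. P \<subseteq> char_ker G \<chi>}"
      hence \<chi>: "\<chi> \<in> Irr G" "P \<subseteq> char_ker G \<chi>" by auto
      have d: "char_degree \<chi> = 1" using linear_iff_derived_le_ker[OF \<chi>(1)] DP \<chi>(2) by auto
      have "\<chi> g ^ (p ^ i) = 1" if g: "g \<in> carrier G" for g
      proof -
        have "\<psi> (g [^] (p ^ i)) = 1" if "\<psi> \<in> lin_le i" for \<psi>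
          using that lin_le_iff[OF lin[OF that]] linear_char_pow[OF lin[OF that] g] g by simp
        hence "g [^] (p ^ i) \<in> P" using g by (simp add: P_def)
        hence "\<chi> (g [^] (p ^ i)) = 1" using \<chi>(2) linear_char_in_ker[OF \<chi>(1) d] by auto
        thus ?thesis using linear_char_pow[OF \<chi>(1) d g] by simp
      qed
      thus "\<chi> \<in> lin_le i" using lin_le_iff[OF \<chi>(1) d] by simp
    qed
  qed (use ker lin in auto)
  hence "card (lin_le i) = group_index G P" using card_Irr_ker_ge_derived[OF PN DP] by simp
  thus ?thesis using that index_p_power[OF Psub] by metis
qed

end

text \<open>The linear characters run out at codegree \<open>p\<^sup>a\<close>; this turns out to be contradictory.\<close>

locale cod_counts_exhausted = cod_counts +
  fixes a :: nat
  assumes a: "1 \<le> a" "a < n"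
    and linear_upto: "\<And>i. 1 \<le> i \<Longrightarrow> i \<le> a \<Longrightarrow> cod_le i = lin_le i"
    and exhausted: "lin_le (a + 1) = lin_le a"
begin

abbreviation D where "D \<equiv> derived G (carrier G)"

lemma D_normal: "D \<lhd> G"
  by (rule derived_self_is_normal)

text \<open>A linear character of codegree \<open>p ^ j\<close> with \<open>j > a\<close> has a
  power of order exactly \<open>p ^ (a + 1)\<close>, which would belong to
  \<open>lin_le (a + 1)\<close> but not to \<open>lin_le a\<close>.\<close>

lemma all_linear:
  assumes \<chi>: "\<chi> \<in> Irr G" "char_degree \<chi> = 1"
  shows "\<chi> \<in> lin_le a"
proof (rule ccontr)
  assume na: "\<chi> \<notin> lin_le a"
  obtain j where j: "cod G \<chi> = of_nat (p ^ j)" using codE[OF \<chi>(1)] by metis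
  have iff: "\<chi> \<in> lin_le i \<longleftrightarrow> j \<le> i" for i using cod_le_iff[OF \<chi>(1) j] \<chi>(2) by (simp add: lin_le_def)
  have ja: "j > a" using na iff by simp
  \<comment> \<open>Raising to the power \<open>q\<close> divides the order \<open>p ^ j\<close>
    down to \<open>p ^ (a + 1)\<close>.\<close>
  define q where "q = p ^ (j - (a + 1))"
  define \<psi> where "\<psi> = restrict (\<lambda>g. \<chi> g ^ q) (carrier G)"
  have \<psi>: "\<psi> \<in> Irr G" "char_degree \<psi> = 1" unfolding \<psi>_def
    by (rule linear_charI; simp add: linear_char_mult[OF \<chi>] power_mult_distrib char_one[OF \<chi>(1)] \<chi>(2))+
  have q1: "q * p ^ (a + 1) = p ^ j" "q * p ^ a = p ^ (j - 1)"
  proof -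
    have "q * p ^ (a + 1) = p ^ (j - (a + 1) + (a + 1))" by (simp only: q_def power_add)
    thus "q * p ^ (a + 1) = p ^ j" using ja by simp
    have "q * p ^ a = p ^ (j - (a + 1) + a)" by (simp only: q_def power_add)
    also have "j - (a + 1) + a = j - 1" using ja by simp
    finally show "q * p ^ a = p ^ (j - 1)" .
  qed
  have "\<chi> g ^ (p ^ j) = 1" if "g \<in> carrier G" for g using that iff[of j] lin_le_iff[OF \<chi>] by auto
  hence "\<psi> g ^ (p ^ (a + 1)) = 1" if "g \<in> carrier G" for g
    using that unfolding q1(1)[symmetric] by (simp add: \<psi>_def power_mult)
  hence "\<psi> \<in> lin_le (a + 1)" unfolding lin_le_iff[OF \<psi>] by blast
  hence "\<psi> \<in> lin_le a" using exhausted by simp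
  hence "\<psi> g ^ (p ^ a) = 1" if "g \<in> carrier G" for g using that unfolding lin_le_iff[OF \<psi>] by blast
  hence "\<forall>g\<in>carrier G. \<chi> g ^ (p ^ (j - 1)) = 1"
    unfolding \<psi>_def q1(2)[symmetric] by (simp add: power_mult)
  hence "\<chi> \<in> lin_le (j - 1)" by (simp add: lin_le_iff[OF \<chi>])
  thus False using iff[of "j - 1"] ja by simp
qed

lemma card_lin_le_a: "1 \<le> i \<Longrightarrow> i \<le> a \<Longrightarrow> card (lin_le i) = p ^ (i + 1)"
  using counts[of i] linear_upto[of i] a by (simp add: cod_le_def)

lemma index_D: "group_index G D = p ^ (a + 1)"
proof -
  have "{\<chi> \<in> Irr G. D \<subseteq> char_ker G \<chi>} = lin_le a"
    using all_linear linear_iff_derived_le_ker by (auto simp: lin_le_def cod_le_def)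
  thus ?thesis using card_Irr_ker_ge_derived[OF D_normal] card_lin_le_a[of a] a by simp
qed

lemma nonlinear_cod:
  assumes \<chi>: "\<chi> \<in> Irr G" "char_degree \<chi> \<noteq> 1"
  obtains j where "a + 1 \<le> j" "cod G \<chi> = of_nat (p ^ j)" "group_index G (char_ker G \<chi>) = p ^ j * char_degree \<chi>"
proof -
  obtain j where j: "cod G \<chi> = of_nat (p ^ j)" "group_index G (char_ker G \<chi>) = p ^ j * char_degree \<chi>"
    using codE[OF \<chi>(1)] by metis
  have "\<chi> \<notin> cod_le a" using linear_upto[of a] a \<chi>(2) by (auto simp: lin_le_def)
  hence "a + 1 \<le> j" using cod_le_iff[OF \<chi>(1) j(1)] by simp
  thus ?thesis using that j by blast
qed

text \<open>\<open>N\<close> is an intersection of kernels, so some character with \<open>N\<close>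
  in its kernel is nonlinear. The index of its kernel is the product of a codegree of at least
  \<open>p ^ (a + 1)\<close> and a degree of at least \<open>p\<close>.\<close>

lemma index_ge:
  assumes N: "N \<lhd> G" and nD: "\<not> D \<subseteq> N"
  shows "p ^ (a + 2) \<le> group_index G N"
proof -
  interpret N: normal N G by (rule N)
  have "\<exists>\<chi>\<in>Irr G. N \<subseteq> char_ker G \<chi> \<and> char_degree \<chi> \<noteq> 1"
  proof (rule ccontr)
    assume "\<not> ?thesis"
    hence "D \<subseteq> char_ker G \<chi>" if "\<chi> \<in> Irr G" "N \<subseteq> char_ker G \<chi>" for \<chi>
      using that linear_iff_derived_le_ker by blast
    hence "D \<subseteq> N" using normal_eq_Inter_ker[OF N] derived_in_carrier[of "carrier G"] by blast
    thus False using nD by simp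
  qed
  then obtain \<chi> where \<chi>: "\<chi> \<in> Irr G" "N \<subseteq> char_ker G \<chi>" "char_degree \<chi> \<noteq> 1" by blast
  obtain j where j: "a + 1 \<le> j" "group_index G (char_ker G \<chi>) = p ^ j * char_degree \<chi>"
    using nonlinear_cod[OF \<chi>(1,3)] by metis
  have "p ^ (a + 1) * p \<le> p ^ j * char_degree \<chi>"
    using j(1) p_gt_1 nonlinear_degree_ge[OF \<chi>(1,3)] by (intro mult_le_mono power_increasing) auto
  also have "\<dots> = group_index G (char_ker G \<chi>)" using j(2) by simp
  also have "\<dots> \<le> group_index G N"
  proof -
    note Ks = normal_imp_subgroup[OF char_ker_normal[OF \<chi>(1)]]
    have c: "card N \<le> card (char_ker G \<chi>)" using card_mono[OF finite_subset_carrier[OF Ks] \<chi>(2)] .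
    have "group_index G (char_ker G \<chi>) * card N \<le> group_index G N * card N"
      using group_index_mult_card[OF Ks] group_index_mult_card[OF N.subgroup_axioms] c
      by (metis mult_le_mono2)
    moreover have "card N > 0" by (rule subgroup_card_pos[OF N.subgroup_axioms])
    ultimately show ?thesis by simp
  qed
  finally show ?thesis by (simp add: mult.commute)
qed

text \<open>Suppose neither inclusion holds. Choose \<open>M\<close> of index \<open>p\<close> in
  \<open>D\<close> above \<open>N \<inter> D\<close>. Then NM still does not contain
  \<open>D\<close>, so its index is at least \<open>p ^ (a + 2)\<close>, which is |G:M|. Hence NM =
  M and \<open>N\<close> lies in \<open>D\<close> after all.\<close>

lemma normal_comparable:
  assumes N: "N \<lhd> G"
  shows "D \<subseteq> N \<or> N \<subseteq> D"
proof (rule disjCI)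
  interpret N: normal N G by (rule N)
  interpret D: normal D G by (rule D_normal)
  assume "\<not> N \<subseteq> D"
  show "D \<subseteq> N"
  proof (rule ccontr)
    assume nD: "\<not> D \<subseteq> N"
    have "N \<inter> D \<lhd> G" by (rule normal_subgroup_intersect[OF N D_normal])
    moreover have "N \<inter> D \<subset> D" using nD by auto
    ultimately obtain M where M: "M \<lhd> G" "N \<inter> D \<subseteq> M" "M \<subset> D" "card D = p * card M"
      using chief_step[OF _ D_normal] by metis
    interpret M: normal M G by (rule M(1))
    note NM = mult_normal[OF N M(1)]
    interpret NM: normal "N <#> M" G by (rule NM(1))
    have "\<not> D \<subseteq> N <#> M"
    proof
      assume le: "D \<subseteq> N <#> M"
      have "D \<subseteq> M"
      proof
        fix d assume d: "d \<in> D"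
        then obtain x m where xm: "x \<in> N" "m \<in> M" "d = x \<otimes> m" using le by (auto simp: set_mult_def)
        have "m \<in> D" using xm(2) M(3) by auto
        hence "x = d \<otimes> inv m" using xm by (simp add: m_assoc)
        hence "x \<in> D" using d \<open>m \<in> D\<close> by simp
        hence "x \<in> M" using xm(1) M(2) by auto
        thus "d \<in> M" using xm by simp
      qed
      thus False using M(3) by auto
    qed
    hence ge: "p ^ (a + 2) \<le> group_index G (N <#> M)" by (rule index_ge[OF NM(1)])
    have "p ^ (a + 2) * card (N <#> M) \<le> group_index G (N <#> M) * card (N <#> M)" using ge by simp
    also have "\<dots> = p ^ (a + 1) * card D"
      using group_index_mult_card[OF NM.subgroup_axioms] group_index_mult_card[OF D.subgroup_axioms] index_D by simp
    also have "\<dots> = p ^ (a + 2) * card M" using M(4) by simp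
    finally have "card (N <#> M) \<le> card M" using p_gt_1 by simp
    hence "N <#> M = M" using NM(3) card_seteq[OF finite_subset_carrier[OF NM.subgroup_axioms], of M] by simp
    hence "N \<subseteq> M" using NM(2) by simp
    thus False using M(3) \<open>\<not> N \<subseteq> D\<close> by auto
  qed
qed

text \<open>For \<open>a \<ge> 2\<close> there are more linear characters of codegree at most
  \<open>p ^ a\<close> than at most \<open>p ^ (a - 1)\<close>; this yields an element whose
  \<open>p ^ (a - 1)\<close>-th power is outside some kernel and so outside \<open>D\<close>. For
  \<open>a = 1\<close> any element outside \<open>D\<close> will do.\<close>

lemma cyclic_cofactor:
  obtains x where "x \<in> carrier G" "group_index G (cyclic_ext x D) \<le> p" "a \<ge> 2 \<Longrightarrow> x [^] p \<notin> D"
proof -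
  have "\<exists>x\<in>carrier G. x [^] (p ^ (a - 1)) \<notin> D"
  proof (cases "a = 1")
    case True
    have "D \<noteq> carrier G"
    proof
      assume "D = carrier G"
      hence "group_index G D * card D = card D"
        using group_index_mult_card[OF normal_imp_subgroup[OF D_normal]] by (simp add: Coset.order_def)
      hence "p ^ (a + 1) = 1" using index_D subgroup_card_pos[OF normal_imp_subgroup[OF D_normal]] by simp
      thus False using p_gt_1 by simp
    qed
    thus ?thesis using True derived_in_carrier[of "carrier G"] by auto
  next
    case False
    hence "card (lin_le (a - 1)) < card (lin_le a)"
      using card_lin_le_a[of "a - 1"] card_lin_le_a[of a] a p_gt_1 by (simp add: power_strict_increasing_iff)
    then obtain \<chi> x where \<chi>: "\<chi> \<in> Irr G" "char_degree \<chi> = 1"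
      and x: "x \<in> carrier G" "x [^] (p ^ (a - 1)) \<notin> char_ker G \<chi>" by (rule exists_linear_char)
    have "D \<subseteq> char_ker G \<chi>" using linear_iff_derived_le_ker[OF \<chi>(1)] \<chi>(2) by simp
    thus ?thesis using x by auto
  qed
  then obtain x where x: "x \<in> carrier G" "x [^] (p ^ (a - 1)) \<notin> D" by blast
  \<comment> \<open>The general lemma is applied with \<open>a - 1\<close> in place of
    \<open>a\<close>.\<close>
  have "group_index G (cyclic_ext x D) \<le> p"
    by (rule cyclic_ext_index_le[OF D_normal x]) (use index_D a in simp)
  moreover have "x [^] p \<notin> D" if "a \<ge> 2"
  proof
    assume "x [^] p \<in> D"
    hence "(x [^] p) [^] (p ^ (a - 2)) \<in> D" by (rule subgroup_pow_closed[OF normal_imp_subgroup[OF D_normal]])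
    moreover have "p * p ^ (a - 2) = p ^ (a - 1)" using that by (metis Suc_diff_Suc Suc_1 Suc_le_lessD power_Suc diff_Suc_1 diff_Suc_eq_diff_pred)
    ultimately show False using x by (simp add: nat_pow_pow)
  qed
  ultimately show ?thesis using that x(1) by blast
qed

text \<open>The characters of codegree \<open>p ^ (a + 1)\<close> have degree \<open>p\<close> and all have the same kernel, which has index
  \<open>p ^ (a + 2)\<close>. So there are at most \<open>p ^ a\<close> of them, but \<open>counts\<close> asks for \<open>p ^ (a + 2) - p ^ (a + 1)\<close>.\<close>

lemma contradiction: False
proof -
  obtain x where x: "x \<in> carrier G" "group_index G (cyclic_ext x D) \<le> p" "a \<ge> 2 \<Longrightarrow> x [^] p \<notin> D"
    using cyclic_cofactor by blast
  obtain y where y: "y \<in> carrier G" "\<And>g. g \<in> carrier G \<Longrightarrow> \<exists>(j::nat) (i::nat). \<exists>c\<in>D. g = y [^] j \<otimes> (x [^] i \<otimes> c)"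
    using two_generated_mod[OF refl x(1,2)] by metis
  define S where "S = cod_le (a + 1) - cod_le a"
  have sub: "cod_le a \<subseteq> cod_le (a + 1)" by (auto simp: cod_le_def intro: le_SucI)
  have cS: "card S = p ^ (a + 2) - p ^ (a + 1)"
    unfolding S_def using card_Diff_subset[OF finite_cod_le sub] counts[of a] counts[of "a + 1"] a
    by (simp add: cod_le_def)
  have deg: "char_degree \<chi> = p \<and> group_index G (char_ker G \<chi>) = p ^ (a + 2)" if \<chi>S: "\<chi> \<in> S" for \<chi>
  proof -
    have \<chi>: "\<chi> \<in> Irr G" using \<chi>S by (simp add: S_def cod_le_def)
    have nl: "char_degree \<chi> \<noteq> 1" using all_linear[OF \<chi>] \<chi>S by (auto simp: S_def lin_le_def)
    obtain j where j: "cod G \<chi> = of_nat (p ^ j)" "group_index G (char_ker G \<chi>) = p ^ j * char_degree \<chi>"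
      using codE[OF \<chi>] by metis
    have ja: "j = a + 1" using \<chi>S cod_le_iff[OF \<chi> j(1)] by (auto simp: S_def)
    have "char_degree \<chi> \<le> p"
    proof (cases "a = 1")
      case True
      obtain e where e: "char_degree \<chi> = p ^ e" using char_degree_p_power[OF \<chi>] .
      have "p ^ e < p ^ 2" using nonlinear_degree_less[OF \<chi> nl j(2)] True e ja by (simp add: numeral_2_eq_2)
      hence "e < 2" using p_gt_1 power_less_imp_less_exp by blast
      hence "p ^ e \<le> p ^ 1" using p_gt_1 by (intro power_increasing) auto
      thus ?thesis using e by simp
    next
      case False
      hence cyc: "\<exists>i::nat. c = x [^] i" if "c \<in> D" for c
        using derived_cyclic[OF refl x(1) x(3) normal_comparable that] a by simp
      have "\<exists>i::nat. h = x [^] i" if "h \<in> cyclic_ext x D" for h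
      proof -
        obtain i :: nat and c where ic: "h = x [^] i \<otimes> c" "c \<in> D" using \<open>h \<in> cyclic_ext x D\<close> unfolding cyclic_ext_def by blast
        obtain i' :: nat where "c = x [^] i'" using cyc[OF ic(2)] by blast
        hence "h = x [^] (i + i')" using ic(1) x(1) by (simp add: nat_pow_mult)
        thus ?thesis by blast
      qed
      hence "char_degree \<chi> \<le> group_index G (cyclic_ext x D)"
        by (rule char_degree_le_index_cyclic[OF \<chi> x(1) cyclic_ext_subgroup[OF D_normal x(1)]])
      thus ?thesis using x(2) by simp
    qed
    thus ?thesis using nonlinear_degree_ge[OF \<chi> nl] j(2) ja by simp
  qed
  have ker: "char_ker G \<chi> \<subseteq> D \<and> card D = p * card (char_ker G \<chi>) \<and>
    (\<forall>g\<in>carrier G. D \<subseteq> commutes_mod (char_ker G \<chi>) g) \<and> (\<forall>d\<in>D. d [^] p \<in> char_ker G \<chi>)" if \<chi>S: "\<chi> \<in> S" for \<chi>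
  proof -
    have \<chi>: "\<chi> \<in> Irr G" using \<chi>S by (simp add: S_def cod_le_def)
    define K where "K = char_ker G \<chi>"
    have K: "K \<lhd> G" unfolding K_def by (rule char_ker_normal[OF \<chi>])
    have "\<not> D \<subseteq> K" using linear_iff_derived_le_ker[OF \<chi>] deg[OF \<chi>S] p_gt_1 by (auto simp: K_def)
    hence KD: "K \<subset> D" using normal_comparable[OF K] by auto
    have "p ^ (a + 2) * card K = p ^ (a + 1) * card D"
      using group_index_mult_card[OF normal_imp_subgroup[OF K]] group_index_mult_card[OF normal_imp_subgroup[OF D_normal]]
        deg[OF \<chi>S] index_D by (simp add: K_def)
    hence cK: "card D = p * card K" using p_gt_1 by simp
    \<comment> \<open>\<open>chief_step\<close> gives some \<open>M\<close> of index
      \<open>p\<close> in \<open>D\<close> above \<open>K\<close>. Having the same order,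
      \<open>M\<close> is \<open>K\<close>, which thereby inherits centrality and exponent
      \<open>p\<close> of D/K.\<close>
    obtain M where M: "K \<subseteq> M" "M \<lhd> G" "card D = p * card M" "\<And>g. g \<in> carrier G \<Longrightarrow> D \<subseteq> commutes_mod M g"
      "\<And>d. d \<in> D \<Longrightarrow> d [^] p \<in> M" using chief_step[OF K D_normal KD] by metis
    have "card K = card M" using cK M(3) p_gt_1 by simp
    hence "K = M" using card_subset_eq[OF finite_subset_carrier[OF normal_imp_subgroup[OF M(2)]] M(1)] by simp
    thus ?thesis using KD cK M by (auto simp: K_def)
  qed
  have S0: "card S > 0" unfolding cS using p_gt_1 by (simp add: power_strict_increasing_iff)
  then obtain \<chi>0 where \<chi>0: "\<chi>0 \<in> S" by (metis card_gt_0_iff ex_in_conv)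
  define K where "K = char_ker G \<chi>0"
  have I0: "\<chi>0 \<in> Irr G" using \<chi>0 by (simp add: S_def cod_le_def)
  have uniq: "char_ker G \<chi> = K" if \<chi>S: "\<chi> \<in> S" for \<chi>
  proof -
    have \<chi>: "\<chi> \<in> Irr G" using \<chi>S by (simp add: S_def cod_le_def)
    show ?thesis unfolding K_def
      using ker[OF \<chi>S] ker[OF \<chi>0]
      by (intro central_index_p_unique[OF refl x(1) y(1) y(2) char_ker_normal[OF \<chi>] _ _ _ _ char_ker_normal[OF I0]]) auto
  qed
  have "card S * p\<^sup>2 = (\<Sum>\<chi>\<in>S. (char_degree \<chi>)\<^sup>2)" using deg by simp
  also have "\<dots> \<le> (\<Sum>\<chi> | \<chi> \<in> Irr G \<and> K \<subseteq> char_ker G \<chi>. (char_degree \<chi>)\<^sup>2)"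
    using finite_Irr uniq by (intro sum_mono2) (auto simp: S_def cod_le_def)
  also have "\<dots> = p ^ (a + 2)"
    unfolding K_def sum_degree_squares[OF char_ker_normal[OF I0]] using deg[OF \<chi>0] by simp
  finally have "(p ^ (a + 2) - p ^ (a + 1)) * p\<^sup>2 \<le> p ^ (a + 2)" unfolding cS .
  moreover have "p ^ (a + 2) - p ^ (a + 1) = p ^ (a + 1) * (p - 1)"
    by (simp add: diff_mult_distrib2 mult.commute mult.left_commute)
  ultimately have "p ^ (a + 1) * ((p - 1) * p\<^sup>2) \<le> p ^ (a + 1) * p" by (simp add: mult.assoc mult.commute)
  hence "(p - 1) * p\<^sup>2 \<le> p" using p_gt_1 by simp
  moreover have "p < (p - 1) * p\<^sup>2"
  proof -
    have "p * 1 < p * p" using p_gt_1 by simp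
    also have "\<dots> \<le> (p - 1) * (p * p)" using p_gt_1 by simp
    finally show ?thesis by (simp add: power2_eq_square)
  qed
  ultimately show False by simp
qed

end

section \<open>Linearity of all characters\<close>

context cod_counts
begin

lemma cod_le_linear:
  "1 \<le> i \<Longrightarrow> i \<le> n \<Longrightarrow> cod_le i = lin_le i"
proof (induction i rule: less_induct)
  case (less i)
  show ?case
  proof (cases "i = 1")
    case True
    thus ?thesis using cod_le_1_linear by simp
  next
    case False
    define a where "a = i - 1"
    have a: "1 \<le> a" "a < n" "i = a + 1" using False less.prems by (auto simp: a_def)
    have IH: "cod_le j = lin_le j" if "1 \<le> j" "j \<le> a" for j
      using less.IH[of j] that a by simp
    have ca: "card (lin_le a) = p ^ (a + 1)" using counts[of a] IH[of a] a by (simp add: cod_le_def)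
    have ci: "card (cod_le i) = p ^ (a + 2)" using counts[of i] less.prems a by (simp add: cod_le_def)
    have sub: "lin_le i \<subseteq> cod_le i" "lin_le a \<subseteq> lin_le i" by (auto simp: lin_le_def cod_le_def a(3) intro: le_SucI)
    have fin: "finite (lin_le i)" using finite_subset[OF sub(1) finite_cod_le] .
    obtain j where j: "card (lin_le i) = p ^ j" using card_lin_le_p_power .
    have "p ^ (a + 1) \<le> p ^ j" using card_mono[OF fin sub(2)] ca j by simp
    moreover have "p ^ j \<le> p ^ (a + 2)" using card_mono[OF finite_cod_le sub(1)] ci j by simp
    ultimately have "a + 1 \<le> j" "j \<le> a + 2" using p_gt_1 by (metis power_le_imp_le_exp)+
    then consider "j = a + 1" | "j = a + 2" by linarith
    thus ?thesis
    proof cases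
      case 1
      hence "lin_le i = lin_le a" using card_subset_eq[OF fin sub(2)] ca j by simp
      then interpret cod_counts_exhausted G p k n a
        using IH a by unfold_locales auto
      from contradiction show ?thesis ..
    next
      case 2
      thus ?thesis using card_subset_eq[OF finite_cod_le sub(1)] ci j by simp
    qed
  qed
qed

text \<open>With all degrees equal to 1, every commutator lies in every kernel, and these intersect
  trivially. The order is the number of characters.\<close>

theorem abelian:
  shows "comm_group G" "Coset.order G = p ^ (n + 1)"
proof -
  have all: "Irr G = lin_le n"
    using cods cod_le_linear[of n] n_pos by (auto simp: cod_le_def)
  hence lin: "char_degree \<chi> = 1" if "\<chi> \<in> Irr G" for \<chi> using that by (auto simp: lin_le_def)
  have t: "{\<one>} \<lhd> G" by (rule one_is_normal)
  have one: "\<one> \<in> char_ker G \<chi>" for \<chi> by (simp add: char_ker_def)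
  have "(\<Sum>\<chi> | \<chi> \<in> Irr G \<and> {\<one>} \<subseteq> char_ker G \<chi>. (char_degree \<chi>)\<^sup>2) = card (Irr G)"
    using lin one by simp
  hence "group_index G {\<one>} = card (Irr G)" using sum_degree_squares[OF t] by simp
  moreover have "card (Irr G) = p ^ (n + 1)"
  proof -
    have "{\<chi> \<in> Irr G. \<exists>j\<le>n. cod G \<chi> = of_nat (p ^ j)} = Irr G" using cods by blast
    thus ?thesis using counts[of n] n_pos by simp
  qed
  ultimately show "Coset.order G = p ^ (n + 1)"
    using group_index_mult_card[OF triv_subgroup] by simp
  have "g \<otimes> h = h \<otimes> g" if gh: "g \<in> carrier G" "h \<in> carrier G" for g h
  proof -
    have "g \<otimes> h \<otimes> inv g \<otimes> inv h \<in> {\<one>}"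
    proof (rule normal_eq_Inter_ker[OF t])
      fix \<chi> assume "\<chi> \<in> Irr G"
      thus "g \<otimes> h \<otimes> inv g \<otimes> inv h \<in> char_ker G \<chi>"
        using lin linear_iff_derived_le_ker derived_le_iff[OF normal_imp_subgroup[OF char_ker_normal]] gh by metis
    qed (use gh in auto)
    hence "h \<in> commutes_mod {\<one>} g" using gh by (simp add: commutes_mod_def)
    thus ?thesis using commutes_modD[OF t gh(1)] gh by (metis l_one m_closed singletonD)
  qed
  thus "comm_group G" by (intro group_comm_groupI) auto
qed

end

section \<open>Groups all of whose codegrees are powers of p\<close>

context fin_group
begin

lemma card_mult_Int:
  assumes N: "N \<lhd> G" and M: "subgroup M G"
  shows "card N * card M = card (N <#> M) * card (N \<inter> M)"
proof -
  interpret second_isomorphism_grp N G M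
    using N M by (simp add: second_isomorphism_grp_def second_isomorphism_grp_axioms_def)
  have NM: "subgroup (N <#> M) G" by (rule normal_set_mult_subgroup)
  have sub: "N \<subseteq> N <#> M" using subgroup.one_closed[OF M] subset by (force simp: set_mult_def)
  define c where "c = card (rcosets\<^bsub>G\<lparr>carrier := M\<rparr>\<^esub> (N \<inter> M))"
  have "c = card (rcosets\<^bsub>G\<lparr>carrier := N <#> M\<rparr>\<^esub> N)"
    using iso_same_card[OF is_isoI[OF normal_intersection_quotient_isom]] by (simp add: c_def FactGroup_def)
  hence "c * card N = card (N <#> M)"
    using group.lagrange[OF subgroup_imp_group[OF NM] subgroup_incl[OF subgroup_axioms NM sub]]
    by (simp add: Coset.order_def)
  moreover have "c * card (N \<inter> M) = card M"
    using group.lagrange[OF subgroup_imp_group[OF M] subgroup_incl[OF subgroups_Inter_pair[OF subgroup_axioms M] M]]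
    by (simp add: Coset.order_def c_def)
  ultimately show ?thesis by (metis mult.assoc mult.commute)
qed

lemma index_Int:
  assumes N: "N \<lhd> G" and M: "M \<lhd> G"
  shows "group_index G (N \<inter> M) * group_index G (N <#> M) = group_index G N * group_index G M"
proof -
  note s = normal_imp_subgroup[OF N] normal_imp_subgroup[OF M]
    normal_imp_subgroup[OF normal_subgroup_intersect[OF N M]] normal_imp_subgroup[OF mult_normal(1)[OF N M]]
  have "(group_index G (N \<inter> M) * group_index G (N <#> M)) * (card N * card M) =
    (group_index G (N \<inter> M) * card (N \<inter> M)) * (group_index G (N <#> M) * card (N <#> M))"
    unfolding card_mult_Int[OF N s(2)] by simp
  also have "\<dots> = (group_index G N * group_index G M) * (card N * card M)"
    using group_index_mult_card[OF s(1)] group_index_mult_card[OF s(2)] group_index_mult_card[OF s(3)]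
      group_index_mult_card[OF s(4)] by (metis mult.assoc mult.left_commute)
  finally show ?thesis using subgroup_card_pos[OF s(1)] subgroup_card_pos[OF s(2)] by simp
qed

text \<open>Take \<open>N\<close> of maximal order among the normal subgroups whose index is not a power of \<open>p\<close>. Then the
  normal subgroups above \<open>N\<close> have a least element \<open>N1\<close>, and the characters of \<open>G/N\<close> that are not characters
  of \<open>G/N1\<close> have kernel \<open>N\<close>. So the \<open>p'\<close>-part \<open>m\<close> of \<open>|G:N|\<close> divides their degrees, hence
  \<open>|G:N| - |G:N1|\<close>, hence \<open>|G:N1|\<close>.\<close>

lemma p_power_codegrees_imp_p_group:
  assumes p: "Factorial_Ring.prime (p::nat)" and cods: "\<And>\<chi>. \<chi> \<in> Irr G \<Longrightarrow> \<exists>j. cod G \<chi> = of_nat (p ^ j)"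
  shows "\<exists>k. Coset.order G = p ^ k"
proof -
  define B where "B N \<longleftrightarrow> N \<lhd> G \<and> \<not> (\<exists>j. group_index G N = p ^ j)" for N
  have "\<not> B N" for N
  proof
    assume "B N"
    moreover have "card M < Suc (Coset.order G)" if "B M" for M
      using that card_mono[OF finite_carrier subgroup.subset[OF normal_imp_subgroup]]
      by (auto simp: B_def Coset.order_def less_Suc_eq_le)
    ultimately obtain N where N: "B N" and max: "\<And>M. B M \<Longrightarrow> card M \<le> card N"
      using ex_has_greatest_nat[of B N card "Suc (Coset.order G)"] by (metis less_imp_le_nat)
    have NN: "N \<lhd> G" and nN: "\<not> (\<exists>j. group_index G N = p ^ j)" using N by (auto simp: B_def)
    define T where "T = {M. M \<lhd> G \<and> N \<subset> M}"
    have T: "M \<lhd> G" "N \<subset> M" "\<exists>j. group_index G M = p ^ j" if "M \<in> T" for M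
    proof -
      show M: "M \<lhd> G" "N \<subset> M" using that by (auto simp: T_def)
      have "card N < card M"
        using psubset_card_mono[OF finite_subset_carrier[OF normal_imp_subgroup[OF M(1)]] M(2)] .
      hence "\<not> B M" using max[of M] by auto
      thus "\<exists>j. group_index G M = p ^ j" using M by (auto simp: B_def)
    qed
    have "group_index G (carrier G) = 1"
      using group_index_mult_card[OF subgroup_self] order_pos by (simp add: Coset.order_def)
    hence "group_index G (carrier G) = p ^ 0" by simp
    hence "N \<noteq> carrier G" using nN by metis
    hence "carrier G \<in> T" using NN normal_self subgroup.subset[OF normal_imp_subgroup[OF NN]] by (auto simp: T_def)
    then obtain N1 where N1: "N1 \<in> T" and min: "\<And>M. M \<in> T \<Longrightarrow> card N1 \<le> card M"
      using ex_has_least_nat[of "\<lambda>M. M \<in> T" "carrier G" card] by blast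
    \<comment> \<open>Two members of \<open>T\<close> meeting exactly in \<open>N\<close> would make
      |G:N| a divisor of a product of two powers of \<open>p\<close>. So the intersection is again
      in \<open>T\<close>, and a member of least order lies in all others.\<close>
    have least: "N1 \<subseteq> M" if M: "M \<in> T" for M
    proof -
      have I: "N1 \<inter> M \<lhd> G" by (rule normal_subgroup_intersect[OF T(1)[OF N1] T(1)[OF M]])
      have "N1 \<inter> M \<noteq> N"
      proof
        assume eq: "N1 \<inter> M = N"
        obtain i j where ij: "group_index G N1 = p ^ i" "group_index G M = p ^ j" using T(3) N1 M by metis
        have "group_index G N * group_index G (N1 <#> M) = p ^ (i + j)"
          using index_Int[OF T(1)[OF N1] T(1)[OF M]] eq ij by (simp add: power_add)
        hence "group_index G N dvd p ^ (i + j)" by (metis dvd_triv_left)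
        thus False using nN divides_primepow_nat[OF p] by blast
      qed
      hence "N1 \<inter> M \<in> T" using I T(2)[OF N1] T(2)[OF M] by (auto simp: T_def)
      hence "card N1 \<le> card (N1 \<inter> M)" by (rule min)
      hence "N1 \<inter> M = N1" using card_seteq[OF finite_subset_carrier[OF normal_imp_subgroup[OF T(1)[OF N1]]]] by blast
      thus ?thesis by blast
    qed
    define R where "R = {\<chi> \<in> Irr G. N \<subseteq> char_ker G \<chi> \<and> \<not> N1 \<subseteq> char_ker G \<chi>}"
    define R1 where "R1 = {\<chi> \<in> Irr G. N1 \<subseteq> char_ker G \<chi>}"
    have split: "{\<chi>. \<chi> \<in> Irr G \<and> N \<subseteq> char_ker G \<chi>} = R \<union> R1" using T(2)[OF N1] by (auto simp: R_def R1_def)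
    have sum: "group_index G N = (\<Sum>\<chi>\<in>R. (char_degree \<chi>)\<^sup>2) + group_index G N1"
      using sum_degree_squares[OF NN] sum_degree_squares[OF T(1)[OF N1]] finite_Irr
      unfolding split by (subst (asm) sum.union_disjoint) (auto simp: R_def R1_def)
    have pos: "group_index G N \<noteq> 0" using group_index_pos[OF normal_imp_subgroup[OF NN]] by simp
    obtain e m where em: "group_index G N = p ^ e * m" "\<not> p dvd m"
      using multiplicity_decompose'[of "group_index G N" p] pos p by (metis not_prime_unit)
    have mdeg: "m dvd char_degree \<chi>" if \<chi>: "\<chi> \<in> R" for \<chi>
    proof -
      have I: "\<chi> \<in> Irr G" using \<chi> by (simp add: R_def)
      have "char_ker G \<chi> \<notin> T" using least \<chi> by (auto simp: R_def)
      hence "char_ker G \<chi> = N" using char_ker_normal[OF I] \<chi> by (auto simp: T_def R_def)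
      then obtain j where "group_index G N = p ^ j * char_degree \<chi>" using cods[OF I] cod_eq_iff[OF I] by metis
      hence "m dvd p ^ j * char_degree \<chi>" using em(1) by (metis dvd_triv_right)
      moreover have "coprime m (p ^ j)" using em(2) p by (metis coprime_commute coprime_power_right_iff prime_imp_coprime)
      ultimately show ?thesis using coprime_dvd_mult_right_iff by blast
    qed
    have "m dvd (\<Sum>\<chi>\<in>R. (char_degree \<chi>)\<^sup>2)"
      using mdeg by (intro dvd_sum) (simp add: power2_eq_square)
    moreover have "m dvd group_index G N" using em(1) by simp
    ultimately have "m dvd group_index G N1" using sum by (metis dvd_add_right_iff)
    then obtain i where "m dvd p ^ i" using T(3)[OF N1] by metis
    then obtain i' where "m = p ^ i'" using divides_primepow_nat[OF p] by blast
    hence "group_index G N = p ^ (e + i')" using em(1) by (simp add: power_add)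
    thus False using nN by blast
  qed
  hence "\<exists>j. group_index G {\<one>} = p ^ j" using one_is_normal by (auto simp: B_def)
  thus ?thesis using group_index_mult_card[OF triv_subgroup] by simp
qed

end

section \<open>Recovering the abelian group\<close>

context cod_counts
begin

lemma pow_eq_one_if_chars:
  assumes g: "g \<in> carrier G"
  shows "g [^] (p ^ n) = \<one>"
proof -
  have "g [^] (p ^ n) \<in> {\<one>}"
  proof (rule normal_eq_Inter_ker[OF one_is_normal])
    fix \<chi> assume \<chi>: "\<chi> \<in> Irr G"
    have "\<chi> \<in> lin_le n" using cods[OF \<chi>] \<chi> cod_le_linear[of n] n_pos by (auto simp: cod_le_def)
    moreover hence d: "char_degree \<chi> = 1" by (simp add: lin_le_def)
    ultimately have "\<chi> g ^ (p ^ n) = 1" using lin_le_iff[OF \<chi>] g by blast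
    thus "g [^] (p ^ n) \<in> char_ker G \<chi>"
      using linear_char_in_ker[OF \<chi> d] linear_char_pow[OF \<chi> d g] g by simp
  qed (use g in simp)
  thus ?thesis by simp
qed

text \<open>There are more characters of codegree at most \<open>p ^ n\<close> than at most
  \<open>p ^ (n - 1)\<close>. The bound on \<open>n\<close> keeps \<open>n - 1\<close> in the range
  of \<open>counts\<close>; at 0 only the trivial character is counted, which does not fit the
  formula.\<close>

lemma exists_order_p_n:
  assumes "n \<ge> 2"
  obtains x where "x \<in> carrier G" "ord x = p ^ n"
proof -
  have "card (lin_le (n - 1)) < card (lin_le n)"
    using counts[of "n - 1"] counts[of n] cod_le_linear[of n] cod_le_linear[of "n - 1"] assms p_gt_1
    by (simp add: cod_le_def power_strict_increasing_iff)
  then obtain \<chi> x where \<chi>: "\<chi> \<in> Irr G" and x: "x \<in> carrier G" "x [^] (p ^ (n - 1)) \<notin> char_ker G \<chi>"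
    by (rule exists_linear_char)
  have "x [^] (p ^ (n - 1)) \<noteq> \<one>"
    using x(2) subgroup.one_closed[OF normal_imp_subgroup[OF char_ker_normal[OF \<chi>]]] by auto
  hence nd: "\<not> ord x dvd p ^ (n - 1)" using pow_eq_id[OF x(1)] by simp
  have "ord x dvd p ^ n" using pow_eq_one_if_chars[OF x(1)] pow_eq_id[OF x(1)] by simp
  then obtain j where j: "j \<le> n" "ord x = p ^ j" using divides_primepow_nat[OF prime_p] by blast
  have "\<not> j \<le> n - 1" using nd j(2) le_imp_power_dvd by metis
  hence "j = n" using j(1) by simp
  thus ?thesis using that x(1) j(2) by simp
qed

text \<open>\<langle>x\<rangle> has index \<open>p\<close>, so any \<open>z\<close> outside it
  satisfies \<open>z [^] p = x [^] j\<close>. Here \<open>p\<close> divides \<open>j\<close>, and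
  dividing \<open>z\<close> by a \<open>p\<close>-th root of \<open>x [^] j\<close> in
  \<langle>x\<rangle> gives an element of order \<open>p\<close> outside
  \<langle>x\<rangle>.\<close>

lemma exists_complement:
  assumes x: "x \<in> carrier G" "ord x = p ^ n"
  obtains y where "y \<in> carrier G" "ord y = p" "\<And>(i::int) (j::int). x [^] i = y [^] j \<Longrightarrow> int p dvd j"
proof -
  interpret C: comm_group G by (rule abelian(1))
  define Y where "Y = cyclic_ext x {\<one>}"
  have Y: "Y = {x [^] (i::nat) | i. True}" using x by (auto simp: Y_def cyclic_ext_def)
  have Ysub: "subgroup Y G" unfolding Y_def by (rule cyclic_ext_subgroup[OF one_is_normal x(1)])
  have YN: "Y \<lhd> G" using C.subgroup_imp_normal[OF Ysub] .
  have red: "x [^] i = x [^] (i mod p ^ n)" for i :: nat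
    using pow_mod[OF x(1), of "p ^ n" i] pow_ord_eq_1[OF x(1)] x(2) by simp
  have "Y \<subseteq> (\<lambda>i. x [^] i) ` {..<p ^ n}"
    unfolding Y using red p_gt_1 by (auto intro!: image_eqI[of _ _ "_ mod p ^ n"])
  hence "card Y \<le> p ^ n" using surj_card_le[of "{..<p ^ n}" Y "\<lambda>i. x [^] i"] by simp
  hence "card Y < Coset.order G" using abelian(2) p_gt_1 by (metis le_less_trans less_add_one power_strict_increasing_iff)
  hence "Y \<noteq> carrier G" by (auto simp: Coset.order_def)
  then obtain z where z: "z \<in> carrier G" "z \<notin> Y" using subgroup.subset[OF Ysub] by auto
  have "card Y \<ge> p ^ n"
  proof -
    have "inj_on (\<lambda>i. x [^] i) {..<p ^ n}"
      by (rule inj_on_subset[OF ord_inj[OF x(1)]]) (auto simp: x(2))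
    thus ?thesis using card_inj_on_le[of "\<lambda>i. x [^] i" "{..<p ^ n}" Y] finite_subset_carrier[OF Ysub] by (auto simp: Y)
  qed
  hence "card Y = p ^ n" using \<open>card Y \<le> p ^ n\<close> by simp
  hence "group_index G Y = p" using group_index_mult_card[OF Ysub] abelian(2) p_gt_1 by simp
  hence "z [^] p \<in> Y" using pow_group_index_normal[OF YN z(1)] by simp
  then obtain j :: nat where j: "z [^] p = x [^] j" unfolding Y by auto
  \<comment> \<open>Otherwise \<open>z [^] (p ^ n) = \<one>\<close> would force
    \<open>x [^] (p ^ (n - 1)) = \<one>\<close>, against the order of \<open>x\<close>.\<close>
  have "p dvd j"
  proof (rule ccontr)
    assume nd: "\<not> p dvd j"
    have "x [^] (p ^ (n - 1) * j) = (x [^] j) [^] (p ^ (n - 1))" using x(1) by (simp add: nat_pow_pow mult.commute)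
    also have "\<dots> = z [^] (p * p ^ (n - 1))" unfolding j[symmetric] using z(1) by (simp add: nat_pow_pow)
    also have "p * p ^ (n - 1) = p ^ n" using n_pos by (metis Suc_diff_le diff_Suc_1 power_Suc Suc_eq_plus1 le_add_diff_inverse2)
    also have "z [^] (p ^ n) = \<one>" by (rule pow_eq_one_if_chars[OF z(1)])
    finally have "x [^] (p ^ (n - 1) * j) \<in> {\<one>}" by simp
    hence "x [^] (p ^ (n - 1)) \<in> {\<one>}"
      by (rule pow_mem_dvd[OF triv_subgroup x(1) _ refl nd])
    hence "p ^ n dvd p ^ (n - 1)" using pow_eq_id[OF x(1)] x(2) by simp
    thus False using p_gt_1 n_pos by (auto simp: dvd_power_iff_le)
  qed
  then obtain l where l: "j = p * l" by auto
  define y where "y = z \<otimes> inv (x [^] l)"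
  have y: "y \<in> carrier G" using z(1) x(1) by (simp add: y_def)
  have yY: "y \<notin> Y"
  proof
    assume "y \<in> Y"
    moreover have "x [^] l \<in> Y" unfolding Y by blast
    ultimately have "y \<otimes> x [^] l \<in> Y" by (rule subgroup.m_closed[OF Ysub])
    thus False using z x(1) by (simp add: y_def m_assoc)
  qed
  have yp: "y [^] p = \<one>"
  proof -
    have "y [^] p = z [^] p \<otimes> inv (x [^] l) [^] p" unfolding y_def using z(1) x(1) by (intro C.nat_pow_distrib) auto
    also have "inv (x [^] l) [^] p = inv (x [^] j)" using x(1) by (simp add: nat_pow_inv nat_pow_pow l mult.commute)
    finally show ?thesis using j x(1) by simp
  qed
  have one: "\<one> \<in> Y" by (rule subgroup.one_closed[OF Ysub])
  have "ord y = p"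
    using yp pow_eq_id[OF y] prime_p yY one y by (metis prime_nat_iff nat_pow_eone pow_ord_eq_1)
  moreover have "int p dvd j'" if eq: "x [^] i = y [^] j'" for i j' :: int
  proof (rule ccontr)
    assume nd: "\<not> int p dvd j'"
    have "y [^] j' = y [^] nat (j' mod int p)"
      using int_pow_eq[OF y, of "j' mod int p" j'] \<open>ord y = p\<close> p_gt_1
      by (simp add: dvd_minus_mod flip: int_pow_int)
    moreover have "x [^] i = x [^] nat (i mod int (p ^ n))"
      using int_pow_eq[OF x(1), of "i mod int (p ^ n)" i] x(2) p_gt_1
      by (simp add: dvd_minus_mod flip: int_pow_int)
    ultimately have "y [^] nat (j' mod int p) \<in> Y" using eq unfolding Y by auto
    moreover have "\<not> p dvd nat (j' mod int p)"
    proof -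
      have "\<not> int p dvd j' mod int p" using nd by (simp add: dvd_mod_iff)
      moreover have "int (nat (j' mod int p)) = j' mod int p" using p_gt_1 by simp
      ultimately show ?thesis by (metis int_dvd_int_iff)
    qed
    \<comment> \<open>An exponent not divisible by \<open>p\<close> would bring \<open>y\<close>
      itself into \<langle>x\<rangle>.\<close>
    ultimately have "y [^] (p ^ 0) \<in> Y" using pow_mem_dvd[OF Ysub y, of "nat (j' mod int p)" 0 "nat (j' mod int p)"] by simp
    thus False using yY y by simp
  qed
  ultimately show ?thesis using that y by blast
qed

text \<open>Exponents reduce modulo the orders of \<open>x\<close> and \<open>y\<close>, so sending
  \<open>(i, j)\<close> to \<open>x [^] i \<otimes> y [^] j\<close> is a homomorphism. It is
  injective by the independence of \<open>x\<close> and \<open>y\<close>, and the orders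
  agree.\<close>

theorem iso_integer_mod_groups:
  assumes n2: "n \<ge> 2"
  shows "integer_mod_group (p ^ n) \<times>\<times> integer_mod_group p \<cong> G"
proof -
  interpret C: comm_group G by (rule abelian(1))
  obtain x where x: "x \<in> carrier G" "ord x = p ^ n" using exists_order_p_n[OF n2] .
  obtain y where y: "y \<in> carrier G" "ord y = p" and ind: "\<And>(i::int) (j::int). x [^] i = y [^] j \<Longrightarrow> int p dvd j"
    using exists_complement[OF x] by blast
  have xm: "x [^] (i mod int (p ^ n)) = x [^] i" for i :: int
    using int_pow_eq[OF x(1), of "i mod int (p ^ n)" i] x(2) by (simp add: dvd_minus_mod)
  have ym: "y [^] (i mod int p) = y [^] i" for i :: int
    using int_pow_eq[OF y(1), of "i mod int p" i] y(2) by (simp add: dvd_minus_mod)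
  let ?B = "integer_mod_group (p ^ n) \<times>\<times> integer_mod_group p"
  define f where "f = (\<lambda>(i::int,j::int). x [^] i \<otimes> y [^] j)"
  have p0: "p \<noteq> 0" using p_gt_1 by simp
  have carB: "carrier ?B = {0..<int (p ^ n)} \<times> {0..<int p}" using p0 by (simp add: carrier_integer_mod_group)
  have m4: "(a \<otimes> b) \<otimes> (c \<otimes> d) = (a \<otimes> c) \<otimes> (b \<otimes> d)"
    if "a \<in> carrier G" "b \<in> carrier G" "c \<in> carrier G" "d \<in> carrier G" for a b c d
    using that by (simp add: m_assoc C.m_lcomm)
  have "f \<in> hom ?B G"
  proof (rule homI)
    fix u v assume "u \<in> carrier ?B" "v \<in> carrier ?B"
    obtain i j where u: "u = (i,j)" by (cases u)
    obtain i' j' where v: "v = (i',j')" by (cases v)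
    note uv = u v
    have "f (u \<otimes>\<^bsub>?B\<^esub> v) = x [^] (i + i') \<otimes> y [^] (j + j')"
      using xm[of "i + i'"] ym[of "j + j'"] by (simp add: uv f_def)
    also have "\<dots> = f u \<otimes> f v"
      using x(1) y(1) m4[of "x [^] i" "x [^] i'" "y [^] j" "y [^] j'"]
      by (simp add: uv f_def int_pow_mult)
    finally show "f (u \<otimes>\<^bsub>?B\<^esub> v) = f u \<otimes> f v" .
  qed (use x y in \<open>auto simp: f_def\<close>)
  moreover have "bij_betw f (carrier ?B) (carrier G)"
  proof -
    have inj: "inj_on f (carrier ?B)"
    proof (rule inj_onI)
      fix u v assume u: "u \<in> carrier ?B" and v: "v \<in> carrier ?B" and eq: "f u = f v"
      obtain i j where "u = (i,j)" by (cases u)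
      moreover obtain i' j' where "v = (i',j')" by (cases v)
      ultimately have uv: "u = (i,j)" "v = (i',j')" by auto
      have r: "0 \<le> i" "i < int (p ^ n)" "0 \<le> i'" "i' < int (p ^ n)" "0 \<le> j" "j < int p" "0 \<le> j'" "j' < int p"
        using u v unfolding carB uv by auto
      have e: "x [^] i \<otimes> y [^] j = x [^] i' \<otimes> y [^] j'" using eq by (simp add: uv f_def)
      have "x [^] i = (x [^] i \<otimes> y [^] j) \<otimes> inv (y [^] j)" using x(1) y(1) by (simp add: m_assoc)
      also have "\<dots> = x [^] i' \<otimes> (y [^] j' \<otimes> inv (y [^] j))" unfolding e using x(1) y(1) by (simp add: m_assoc)
      finally have "inv (x [^] i') \<otimes> x [^] i = inv (x [^] i') \<otimes> (x [^] i' \<otimes> (y [^] j' \<otimes> inv (y [^] j)))"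
        by (rule arg_cong)
      also have "\<dots> = y [^] j' \<otimes> inv (y [^] j)" using x(1) y(1) by (simp add: m_assoc[symmetric])
      finally have eq': "x [^] (i - i') = y [^] (j' - j)"
        using x(1) y(1) C.m_comm[of "x [^] i" "inv (x [^] i')"] by (simp add: int_pow_diff)
      hence "int p dvd j' - j" by (rule ind)
      hence "j' mod int p = j mod int p" by (simp add: mod_eq_dvd_iff)
      hence jj: "j' = j" using r by simp
      hence "x [^] (i - i') = \<one>" using eq' by simp
      hence "int (p ^ n) dvd i - i'" using int_pow_eq_id[OF x(1)] x(2) by simp
      hence "i mod int (p ^ n) = i' mod int (p ^ n)" by (simp add: mod_eq_dvd_iff)
      hence "i = i'" using r by simp
      thus "u = v" using uv jj by simp
    qed
    have "card (carrier ?B) = card (carrier G)"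
      using abelian(2) unfolding carB by (simp add: Coset.order_def card_cartesian_product nat_power_eq)
    hence "f ` carrier ?B = carrier G"
      using card_image[OF inj] hom_carrier[OF \<open>f \<in> hom ?B G\<close>] card_subset_eq[OF finite_carrier] by metis
    thus ?thesis using inj by (simp add: bij_betw_def)
  qed
  ultimately show ?thesis by (intro is_isoI) (simp add: iso_def)
qed

end

section \<open>The codegree counts of the given abelian group\<close>

context fin_group
begin

text \<open>Codegree at most \<open>p ^ i\<close> means that the subgroup of \<open>p ^ i\<close>-th
  powers lies in the kernel, so the count is the index of that subgroup, p^(n+1) / p^(n-i).\<close>

lemma abelian_cod_counts:
  assumes comm: "comm_group G" and p: "Factorial_Ring.prime p" and o: "Coset.order G = p ^ (n + 1)" and n: "n \<ge> 1"
    and pow: "\<And>i. 1 \<le> i \<Longrightarrow> i \<le> n \<Longrightarrow> card {g [^] (p ^ i) | g. g \<in> carrier G} = p ^ (n - i)"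
  shows "cod_counts G p (n + 1) n"
proof -
  interpret C: comm_group G by (rule comm)
  interpret fin_p_group G p "n + 1" using p o by unfold_locales auto
  have der: "derived G (carrier G) = {\<one>}" by (rule C.derived_eq_singleton) simp
  have d: "char_degree \<chi> = 1" if "\<chi> \<in> Irr G" for \<chi>
    using linear_iff_derived_le_ker[OF that] der by (simp add: char_ker_def)
  have idx: "\<exists>j. cod G \<chi> = of_nat (p ^ j) \<and> group_index G (char_ker G \<chi>) = p ^ j" if \<chi>: "\<chi> \<in> Irr G" for \<chi>
    using index_p_power[OF normal_imp_subgroup[OF char_ker_normal[OF \<chi>]]] cod_eq_iff[OF \<chi>] d[OF \<chi>]
    by (metis mult.right_neutral)
  note le = linear_char_p_power_iff[OF _ d p_gt_1]
  define P where "P i = {g [^] (p ^ i) | g. g \<in> carrier G}" for i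
  have Psub: "subgroup (P i) G" for i
  proof (rule finite_subgroupI)
    show "P i \<subseteq> carrier G" by (auto simp: P_def)
    have "\<one> = \<one> [^] (p ^ i)" by simp
    thus "\<one> \<in> P i" unfolding P_def by blast
    fix u v assume "u \<in> P i" "v \<in> P i"
    then obtain g h where gh: "g \<in> carrier G" "h \<in> carrier G" "u = g [^] (p ^ i)" "v = h [^] (p ^ i)" by (auto simp: P_def)
    hence "u \<otimes> v = (g \<otimes> h) [^] (p ^ i)" by (simp add: C.nat_pow_distrib)
    thus "u \<otimes> v \<in> P i" using gh unfolding P_def by blast
  qed
  have ker: "P i \<subseteq> char_ker G \<chi> \<longleftrightarrow> (\<forall>g\<in>carrier G. \<chi> g ^ (p ^ i) = 1)" if \<chi>: "\<chi> \<in> Irr G" for i \<chi>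
    unfolding P_def by (auto simp: linear_char_in_ker[OF \<chi> d[OF \<chi>]] linear_char_pow[OF \<chi> d[OF \<chi>]])
  have cPn: "\<chi> g ^ (p ^ n) = 1" if \<chi>: "\<chi> \<in> Irr G" and g: "g \<in> carrier G" for \<chi> g
  proof -
    have "card (P n) = 1" using pow[of n] n by (simp add: P_def)
    hence "P n = {\<one>}" using subgroup.one_closed[OF Psub] by (metis card_1_singletonE singletonD)
    thus ?thesis using ker[OF \<chi>, of n] g by (simp add: char_ker_def)
  qed
  show ?thesis
  proof
    fix \<chi> assume \<chi>: "\<chi> \<in> Irr G"
    obtain j where j: "cod G \<chi> = of_nat (p ^ j)" "group_index G (char_ker G \<chi>) = p ^ j" using idx[OF \<chi>] by blast
    thus "\<exists>j\<le>n. cod G \<chi> = of_nat (p ^ j)" using le[OF \<chi> \<chi> j(2), of n] cPn[OF \<chi>] by blast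
  next
    fix i assume i: "1 \<le> i" "i \<le> n"
    have "(\<exists>j\<le>i. cod G \<chi> = of_nat (p ^ j)) \<longleftrightarrow> P i \<subseteq> char_ker G \<chi>" if \<chi>: "\<chi> \<in> Irr G" for \<chi>
    proof -
      obtain j where j: "cod G \<chi> = of_nat (p ^ j)" "group_index G (char_ker G \<chi>) = p ^ j" using idx[OF \<chi>] by blast
      have "(\<exists>j\<le>i. cod G \<chi> = of_nat (p ^ j)) \<longleftrightarrow> j \<le> i"
        unfolding j(1) of_nat_eq_iff using p_gt_1 power_inject_exp by metis
      thus ?thesis using le[OF \<chi> \<chi> j(2)] ker[OF \<chi>] by simp
    qed
    hence "{\<chi> \<in> Irr G. \<exists>j\<le>i. cod G \<chi> = of_nat (p ^ j)} = {\<chi> \<in> Irr G. P i \<subseteq> char_ker G \<chi>}" by blast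
    moreover have PN: "P i \<lhd> G" using Psub C.subgroup_imp_normal by blast
    hence "card {\<chi> \<in> Irr G. P i \<subseteq> char_ker G \<chi>} = group_index G (P i)"
      by (rule card_Irr_ker_ge_derived) (use der subgroup.one_closed[OF Psub] in simp)
    moreover have "group_index G (P i) = p ^ (i + 1)"
    proof -
      have "group_index G (P i) * p ^ (n - i) = p ^ (i + 1) * p ^ (n - i)"
        using group_index_mult_card[OF Psub[of i]] pow[OF i] o i by (simp add: P_def power_add[symmetric] flip: power_Suc)
      thus ?thesis using p_gt_1 by simp
    qed
    ultimately show "card {\<chi> \<in> Irr G. \<exists>j\<le>i. cod G \<chi> = of_nat (p ^ j)} = p ^ (i + 1)" by simp
  qed (fact n)
qed

end

text \<open>Since \<open>i \<ge> 1\<close>, the second coordinate is killed; the first runs through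
  the multiples of \<open>p ^ i\<close> modulo \<open>p ^ n\<close>.\<close>

lemma card_powers_integer_mod_groups:
  fixes p n i :: nat
  assumes p: "p > 0" and i: "1 \<le> i" "i \<le> n"
  defines "B \<equiv> integer_mod_group (p ^ n) \<times>\<times> integer_mod_group p"
  shows "card {g [^]\<^bsub>B\<^esub> (p ^ i) | g. g \<in> carrier B} = p ^ (n - i)"
proof -
  have pow: "(a, b) [^]\<^bsub>B\<^esub> (k::nat) = (int k * a mod int (p ^ n), int k * b mod int p)" for a b k
  proof (induction k)
    case (Suc k)
    thus ?case by (simp add: B_def mod_add_right_eq mod_add_left_eq algebra_simps)
  qed (simp add: B_def)
  have carB: "carrier B = {0..<int (p ^ n)} \<times> {0..<int p}" using p by (simp add: B_def carrier_integer_mod_group)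
  have pn: "int (p ^ n) = int (p ^ i) * int (p ^ (n - i))" using i by (simp flip: power_add of_nat_mult)
  have z: "int (p ^ i) * b mod int p = 0" for b using i(1) by (cases i) auto
  have "{g [^]\<^bsub>B\<^esub> (p ^ i) | g. g \<in> carrier B} = (\<lambda>c. (int (p ^ i) * c, 0)) ` {0..<int (p ^ (n - i))}"
  proof (intro equalityI subsetI)
    fix u assume "u \<in> {g [^]\<^bsub>B\<^esub> (p ^ i) | g. g \<in> carrier B}"
    then obtain a b where u: "u = (a, b) [^]\<^bsub>B\<^esub> (p ^ i)" by auto
    have "u = (int (p ^ i) * (a mod int (p ^ (n - i))), 0)"
      unfolding u pow z unfolding pn by (simp only: mult_mod_right)
    thus "u \<in> (\<lambda>c. (int (p ^ i) * c, 0)) ` {0..<int (p ^ (n - i))}"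
      using p by (intro image_eqI[of _ _ "a mod int (p ^ (n - i))"]) auto
  next
    fix u assume "u \<in> (\<lambda>c. (int (p ^ i) * c, 0 :: int)) ` {0..<int (p ^ (n - i))}"
    then obtain c where "u = (int (p ^ i) * c, 0)" "c \<in> {0..<int (p ^ (n - i))}" by blast
    hence c: "u = (int (p ^ i) * c, 0)" "0 \<le> c" "c < int (p ^ (n - i))" by auto
    have "int (p ^ i) * c < int (p ^ n)" unfolding pn using c(3) p by (intro mult_strict_left_mono) auto
    hence "u = (c, 0) [^]\<^bsub>B\<^esub> (p ^ i)" using c(1,2) by (simp add: pow)
    moreover have "c < int (p ^ n)"
    proof -
      have "p ^ (n - i) \<le> p ^ n" using p by (intro power_increasing) auto
      thus ?thesis using c(3) by linarith
    qed
    hence "(c, 0) \<in> carrier B" unfolding carB using c(2) p by simp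
    ultimately show "u \<in> {g [^]\<^bsub>B\<^esub> (p ^ i) | g. g \<in> carrier B}" by blast
  qed
  moreover have "inj_on (\<lambda>c. (int (p ^ i) * c, 0 :: int)) {0..<int (p ^ (n - i))}" using p by (intro inj_onI) simp
  ultimately show ?thesis by (simp add: card_image nat_power_eq)
qed

text \<open>Only the order, commutativity and the numbers of \<open>p ^ i\<close>-th powers are
  carried along the isomorphism; the characters are those of \<open>A\<close> throughout.\<close>

lemma cod_counts_integer_mod_groups:
  fixes A (structure)
  assumes A: "group A" "A \<cong> integer_mod_group (p ^ n) \<times>\<times> integer_mod_group p" and p: "Factorial_Ring.prime p" and n: "n \<ge> 1"
  shows "cod_counts A p (n + 1) n"
proof -
  let ?B = "integer_mod_group (p ^ n) \<times>\<times> integer_mod_group p"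
  have p0: "p > 0" using p by (simp add: prime_gt_0_nat)
  have grpB: "group ?B" by (intro DirProd_group) auto
  have commB: "comm_group ?B"
  proof (rule group.group_comm_groupI[OF grpB])
    fix u v assume "u \<in> carrier ?B" "v \<in> carrier ?B"
    show "u \<otimes>\<^bsub>?B\<^esub> v = v \<otimes>\<^bsub>?B\<^esub> u" by (cases u; cases v) (simp add: add.commute)
  qed
  interpret B: comm_group ?B by (rule commB)
  interpret A: group A by (rule A(1))
  have comm: "comm_group A" by (rule B.iso_imp_comm_group[OF A.iso_sym[OF A(2)] A.is_monoid])
  obtain f where f: "f \<in> iso A ?B" using A(2) by (auto simp: is_iso_def)
  hence fh: "f \<in> hom A ?B" and fb: "bij_betw f (carrier A) (carrier ?B)" by (auto simp: iso_def)
  have carB: "carrier ?B = {0..<int (p ^ n)} \<times> {0..<int p}" using p0 by (simp add: carrier_integer_mod_group)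
  interpret A: fin_group A
  proof
    show "finite (carrier A)" using bij_betw_finite[OF fb] unfolding carB by simp
  qed
  have "Coset.order A = p ^ (n + 1)"
    using bij_betw_same_card[OF fb] unfolding carB by (simp add: Coset.order_def card_cartesian_product nat_power_eq)
  moreover have "card {g [^]\<^bsub>A\<^esub> (p ^ i) | g. g \<in> carrier A} = p ^ (n - i)" if i: "1 \<le> i" "i \<le> n" for i
  proof -
    have fp: "f (g [^]\<^bsub>A\<^esub> (p ^ i)) = f g [^]\<^bsub>?B\<^esub> (p ^ i)" if "g \<in> carrier A" for g
      using hom_nat_pow[OF fh that A(1) grpB] .
    have "f ` {g [^]\<^bsub>A\<^esub> (p ^ i) | g. g \<in> carrier A} = {g [^]\<^bsub>?B\<^esub> (p ^ i) | g. g \<in> carrier ?B}"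
    proof (intro equalityI subsetI)
      fix u assume "u \<in> f ` {g [^]\<^bsub>A\<^esub> (p ^ i) | g. g \<in> carrier A}"
      then obtain g where g: "g \<in> carrier A" "u = f g [^]\<^bsub>?B\<^esub> (p ^ i)" using fp by auto
      have "f g \<in> carrier ?B" using fb g(1) bij_betwE by blast
      thus "u \<in> {g [^]\<^bsub>?B\<^esub> (p ^ i) | g. g \<in> carrier ?B}" using g(2) by blast
    next
      fix u assume "u \<in> {g [^]\<^bsub>?B\<^esub> (p ^ i) | g. g \<in> carrier ?B}"
      then obtain h where h: "h \<in> carrier ?B" "u = h [^]\<^bsub>?B\<^esub> (p ^ i)" by blast
      then obtain g where g: "g \<in> carrier A" "h = f g" using fb by (metis bij_betw_imp_surj_on imageE)
      hence "u = f (g [^]\<^bsub>A\<^esub> (p ^ i))" using fp h(2) by simp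
      thus "u \<in> f ` {g [^]\<^bsub>A\<^esub> (p ^ i) | g. g \<in> carrier A}" using g(1) by blast
    qed
    moreover have "inj_on f {g [^]\<^bsub>A\<^esub> (p ^ i) | g. g \<in> carrier A}"
      by (rule inj_on_subset[OF bij_betw_imp_inj_on[OF fb]]) auto
    ultimately show ?thesis using card_powers_integer_mod_groups[OF p0 i] by (metis (lifting) card_image)
  qed
  ultimately show ?thesis by (rule A.abelian_cod_counts[OF comm p _ n])
qed

text \<open>Equality is wanted for every \<open>d\<close>, including those that are not codegrees.
  Finiteness of \<open>Irr\<close> ensures that multiplicity 0 means exactly this, as
  \<open>card\<close> is also 0 on infinite sets.\<close>

lemma pseudo_algebra_eq_imp_cod_mult_eq:
  assumes G: "fin_group G" and H: "fin_group H" and eq: "pseudo_algebra G = pseudo_algebra H"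
  shows "cod_mult G d = cod_mult H d"
proof -
  have "d \<in> Cod G \<longleftrightarrow> d \<in> Cod H"
    using arg_cong[OF eq, of "\<lambda>S. d \<in> fst ` S"] by (auto simp: pseudo_algebra_def image_iff)
  moreover have "cod_mult G d = cod_mult H d" if "d \<in> Cod G"
  proof -
    have "(d, cod_mult G d) \<in> pseudo_algebra H" unfolding eq[symmetric] using that by (auto simp: pseudo_algebra_def)
    thus ?thesis by (auto simp: pseudo_algebra_def)
  qed
  moreover have "cod_mult G d = 0 \<longleftrightarrow> d \<notin> Cod G" "cod_mult H d = 0 \<longleftrightarrow> d \<notin> Cod H"
    using fin_group.finite_Irr[OF G] fin_group.finite_Irr[OF H] by (auto simp: cod_mult_def Cod_def)
  ultimately show ?thesis by metis
qed

lemma card_Irr_cod_in: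
  assumes "fin_group G" "finite S"
  shows "card {\<chi> \<in> Irr G. cod G \<chi> \<in> S} = (\<Sum>d\<in>S. cod_mult G d)"
proof -
  have "{\<chi> \<in> Irr G. cod G \<chi> \<in> S} = (\<Union>d\<in>S. {\<chi> \<in> Irr G. cod G \<chi> = d})" by auto
  thus ?thesis unfolding cod_mult_def
    using fin_group.finite_Irr[OF assms(1)] assms(2) by (simp only:, subst card_UN_disjoint) auto
qed

theorem theorem1p2:
  fixes p n :: nat
    and A :: "('a, 'c) monoid_scheme"
    and G :: "('b, 'd) monoid_scheme"
  assumes "Factorial_Ring.prime p" and "n \<ge> 3"
    and "group A" and "A \<cong> integer_mod_group (p ^ n) \<times>\<times> integer_mod_group p"
    and "group G" and "finite (carrier G)"
    and "pseudo_algebra G = pseudo_algebra A"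
  shows "(\<exists>k. Coset.order G = p ^ k) \<and>
    (G \<cong> A \<or>
     (group_index G (commutator_subgroup G) = p\<^sup>2 \<and> p > 2 \<and>
      \<not> cyclic_group (G\<lparr>carrier := group_center G\<rparr>) \<and>
      (\<exists>!M. maximal_subgroup M (G\<lparr>carrier := commutator_subgroup G\<rparr>) \<and> M \<lhd> G \<and>
            \<not> comm_group (G Mod M) \<and> Coset.order (G Mod M) = p ^ 3 \<and>
            group_exponent (G Mod M) = p)))"
proof -
  interpret A: cod_counts A p "n + 1" n
    using cod_counts_integer_mod_groups[OF assms(3,4,1)] assms(2) by simp
  interpret G: fin_group G using assms(5,6) by (simp add: fin_group_def fin_group_axioms_def)
  note mult = pseudo_algebra_eq_imp_cod_mult_eq[OF G.fin_group_axioms A.fin_group_axioms assms(7)]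
  have cods: "\<exists>j\<le>n. cod G \<chi> = of_nat (p ^ j)" if "\<chi> \<in> Irr G" for \<chi>
  proof -
    have "cod G \<chi> \<in> Cod G" using that by (simp add: Cod_def)
    moreover have "Cod G = Cod A"
      using arg_cong[OF assms(7), of "\<lambda>S. fst ` S"] by (simp add: pseudo_algebra_def image_Collect)
    ultimately show ?thesis using A.cods by (auto simp: Cod_def)
  qed
  obtain k where k: "Coset.order G = p ^ k"
    using G.p_power_codegrees_imp_p_group[OF assms(1)] cods by blast
  interpret G: cod_counts G p k n
  proof
    fix i assume i: "1 \<le> i" "i \<le> n"
    \<comment> \<open>The cumulative counts are recovered as sums of multiplicities over this finite
      set, and those agree for the two groups.\<close>
    define S :: "complex set" where "S = (\<lambda>j. of_nat (p ^ j)) ` {..i}"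
    have "card {\<chi> \<in> Irr G. cod G \<chi> \<in> S} = card {\<chi> \<in> Irr A. cod A \<chi> \<in> S}"
      using card_Irr_cod_in[OF G.fin_group_axioms, of S] card_Irr_cod_in[OF A.fin_group_axioms, of S] mult
      by (simp add: S_def)
    also have "{\<chi> \<in> Irr A. cod A \<chi> \<in> S} = {\<chi> \<in> Irr A. \<exists>j\<le>i. cod A \<chi> = of_nat (p ^ j)}" by (auto simp: S_def)
    also have "card \<dots> = p ^ (i + 1)" by (rule A.counts[OF i])
    also have "{\<chi> \<in> Irr G. cod G \<chi> \<in> S} = {\<chi> \<in> Irr G. \<exists>j\<le>i. cod G \<chi> = of_nat (p ^ j)}" by (auto simp: S_def)
    finally show "card {\<chi> \<in> Irr G. \<exists>j\<le>i. cod G \<chi> = of_nat (p ^ j)} = p ^ (i + 1)" .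
  next
    show "1 \<le> n" using assms(2) by simp
  qed (fact assms(1) k cods)+
  have "G \<cong> integer_mod_group (p ^ n) \<times>\<times> integer_mod_group p"
    by (rule group.iso_sym[OF DirProd_group G.iso_integer_mod_groups]) (use assms(2) in auto)
  also have "\<dots> \<cong> A" by (rule A.iso_sym[OF assms(4)])
  finally have "G \<cong> A" .
  thus ?thesis using k by blast
qed

end
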